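(* Let $H$ be a Hopf algebra with invertible antipode, $B$ a $\sigma$-twisted left $H$-module algebra, $(\Omega^1(H),\mathrm{d}_H)$ a bicovariant FODC on $H$ and $(\Omega^1(B),\mathrm{d}_B)$ a $\sigma$-twisted $H$-module FODC on $B$. Then the quantum principal bundle on the crossed product algebra $B\#_\sigma H$ given by the crossed product calculus $(\Omega^1(B\#_\sigma H),\mathrm{d}_{\#_\sigma})$ and $(\Omega^1(H),\mathrm{d}_H)$ admits a strong connection $$c:(B\#_\sigma H)\otimes{}^{\mathrm{co}H}\Omega^1(H)\to\Omega^1(B\#_\sigma H),\qquad (b\otimes h)\otimes\gamma\mapsto b\otimes h\gamma.$$
   Context: Everything is over a field $\Bbbk$; algebras are associative and unital. Sweedler notation: $\Delta(h)=h_1\otimes h_2$; right coactions $m\mapsto m_0\otimes m_1$; left coactions $m\mapsto m_{-1}\otimes m_0$, with $m_{-2}\otimes m_{-1}\otimes m_0$ the iterated left coaction. $B$ is a $\sigma$-twisted left $H$-module algebra: there are a linear map $\cdot:H\otimes B\to B$ (a measure) with $h\cdot 1_B=\varepsilon(h)1_B$, $h\cdot(bb')=(h_1\cdot b)(h_2\cdot b')$, and a convolution invertible linear map $\sigma:H\otimes H\to B$ with convolution inverse $\sigma^{-1}$, such that $1_H\cdot b=b$, $h\cdot(h'\cdot b)=\sigma(h_1\otimes h'_1)(h_2h'_2\cdot b)\sigma^{-1}(h_3\otimes h'_3)$, $\sigma(h\otimes1_H)=\varepsilon(h)1_B=\sigma(1_H\otimes h)$ and $(h_1\cdot\sigma(h'_1\otimes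 h''_1))\sigma(h_2\otimes h'_2h''_2)=\sigma(h_1\otimes h'_1)\sigma(h_2h'_2\otimes h'')$. The crossed product algebra $B\#_\sigma H$ is $B\otimes H$ with unit $1_B\otimes1_H$ and product $(b\otimes h)(b'\otimes h')=b(h_1\cdot b')\sigma(h_2\otimes h'_1)\otimes h_3h'_2$; it is a right $H$-comodule algebra via $\mathrm{Id}_B\otimes\Delta$, with coinvariant subalgebra $B\otimes\Bbbk1_H\cong B$. A FODC on an algebra $A$ is a pair $(\Omega^1(A),\mathrm{d}_A)$ with $\Omega^1(A)$ an $A$-bimodule, $\mathrm{d}_A:A\to\Omega^1(A)$ linear satisfying the Leibniz rule, and $\Omega^1(A)=\mathrm{span}_\Bbbk\{a\,\mathrm{d}_Ab\}$. A FODC on $H$ is bicovariant if $\Omega^1(H)$ is an $H$-bicomodule with coactions compatible with the $H$-bimodule structure and $\mathrm{d}_H$ is left and right $H$-colinear; ${}^{\mathrm{co}H}\Omega^1(H)=\{\gamma:\gamma_{-1}\otimes\gamma_0=1_H\otimes\gamma\}$. $(\Omega^1(B),\mathrm{d}_B)$ is a $\sigma$-twisted $H$-module FODC if there is a linear map $\cdot:H\otimes\Omega^1(B)\to\Omega^1(B)$ with $h\cdot(b\,\mathrm{d}_Bb')=(h_1\cdot b)(h_2\cdot\mathrm{d}_Bb')$, $\mathrm{d}_B(h\cdot b)=h\cdot\mathrm{d}_Bb$ and $\mathrm{d}_B\circ\sigma=0$. The crossed product calculus is the right $H$-covariant FODC $\Omega^1(B\#_\sigma H)=(\Omega^1(B)\otimes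 H)\oplus(B\otimes\Omega^1(H))$, $\mathrm{d}_{\#_\sigma}(b\otimes h)=\mathrm{d}_Bb\otimes h+b\otimes\mathrm{d}_Hh$, with actions $(b'\otimes h')\cdot(\beta\otimes h+b\otimes\gamma)=b'(h'_1\cdot\beta)\sigma(h'_2\otimes h_1)\otimes h'_3h_2+b'(h'_1\cdot b)\sigma(h'_2\otimes\gamma_{-1})\otimes h'_3\gamma_0$, $(\beta\otimes h+b\otimes\gamma)\cdot(b'\otimes h')=\beta(h_1\cdot b')\sigma(h_2\otimes h'_1)\otimes h_3h'_2+b(\gamma_{-2}\cdot b')\sigma(\gamma_{-1}\otimes h'_1)\otimes\gamma_0h'_2$, and right coaction $\beta\otimes h+b\otimes\gamma\mapsto\beta\otimes h_1\otimes h_2+b\otimes\gamma_0\otimes\gamma_1$. Together with $(\Omega^1(H),\mathrm{d}_H)$ it is a quantum principal bundle: the vertical map $\mathrm{ver}:\Omega^1(B\#_\sigma H)\to(B\#_\sigma H)\otimes{}^{\mathrm{co}H}\Omega^1(H)$, $a\,\mathrm{d}_{\#_\sigma}a'\mapsto aa'_0\otimes S(a'_1)\mathrm{d}_Ha'_2$, is well-defined and surjective with kernel the horizontal forms $\Omega^1(B)\otimes H$. A connection is a left $B\#_\sigma H$-linear, right $H$-colinear map $c:(B\#_\sigma H)\otimes{}^{\mathrm{co}H}\Omega^1(H)\to\Omega^1(B\#_\sigma H)$ with $\mathrm{ver}\circ c=\mathrm{Id}$; on the source, $B\#_\sigma H$ acts on the first factor and $H$ coacts diagonally, ${}^{\mathrm{co}H}\Omega^1(H)$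 carrying the restriction of the right $H$-coaction of $\Omega^1(H)$. It is strong if $(\mathrm{Id}-c\circ\mathrm{ver})\mathrm{d}_{\#_\sigma}(B\#_\sigma H)\subseteq\Omega^1(B)(B\#_\sigma H)$, where $\Omega^1(B)$ is identified with $\Omega^1(B)\otimes\Bbbk1_H$. *)

theory Defs
  imports "HOL-Algebra.Module"
begin

section \<open>Linear algebra over a field\<close>

text \<open>All vector spaces are records of type \<^typ>\<open>('k, 'm) module\<close> (or extensions thereof) over a
  ring record \<open>K\<close>.  The fields \<open>mult\<close> and \<open>one\<close> only carry meaning when the space is an algebra.\<close>

locale kspace = field K + module K M for K (structure) and M (structure)

definition linear_map ::
  "('k, 'r) ring_scheme \<Rightarrow> ('k, 'm, 'x) module_scheme \<Rightarrow> ('k, 'n, 'y) module_scheme \<Rightarrow> ('m \<Rightarrow> 'n) \<Rightarrow> bool"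
  where "linear_map K M N f \<longleftrightarrow>
    f \<in> carrier M \<rightarrow> carrier N \<and>
    (\<forall>x\<in>carrier M. \<forall>y\<in>carrier M. f (x \<oplus>\<^bsub>M\<^esub> y) = f x \<oplus>\<^bsub>N\<^esub> f y) \<and>
    (\<forall>a\<in>carrier K. \<forall>x\<in>carrier M. f (a \<odot>\<^bsub>M\<^esub> x) = a \<odot>\<^bsub>N\<^esub> f x)"

definition bilinear_map ::
  "('k, 'r) ring_scheme \<Rightarrow> ('k, 'm, 'x) module_scheme \<Rightarrow> ('k, 'n, 'y) module_scheme \<Rightarrow>
   ('k, 'p, 'z) module_scheme \<Rightarrow> ('m \<Rightarrow> 'n \<Rightarrow> 'p) \<Rightarrow> bool"
  where "bilinear_map K M N P f \<longleftrightarrow>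
    (\<forall>x\<in>carrier M. linear_map K N P (f x)) \<and>
    (\<forall>y\<in>carrier N. linear_map K M P (\<lambda>x. f x y))"

definition kspan :: "('k, 'r) ring_scheme \<Rightarrow> ('k, 'm, 'x) module_scheme \<Rightarrow> 'm set \<Rightarrow> 'm set"
  where "kspan K M S = \<Inter>{N. submodule N K M \<and> S \<subseteq> N}"

definition direct_sum ::
  "('k, 'm, 'x) module_scheme \<Rightarrow> ('k, 'n, 'y) module_scheme \<Rightarrow> ('k, 'm \<times> 'n) module"
  where "direct_sum M N =
    \<lparr>carrier = carrier M \<times> carrier N,
     mult = undefined, one = undefined,
     zero = (\<zero>\<^bsub>M\<^esub>, \<zero>\<^bsub>N\<^esub>),
     add = (\<lambda>x y. (fst x \<oplus>\<^bsub>M\<^esub> fst y, snd x \<oplus>\<^bsub>N\<^esub> snd y)),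
     smult = (\<lambda>a x. (a \<odot>\<^bsub>M\<^esub> fst x, a \<odot>\<^bsub>N\<^esub> snd x))\<rparr>"

subsection \<open>Tensor products\<close>

text \<open>The tensor product is presented by generators and relations.  A list
  \<open>[(m1, n1), \<dots>, (mk, nk)]\<close> stands for the finite sum of the \<open>mi \<otimes> ni\<close>; two lists represent the same
  tensor iff they are related by the congruence (for concatenation) generated by commutativity
  and the bilinearity relations.  Negatives need no generator of their own: \<open>(- m) \<otimes> n\<close> is the
  negative of \<open>m \<otimes> n\<close> because \<open>0 \<otimes> n\<close> is related to the empty sum.\<close>

inductive tensor_rel ::
  "('k, 'r) ring_scheme \<Rightarrow> ('k, 'm, 'x) module_scheme \<Rightarrow> ('k, 'n, 'y) module_scheme \<Rightarrow>
   ('m \<times> 'n) list \<Rightarrow> ('m \<times> 'n) list \<Rightarrow> bool"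
  for K :: "('k, 'r) ring_scheme" and M :: "('k, 'm, 'x) module_scheme"
    and N :: "('k, 'n, 'y) module_scheme"
  where
    refl: "xs \<in> lists (carrier M \<times> carrier N) \<Longrightarrow> tensor_rel K M N xs xs"
  | sym: "tensor_rel K M N xs ys \<Longrightarrow> tensor_rel K M N ys xs"
  | trans: "tensor_rel K M N xs ys \<Longrightarrow> tensor_rel K M N ys zs \<Longrightarrow> tensor_rel K M N xs zs"
  | append: "tensor_rel K M N xs xs' \<Longrightarrow> tensor_rel K M N ys ys' \<Longrightarrow>
      tensor_rel K M N (xs @ ys) (xs' @ ys')"
  | commute: "xs \<in> lists (carrier M \<times> carrier N) \<Longrightarrow> ys \<in> lists (carrier M \<times> carrier N) \<Longrightarrow>
      tensor_rel K M N (xs @ ys) (ys @ xs)"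
  | add_left: "m \<in> carrier M \<Longrightarrow> m' \<in> carrier M \<Longrightarrow> n \<in> carrier N \<Longrightarrow>
      tensor_rel K M N [(m \<oplus>\<^bsub>M\<^esub> m', n)] [(m, n), (m', n)]"
  | add_right: "m \<in> carrier M \<Longrightarrow> n \<in> carrier N \<Longrightarrow> n' \<in> carrier N \<Longrightarrow>
      tensor_rel K M N [(m, n \<oplus>\<^bsub>N\<^esub> n')] [(m, n), (m, n')]"
  | smult: "a \<in> carrier K \<Longrightarrow> m \<in> carrier M \<Longrightarrow> n \<in> carrier N \<Longrightarrow>
      tensor_rel K M N [(a \<odot>\<^bsub>M\<^esub> m, n)] [(m, a \<odot>\<^bsub>N\<^esub> n)]"
  | zero: "n \<in> carrier N \<Longrightarrow> tensor_rel K M N [(\<zero>\<^bsub>M\<^esub>, n)] []"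

definition tensor_class ::
  "('k, 'r) ring_scheme \<Rightarrow> ('k, 'm, 'x) module_scheme \<Rightarrow> ('k, 'n, 'y) module_scheme \<Rightarrow>
   ('m \<times> 'n) list \<Rightarrow> ('m \<times> 'n) list set"
  where "tensor_class K M N xs = {ys. tensor_rel K M N xs ys}"

definition tensor ::
  "('k, 'r) ring_scheme \<Rightarrow> ('k, 'm, 'x) module_scheme \<Rightarrow> ('k, 'n, 'y) module_scheme \<Rightarrow>
   ('k, ('m \<times> 'n) list set) module"
  where "tensor K M N =
    \<lparr>carrier = tensor_class K M N ` lists (carrier M \<times> carrier N),
     mult = undefined, one = undefined,
     zero = tensor_class K M N [],
     add = (\<lambda>X Y. \<Union>xs\<in>X. \<Union>ys\<in>Y. tensor_class K M N (xs @ ys)),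
     smult = (\<lambda>a X. \<Union>xs\<in>X. tensor_class K M N (map (\<lambda>(m, n). (a \<odot>\<^bsub>M\<^esub> m, n)) xs))\<rparr>"

definition pure_tensor ::
  "('k, 'r) ring_scheme \<Rightarrow> ('k, 'm, 'x) module_scheme \<Rightarrow> ('k, 'n, 'y) module_scheme \<Rightarrow>
   'm \<Rightarrow> 'n \<Rightarrow> ('m \<times> 'n) list set"
  where "pure_tensor K M N m n = tensor_class K M N [(m, n)]"

text \<open>The value on \<open>X\<close> of the linear map into \<open>P\<close> induced by \<open>f\<close>, that is, the sum of the
  \<open>f mi ni\<close> if \<open>X\<close> is the sum of the \<open>mi \<otimes> ni\<close>.  It is independent of the chosen representative
  when \<open>f\<close> is bilinear, which is the case in all uses below.\<close>

definition tensor_lift ::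
  "('k, 'p, 'z) module_scheme \<Rightarrow> ('m \<Rightarrow> 'n \<Rightarrow> 'p) \<Rightarrow> ('m \<times> 'n) list set \<Rightarrow> 'p"
  where "tensor_lift P f X =
    foldr (\<lambda>(m, n) p. f m n \<oplus>\<^bsub>P\<^esub> p) (SOME xs. xs \<in> X) \<zero>\<^bsub>P\<^esub>"

definition tensor_map ::
  "('k, 'r) ring_scheme \<Rightarrow> ('k, 'p, 'x) module_scheme \<Rightarrow> ('k, 'q, 'y) module_scheme \<Rightarrow>
   ('m \<Rightarrow> 'p) \<Rightarrow> ('n \<Rightarrow> 'q) \<Rightarrow> ('m \<times> 'n) list set \<Rightarrow> ('p \<times> 'q) list set"
  where "tensor_map K P Q f g =
    tensor_lift (tensor K P Q) (\<lambda>m n. pure_tensor K P Q (f m) (g n))"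

text \<open>The product \<open>(m \<otimes> n) (m' \<otimes> n') = f m m' \<otimes> g n n'\<close>.\<close>

definition tensor_map2 ::
  "('k, 'r) ring_scheme \<Rightarrow> ('k, 'p, 'x) module_scheme \<Rightarrow> ('k, 'q, 'y) module_scheme \<Rightarrow>
   ('m \<Rightarrow> 'm1 \<Rightarrow> 'p) \<Rightarrow> ('n \<Rightarrow> 'n1 \<Rightarrow> 'q) \<Rightarrow>
   ('m \<times> 'n) list set \<Rightarrow> ('m1 \<times> 'n1) list set \<Rightarrow> ('p \<times> 'q) list set"
  where "tensor_map2 K P Q f g X Y =
    tensor_lift (tensor K P Q)
      (\<lambda>m n. tensor_lift (tensor K P Q) (\<lambda>m' n'. pure_tensor K P Q (f m m') (g n n')) Y) X"

text \<open>The canonical isomorphism from \<open>(L \<otimes> M) \<otimes> N\<close> to \<open>L \<otimes> (M \<otimes> N)\<close>.\<close>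

definition tensor_assoc ::
  "('k, 'r) ring_scheme \<Rightarrow> ('k, 'l, 'x) module_scheme \<Rightarrow> ('k, 'm, 'y) module_scheme \<Rightarrow>
   ('k, 'n, 'z) module_scheme \<Rightarrow>
   (('l \<times> 'm) list set \<times> 'n) list set \<Rightarrow> ('l \<times> ('m \<times> 'n) list set) list set"
  where "tensor_assoc K L M N =
    tensor_lift (tensor K L (tensor K M N))
      (\<lambda>t n. tensor_lift (tensor K L (tensor K M N))
        (\<lambda>l m. pure_tensor K L (tensor K M N) l (pure_tensor K M N m n)) t)"

text \<open>Three-legged Sweedler sums: the sum of the \<open>F x1 x2 x3\<close>, where \<open>x1 \<otimes> x2 \<otimes> x3\<close> denotes
  \<open>(\<Delta> \<otimes> id) (\<delta> x)\<close>.  With \<open>\<delta> = \<Delta>\<close> this is \<open>h1 \<otimes> h2 \<otimes> h3\<close>, with \<open>\<delta>\<close> a left coaction it is the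
  iterated left coaction.\<close>

definition sweedler3 ::
  "('k, 'p, 'z) module_scheme \<Rightarrow> ('h \<Rightarrow> ('h \<times> 'h) list set) \<Rightarrow> ('m \<Rightarrow> ('h \<times> 'm) list set) \<Rightarrow>
   ('h \<Rightarrow> 'h \<Rightarrow> 'm \<Rightarrow> 'p) \<Rightarrow> 'm \<Rightarrow> 'p"
  where "sweedler3 P \<Delta> \<delta> F x =
    tensor_lift P (\<lambda>u x3. tensor_lift P (\<lambda>x1 x2. F x1 x2 x3) (\<Delta> u)) (\<delta> x)"

section \<open>Hopf algebras, comodules and bimodules\<close>

text \<open>The locale \<open>algebra\<close> of the library is restricted to commutative algebras.\<close>

locale k_algebra = kspace K A + ring A for K (structure) and A (structure) +
  assumes smult_mult_left:
      "\<lbrakk>a \<in> carrier K; x \<in> carrier A; y \<in> carrier A\<rbrakk> \<Longrightarrow>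
        a \<odot>\<^bsub>A\<^esub> (x \<otimes>\<^bsub>A\<^esub> y) = (a \<odot>\<^bsub>A\<^esub> x) \<otimes>\<^bsub>A\<^esub> y"
    and smult_mult_right:
      "\<lbrakk>a \<in> carrier K; x \<in> carrier A; y \<in> carrier A\<rbrakk> \<Longrightarrow>
        a \<odot>\<^bsub>A\<^esub> (x \<otimes>\<^bsub>A\<^esub> y) = x \<otimes>\<^bsub>A\<^esub> (a \<odot>\<^bsub>A\<^esub> y)"

record ('k, 'h) hopf = "('k, 'h) module" +
  comult :: "'h \<Rightarrow> ('h \<times> 'h) list set"
  counit :: "'h \<Rightarrow> 'k"
  antipode :: "'h \<Rightarrow> 'h"

locale hopf_algebra = k_algebra K H
  for K (structure) and H :: "('k, 'h, 'x) hopf_scheme" (structure) +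
  assumes comult_linear: "linear_map K H (tensor K H H) (comult H)"
    and counit_closed: "counit H \<in> carrier H \<rightarrow> carrier K"
    and counit_add: "\<lbrakk>x \<in> carrier H; y \<in> carrier H\<rbrakk> \<Longrightarrow>
      counit H (x \<oplus>\<^bsub>H\<^esub> y) = counit H x \<oplus>\<^bsub>K\<^esub> counit H y"
    and counit_smult: "\<lbrakk>a \<in> carrier K; x \<in> carrier H\<rbrakk> \<Longrightarrow>
      counit H (a \<odot>\<^bsub>H\<^esub> x) = a \<otimes>\<^bsub>K\<^esub> counit H x"
    and coassoc: "x \<in> carrier H \<Longrightarrow>
      tensor_assoc K H H H (tensor_map K (tensor K H H) H (comult H) (\<lambda>y. y) (comult H x))
      = tensor_map K H (tensor K H H) (\<lambda>y. y) (comult H) (comult H x)"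
    and counit_left: "x \<in> carrier H \<Longrightarrow>
      tensor_lift H (\<lambda>x1 x2. counit H x1 \<odot>\<^bsub>H\<^esub> x2) (comult H x) = x"
    and counit_right: "x \<in> carrier H \<Longrightarrow>
      tensor_lift H (\<lambda>x1 x2. counit H x2 \<odot>\<^bsub>H\<^esub> x1) (comult H x) = x"
    and comult_mult: "\<lbrakk>x \<in> carrier H; y \<in> carrier H\<rbrakk> \<Longrightarrow>
      comult H (x \<otimes>\<^bsub>H\<^esub> y) = tensor_map2 K H H (mult H) (mult H) (comult H x) (comult H y)"
    and comult_one: "comult H \<one>\<^bsub>H\<^esub> = pure_tensor K H H \<one>\<^bsub>H\<^esub> \<one>\<^bsub>H\<^esub>"
    and counit_mult: "\<lbrakk>x \<in> carrier H; y \<in> carrier H\<rbrakk> \<Longrightarrow>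
      counit H (x \<otimes>\<^bsub>H\<^esub> y) = counit H x \<otimes>\<^bsub>K\<^esub> counit H y"
    and counit_one: "counit H \<one>\<^bsub>H\<^esub> = \<one>\<^bsub>K\<^esub>"
    and antipode_linear: "linear_map K H H (antipode H)"
    and antipode_left: "x \<in> carrier H \<Longrightarrow>
      tensor_lift H (\<lambda>x1 x2. antipode H x1 \<otimes>\<^bsub>H\<^esub> x2) (comult H x) = counit H x \<odot>\<^bsub>H\<^esub> \<one>\<^bsub>H\<^esub>"
    and antipode_right: "x \<in> carrier H \<Longrightarrow>
      tensor_lift H (\<lambda>x1 x2. x1 \<otimes>\<^bsub>H\<^esub> antipode H x2) (comult H x) = counit H x \<odot>\<^bsub>H\<^esub> \<one>\<^bsub>H\<^esub>"

locale left_comodule = kspace K M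
  for K (structure) and H :: "('k, 'h, 'x) hopf_scheme" and M (structure) and \<delta> +
  assumes coact_linear: "linear_map K M (tensor K H M) \<delta>"
    and coact_coassoc: "m \<in> carrier M \<Longrightarrow>
      tensor_assoc K H H M (tensor_map K (tensor K H H) M (comult H) (\<lambda>y. y) (\<delta> m))
      = tensor_map K H (tensor K H M) (\<lambda>y. y) \<delta> (\<delta> m)"
    and coact_counit: "m \<in> carrier M \<Longrightarrow>
      tensor_lift M (\<lambda>h m. counit H h \<odot>\<^bsub>M\<^esub> m) (\<delta> m) = m"

locale right_comodule = kspace K M
  for K (structure) and H :: "('k, 'h, 'x) hopf_scheme" and M (structure) and \<delta> +
  assumes coact_linear: "linear_map K M (tensor K M H) \<delta>"
    and coact_coassoc: "m \<in> carrier M \<Longrightarrow>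
      tensor_assoc K M H H (tensor_map K (tensor K M H) H \<delta> (\<lambda>y. y) (\<delta> m))
      = tensor_map K M (tensor K H H) (\<lambda>y. y) (comult H) (\<delta> m)"
    and coact_counit: "m \<in> carrier M \<Longrightarrow>
      tensor_lift M (\<lambda>m h. counit H h \<odot>\<^bsub>M\<^esub> m) (\<delta> m) = m"

locale bicomodule = L: left_comodule K H M \<delta>L + R: right_comodule K H M \<delta>R
  for K (structure) and H :: "('k, 'h, 'x) hopf_scheme" and M (structure) and \<delta>L and \<delta>R +
  assumes coact_commute: "m \<in> carrier M \<Longrightarrow>
      tensor_assoc K H M H (tensor_map K (tensor K H M) H \<delta>L (\<lambda>y. y) (\<delta>R m))
      = tensor_map K H (tensor K M H) (\<lambda>y. y) \<delta>R (\<delta>L m)"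

record ('k, 'm, 'a) bimodule = "('k, 'm) module" +
  lact :: "'a \<Rightarrow> 'm \<Rightarrow> 'm"
  ract :: "'m \<Rightarrow> 'a \<Rightarrow> 'm"

locale algebra_bimodule = k_algebra K A + \<Gamma>: kspace K \<Gamma>
  for K (structure) and A (structure) and \<Gamma> :: "('k, 'm, 'a, 'y) bimodule_scheme" (structure) +
  assumes lact_bilinear: "bilinear_map K A \<Gamma> \<Gamma> (lact \<Gamma>)"
    and ract_bilinear: "bilinear_map K \<Gamma> A \<Gamma> (ract \<Gamma>)"
    and lact_one: "\<gamma> \<in> carrier \<Gamma> \<Longrightarrow> lact \<Gamma> \<one>\<^bsub>A\<^esub> \<gamma> = \<gamma>"
    and ract_one: "\<gamma> \<in> carrier \<Gamma> \<Longrightarrow> ract \<Gamma> \<gamma> \<one>\<^bsub>A\<^esub> = \<gamma>"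
    and lact_mult: "\<lbrakk>a \<in> carrier A; b \<in> carrier A; \<gamma> \<in> carrier \<Gamma>\<rbrakk> \<Longrightarrow>
      lact \<Gamma> (a \<otimes>\<^bsub>A\<^esub> b) \<gamma> = lact \<Gamma> a (lact \<Gamma> b \<gamma>)"
    and ract_mult: "\<lbrakk>a \<in> carrier A; b \<in> carrier A; \<gamma> \<in> carrier \<Gamma>\<rbrakk> \<Longrightarrow>
      ract \<Gamma> \<gamma> (a \<otimes>\<^bsub>A\<^esub> b) = ract \<Gamma> (ract \<Gamma> \<gamma> a) b"
    and lact_ract: "\<lbrakk>a \<in> carrier A; b \<in> carrier A; \<gamma> \<in> carrier \<Gamma>\<rbrakk> \<Longrightarrow>
      ract \<Gamma> (lact \<Gamma> a \<gamma>) b = lact \<Gamma> a (ract \<Gamma> \<gamma> b)"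

section \<open>First order differential calculi\<close>

record ('k, 'm, 'a) calculus = "('k, 'm, 'a) bimodule" +
  diff :: "'a \<Rightarrow> 'm"

locale fodc = algebra_bimodule K A \<Omega>
  for K (structure) and A (structure) and \<Omega> :: "('k, 'm, 'a, 'y) calculus_scheme" (structure) +
  assumes diff_linear: "linear_map K A \<Omega> (diff \<Omega>)"
    and diff_Leibniz: "\<lbrakk>a \<in> carrier A; b \<in> carrier A\<rbrakk> \<Longrightarrow>
      diff \<Omega> (a \<otimes>\<^bsub>A\<^esub> b) = ract \<Omega> (diff \<Omega> a) b \<oplus>\<^bsub>\<Omega>\<^esub> lact \<Omega> a (diff \<Omega> b)"
    and diff_span: "carrier \<Omega> =
      kspan K \<Omega> {lact \<Omega> a (diff \<Omega> b) | a b. a \<in> carrier A \<and> b \<in> carrier A}"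

record ('k, 'm, 'h) bicovariant_calculus = "('k, 'm, 'h) calculus" +
  lcoact :: "'m \<Rightarrow> ('h \<times> 'm) list set"
  rcoact :: "'m \<Rightarrow> ('m \<times> 'h) list set"

locale bicovariant_fodc =
  hopf_algebra K H + calc: fodc K H \<Omega> + bicom: bicomodule K H \<Omega> "lcoact \<Omega>" "rcoact \<Omega>"
  for K (structure) and H :: "('k, 'h, 'x) hopf_scheme" (structure)
    and \<Omega> :: "('k, 'm, 'h, 'y) bicovariant_calculus_scheme" (structure) +
  assumes lcoact_lact: "\<lbrakk>h \<in> carrier H; \<gamma> \<in> carrier \<Omega>\<rbrakk> \<Longrightarrow>
      lcoact \<Omega> (lact \<Omega> h \<gamma>) = tensor_map2 K H \<Omega> (mult H) (lact \<Omega>) (comult H h) (lcoact \<Omega> \<gamma>)"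
    and lcoact_ract: "\<lbrakk>h \<in> carrier H; \<gamma> \<in> carrier \<Omega>\<rbrakk> \<Longrightarrow>
      lcoact \<Omega> (ract \<Omega> \<gamma> h) = tensor_map2 K H \<Omega> (mult H) (ract \<Omega>) (lcoact \<Omega> \<gamma>) (comult H h)"
    and rcoact_lact: "\<lbrakk>h \<in> carrier H; \<gamma> \<in> carrier \<Omega>\<rbrakk> \<Longrightarrow>
      rcoact \<Omega> (lact \<Omega> h \<gamma>) = tensor_map2 K \<Omega> H (lact \<Omega>) (mult H) (comult H h) (rcoact \<Omega> \<gamma>)"
    and rcoact_ract: "\<lbrakk>h \<in> carrier H; \<gamma> \<in> carrier \<Omega>\<rbrakk> \<Longrightarrow>
      rcoact \<Omega> (ract \<Omega> \<gamma> h) = tensor_map2 K \<Omega> H (ract \<Omega>) (mult H) (rcoact \<Omega> \<gamma>) (comult H h)"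
    and lcoact_diff: "h \<in> carrier H \<Longrightarrow>
      lcoact \<Omega> (diff \<Omega> h) = tensor_map K H \<Omega> (\<lambda>y. y) (diff \<Omega>) (comult H h)"
    and rcoact_diff: "h \<in> carrier H \<Longrightarrow>
      rcoact \<Omega> (diff \<Omega> h) = tensor_map K \<Omega> H (diff \<Omega>) (\<lambda>y. y) (comult H h)"

text \<open>The left coinvariant forms, as a subspace of \<open>\<Omega>\<close>.\<close>

definition coinv_forms ::
  "('k, 'r) ring_scheme \<Rightarrow> ('k, 'h, 'x) hopf_scheme \<Rightarrow>
   ('k, 'm, 'h, 'y) bicovariant_calculus_scheme \<Rightarrow> ('k, 'm, 'h, 'y) bicovariant_calculus_scheme"
  where "coinv_forms K H \<Omega> =
    \<Omega>\<lparr>carrier := {\<gamma> \<in> carrier \<Omega>. lcoact \<Omega> \<gamma> = pure_tensor K H \<Omega> \<one>\<^bsub>H\<^esub> \<gamma>}\<rparr>"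

text \<open>The restriction of the right coaction of \<open>\<Omega>\<close> to the left coinvariant forms: the preimage of
  \<open>rcoact \<Omega> \<gamma>\<close> under the inclusion of \<open>coinv_forms \<otimes> H\<close> into \<open>\<Omega> \<otimes> H\<close>.\<close>

definition coinv_rcoact ::
  "('k, 'r) ring_scheme \<Rightarrow> ('k, 'h, 'x) hopf_scheme \<Rightarrow>
   ('k, 'm, 'h, 'y) bicovariant_calculus_scheme \<Rightarrow> 'm \<Rightarrow> ('m \<times> 'h) list set"
  where "coinv_rcoact K H \<Omega> \<gamma> =
    (THE t. t \<in> carrier (tensor K (coinv_forms K H \<Omega>) H) \<and>
       tensor_map K \<Omega> H (\<lambda>x. x) (\<lambda>h. h) t = rcoact \<Omega> \<gamma>)"

section \<open>Twisted module algebras and crossed products\<close>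

text \<open>A linear map on \<open>H \<otimes> B\<close> or \<open>H \<otimes> \<Omega>\<close> that is an action is written as a curried bilinear map;
  \<open>\<sigma>\<close> and its convolution inverse \<open>\<sigma>'\<close> are maps on the tensor product \<open>H \<otimes> H\<close>.\<close>

locale twisted_module_algebra = hopf_algebra K H + B: k_algebra K B
  for K (structure) and H :: "('k, 'h, 'x) hopf_scheme" (structure)
    and B :: "('k, 'b, 'y) module_scheme" (structure)
    and act :: "'h \<Rightarrow> 'b \<Rightarrow> 'b" and \<sigma> \<sigma>' :: "('h \<times> 'h) list set \<Rightarrow> 'b" +
  assumes act_bilinear: "bilinear_map K H B B act"
    and act_unit: "h \<in> carrier H \<Longrightarrow> act h \<one>\<^bsub>B\<^esub> = counit H h \<odot>\<^bsub>B\<^esub> \<one>\<^bsub>B\<^esub>"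
    and act_mult: "\<lbrakk>h \<in> carrier H; b \<in> carrier B; b' \<in> carrier B\<rbrakk> \<Longrightarrow>
      act h (b \<otimes>\<^bsub>B\<^esub> b') = tensor_lift B (\<lambda>h1 h2. act h1 b \<otimes>\<^bsub>B\<^esub> act h2 b') (comult H h)"
    and \<sigma>_linear: "linear_map K (tensor K H H) B \<sigma>"
    and \<sigma>'_linear: "linear_map K (tensor K H H) B \<sigma>'"
    and \<sigma>_\<sigma>': "\<lbrakk>h \<in> carrier H; g \<in> carrier H\<rbrakk> \<Longrightarrow>
      tensor_lift B (\<lambda>h1 h2. tensor_lift B (\<lambda>g1 g2.
          \<sigma> (pure_tensor K H H h1 g1) \<otimes>\<^bsub>B\<^esub> \<sigma>' (pure_tensor K H H h2 g2)) (comult H g)) (comult H h)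
      = (counit H h \<otimes>\<^bsub>K\<^esub> counit H g) \<odot>\<^bsub>B\<^esub> \<one>\<^bsub>B\<^esub>"
    and \<sigma>'_\<sigma>: "\<lbrakk>h \<in> carrier H; g \<in> carrier H\<rbrakk> \<Longrightarrow>
      tensor_lift B (\<lambda>h1 h2. tensor_lift B (\<lambda>g1 g2.
          \<sigma>' (pure_tensor K H H h1 g1) \<otimes>\<^bsub>B\<^esub> \<sigma> (pure_tensor K H H h2 g2)) (comult H g)) (comult H h)
      = (counit H h \<otimes>\<^bsub>K\<^esub> counit H g) \<odot>\<^bsub>B\<^esub> \<one>\<^bsub>B\<^esub>"
    and act_one: "b \<in> carrier B \<Longrightarrow> act \<one>\<^bsub>H\<^esub> b = b"
    and act_act: "\<lbrakk>h \<in> carrier H; g \<in> carrier H; b \<in> carrier B\<rbrakk> \<Longrightarrow>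
      act h (act g b) =
        sweedler3 B (comult H) (comult H) (\<lambda>h1 h2 h3.
          sweedler3 B (comult H) (comult H) (\<lambda>g1 g2 g3.
            \<sigma> (pure_tensor K H H h1 g1) \<otimes>\<^bsub>B\<^esub> act (h2 \<otimes>\<^bsub>H\<^esub> g2) b
              \<otimes>\<^bsub>B\<^esub> \<sigma>' (pure_tensor K H H h3 g3)) g) h"
    and \<sigma>_one_right: "h \<in> carrier H \<Longrightarrow>
      \<sigma> (pure_tensor K H H h \<one>\<^bsub>H\<^esub>) = counit H h \<odot>\<^bsub>B\<^esub> \<one>\<^bsub>B\<^esub>"
    and \<sigma>_one_left: "h \<in> carrier H \<Longrightarrow>
      \<sigma> (pure_tensor K H H \<one>\<^bsub>H\<^esub> h) = counit H h \<odot>\<^bsub>B\<^esub> \<one>\<^bsub>B\<^esub>"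
    and \<sigma>_cocycle: "\<lbrakk>h \<in> carrier H; g \<in> carrier H; f \<in> carrier H\<rbrakk> \<Longrightarrow>
      tensor_lift B (\<lambda>h1 h2. tensor_lift B (\<lambda>g1 g2. tensor_lift B (\<lambda>f1 f2.
          act h1 (\<sigma> (pure_tensor K H H g1 f1)) \<otimes>\<^bsub>B\<^esub> \<sigma> (pure_tensor K H H h2 (g2 \<otimes>\<^bsub>H\<^esub> f2)))
        (comult H f)) (comult H g)) (comult H h)
      = tensor_lift B (\<lambda>h1 h2. tensor_lift B (\<lambda>g1 g2.
          \<sigma> (pure_tensor K H H h1 g1) \<otimes>\<^bsub>B\<^esub> \<sigma> (pure_tensor K H H (h2 \<otimes>\<^bsub>H\<^esub> g2) f))
        (comult H g)) (comult H h)"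

locale twisted_module_fodc =
  twisted_module_algebra K H B act \<sigma> \<sigma>' + calcB: fodc K B \<Omega>
  for K (structure) and H :: "('k, 'h, 'x) hopf_scheme" (structure)
    and B :: "('k, 'b, 'y) module_scheme" (structure)
    and act :: "'h \<Rightarrow> 'b \<Rightarrow> 'b" and \<sigma> \<sigma>' :: "('h \<times> 'h) list set \<Rightarrow> 'b"
    and \<Omega> :: "('k, 'v, 'b, 'z) calculus_scheme" (structure) and actf :: "'h \<Rightarrow> 'v \<Rightarrow> 'v" +
  assumes actf_bilinear: "bilinear_map K H \<Omega> \<Omega> actf"
    and actf_lact_diff: "\<lbrakk>h \<in> carrier H; b \<in> carrier B; b' \<in> carrier B\<rbrakk> \<Longrightarrow>
      actf h (lact \<Omega> b (diff \<Omega> b'))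
      = tensor_lift \<Omega> (\<lambda>h1 h2. lact \<Omega> (act h1 b) (actf h2 (diff \<Omega> b'))) (comult H h)"
    and diff_act: "\<lbrakk>h \<in> carrier H; b \<in> carrier B\<rbrakk> \<Longrightarrow> diff \<Omega> (act h b) = actf h (diff \<Omega> b)"
    and diff_\<sigma>: "t \<in> carrier (tensor K H H) \<Longrightarrow> diff \<Omega> (\<sigma> t) = \<zero>\<^bsub>\<Omega>\<^esub>"

definition crossed_mult ::
  "('k, 'r) ring_scheme \<Rightarrow> ('k, 'h, 'x) hopf_scheme \<Rightarrow> ('k, 'b, 'y) module_scheme \<Rightarrow>
   ('h \<Rightarrow> 'b \<Rightarrow> 'b) \<Rightarrow> (('h \<times> 'h) list set \<Rightarrow> 'b) \<Rightarrow>
   ('b \<times> 'h) list set \<Rightarrow> ('b \<times> 'h) list set \<Rightarrow> ('b \<times> 'h) list set"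
  where "crossed_mult K H B act \<sigma> X Y =
    (let T = tensor K B H in
      tensor_lift T (\<lambda>b h. tensor_lift T (\<lambda>b' h'.
        sweedler3 T (comult H) (comult H) (\<lambda>h1 h2 h3. tensor_lift T (\<lambda>h'1 h'2.
          pure_tensor K B H
            (b \<otimes>\<^bsub>B\<^esub> act h1 b' \<otimes>\<^bsub>B\<^esub> \<sigma> (pure_tensor K H H h2 h'1)) (h3 \<otimes>\<^bsub>H\<^esub> h'2))
        (comult H h')) h) Y) X)"

definition crossed_product ::
  "('k, 'r) ring_scheme \<Rightarrow> ('k, 'h, 'x) hopf_scheme \<Rightarrow> ('k, 'b, 'y) module_scheme \<Rightarrow>
   ('h \<Rightarrow> 'b \<Rightarrow> 'b) \<Rightarrow> (('h \<times> 'h) list set \<Rightarrow> 'b) \<Rightarrow> ('k, ('b \<times> 'h) list set) module"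
  where "crossed_product K H B act \<sigma> =
    (tensor K B H)\<lparr>mult := crossed_mult K H B act \<sigma>, one := pure_tensor K B H \<one>\<^bsub>B\<^esub> \<one>\<^bsub>H\<^esub>\<rparr>"

text \<open>The coaction \<open>id \<otimes> \<Delta>\<close>, with values in \<open>(B \<otimes> H) \<otimes> H\<close>.\<close>

definition crossed_coact ::
  "('k, 'r) ring_scheme \<Rightarrow> ('k, 'h, 'x) hopf_scheme \<Rightarrow> ('k, 'b, 'y) module_scheme \<Rightarrow>
   ('b \<times> 'h) list set \<Rightarrow> (('b \<times> 'h) list set \<times> 'h) list set"
  where "crossed_coact K H B =
    (let T = tensor K (tensor K B H) H in
      tensor_lift T (\<lambda>b h. tensor_lift T (\<lambda>h1 h2.
        pure_tensor K (tensor K B H) H (pure_tensor K B H b h1) h2) (comult H h)))"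

section \<open>The crossed product calculus\<close>

text \<open>Below \<open>\<Omega>H\<close> is the calculus on \<open>H\<close>, \<open>\<Omega>B\<close> the calculus on \<open>B\<close>, and the first and
  second components of a pair are its parts in \<open>\<Omega>B \<otimes> H\<close> and \<open>B \<otimes> \<Omega>H\<close>.\<close>

definition crossed_lact ::
  "('k, 'r) ring_scheme \<Rightarrow> ('k, 'h, 'x) hopf_scheme \<Rightarrow> ('k, 'b, 'y) module_scheme \<Rightarrow>
   ('h \<Rightarrow> 'b \<Rightarrow> 'b) \<Rightarrow> (('h \<times> 'h) list set \<Rightarrow> 'b) \<Rightarrow>
   ('k, 'm, 'h, 'w) bicovariant_calculus_scheme \<Rightarrow>
   ('k, 'v, 'b, 'z) calculus_scheme \<Rightarrow> ('h \<Rightarrow> 'v \<Rightarrow> 'v) \<Rightarrow>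
   ('b \<times> 'h) list set \<Rightarrow> ('v \<times> 'h) list set \<times> ('b \<times> 'm) list set \<Rightarrow>
   ('v \<times> 'h) list set \<times> ('b \<times> 'm) list set"
  where "crossed_lact K H B act \<sigma> \<Omega>H \<Omega>B actf a \<omega> =
    (let T = tensor K \<Omega>B H; U = tensor K B \<Omega>H in
      (tensor_lift T (\<lambda>b' h'. tensor_lift T (\<lambda>\<beta> h.
          sweedler3 T (comult H) (comult H) (\<lambda>h'1 h'2 h'3. tensor_lift T (\<lambda>h1 h2.
            pure_tensor K \<Omega>B H
              (ract \<Omega>B (lact \<Omega>B b' (actf h'1 \<beta>)) (\<sigma> (pure_tensor K H H h'2 h1)))
              (h'3 \<otimes>\<^bsub>H\<^esub> h2))
          (comult H h)) h') (fst \<omega>)) a,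
       tensor_lift U (\<lambda>b' h'. tensor_lift U (\<lambda>b \<gamma>.
          sweedler3 U (comult H) (comult H) (\<lambda>h'1 h'2 h'3. tensor_lift U (\<lambda>g \<gamma>0.
            pure_tensor K B \<Omega>H
              (b' \<otimes>\<^bsub>B\<^esub> act h'1 b \<otimes>\<^bsub>B\<^esub> \<sigma> (pure_tensor K H H h'2 g))
              (lact \<Omega>H h'3 \<gamma>0))
          (lcoact \<Omega>H \<gamma>)) h') (snd \<omega>)) a))"

definition crossed_ract ::
  "('k, 'r) ring_scheme \<Rightarrow> ('k, 'h, 'x) hopf_scheme \<Rightarrow> ('k, 'b, 'y) module_scheme \<Rightarrow>
   ('h \<Rightarrow> 'b \<Rightarrow> 'b) \<Rightarrow> (('h \<times> 'h) list set \<Rightarrow> 'b) \<Rightarrow>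
   ('k, 'm, 'h, 'w) bicovariant_calculus_scheme \<Rightarrow> ('k, 'v, 'b, 'z) calculus_scheme \<Rightarrow>
   ('v \<times> 'h) list set \<times> ('b \<times> 'm) list set \<Rightarrow> ('b \<times> 'h) list set \<Rightarrow>
   ('v \<times> 'h) list set \<times> ('b \<times> 'm) list set"
  where "crossed_ract K H B act \<sigma> \<Omega>H \<Omega>B \<omega> a =
    (let T = tensor K \<Omega>B H; U = tensor K B \<Omega>H in
      (tensor_lift T (\<lambda>\<beta> h. tensor_lift T (\<lambda>b' h'.
          sweedler3 T (comult H) (comult H) (\<lambda>h1 h2 h3. tensor_lift T (\<lambda>h'1 h'2.
            pure_tensor K \<Omega>B H
              (ract \<Omega>B \<beta> (act h1 b' \<otimes>\<^bsub>B\<^esub> \<sigma> (pure_tensor K H H h2 h'1)))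
              (h3 \<otimes>\<^bsub>H\<^esub> h'2))
          (comult H h')) h) a) (fst \<omega>),
       tensor_lift U (\<lambda>b \<gamma>. tensor_lift U (\<lambda>b' h'.
          sweedler3 U (comult H) (lcoact \<Omega>H) (\<lambda>g2 g1 \<gamma>0. tensor_lift U (\<lambda>h'1 h'2.
            pure_tensor K B \<Omega>H
              (b \<otimes>\<^bsub>B\<^esub> act g2 b' \<otimes>\<^bsub>B\<^esub> \<sigma> (pure_tensor K H H g1 h'1))
              (ract \<Omega>H \<gamma>0 h'2))
          (comult H h')) \<gamma>) a) (snd \<omega>)))"

definition crossed_diff ::
  "('k, 'r) ring_scheme \<Rightarrow> ('k, 'h, 'x) hopf_scheme \<Rightarrow> ('k, 'b, 'y) module_scheme \<Rightarrow>
   ('k, 'm, 'h, 'w) bicovariant_calculus_scheme \<Rightarrow> ('k, 'v, 'b, 'z) calculus_scheme \<Rightarrow>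
   ('b \<times> 'h) list set \<Rightarrow> ('v \<times> 'h) list set \<times> ('b \<times> 'm) list set"
  where "crossed_diff K H B \<Omega>H \<Omega>B a =
    (tensor_map K \<Omega>B H (diff \<Omega>B) (\<lambda>h. h) a, tensor_map K B \<Omega>H (\<lambda>b. b) (diff \<Omega>H) a)"

definition crossed_calculus ::
  "('k, 'r) ring_scheme \<Rightarrow> ('k, 'h, 'x) hopf_scheme \<Rightarrow> ('k, 'b, 'y) module_scheme \<Rightarrow>
   ('h \<Rightarrow> 'b \<Rightarrow> 'b) \<Rightarrow> (('h \<times> 'h) list set \<Rightarrow> 'b) \<Rightarrow>
   ('k, 'm, 'h, 'w) bicovariant_calculus_scheme \<Rightarrow>
   ('k, 'v, 'b, 'z) calculus_scheme \<Rightarrow> ('h \<Rightarrow> 'v \<Rightarrow> 'v) \<Rightarrow>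
   ('k, ('v \<times> 'h) list set \<times> ('b \<times> 'm) list set, ('b \<times> 'h) list set) calculus"
  where "crossed_calculus K H B act \<sigma> \<Omega>H \<Omega>B actf =
    module.extend (direct_sum (tensor K \<Omega>B H) (tensor K B \<Omega>H))
      \<lparr>lact = crossed_lact K H B act \<sigma> \<Omega>H \<Omega>B actf,
       ract = crossed_ract K H B act \<sigma> \<Omega>H \<Omega>B,
       diff = crossed_diff K H B \<Omega>H \<Omega>B\<rparr>"

definition crossed_calculus_coact ::
  "('k, 'r) ring_scheme \<Rightarrow> ('k, 'h, 'x) hopf_scheme \<Rightarrow> ('k, 'b, 'y) module_scheme \<Rightarrow>
   ('k, 'm, 'h, 'w) bicovariant_calculus_scheme \<Rightarrow> ('k, 'v, 'b, 'z) calculus_scheme \<Rightarrow>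
   ('v \<times> 'h) list set \<times> ('b \<times> 'm) list set \<Rightarrow>
   ((('v \<times> 'h) list set \<times> ('b \<times> 'm) list set) \<times> 'h) list set"
  where "crossed_calculus_coact K H B \<Omega>H \<Omega>B \<omega> =
    (let D = direct_sum (tensor K \<Omega>B H) (tensor K B \<Omega>H); T = tensor K D H in
      tensor_lift T (\<lambda>\<beta> h. tensor_lift T (\<lambda>h1 h2.
        pure_tensor K D H (pure_tensor K \<Omega>B H \<beta> h1, \<zero>\<^bsub>tensor K B \<Omega>H\<^esub>) h2) (comult H h)) (fst \<omega>)
      \<oplus>\<^bsub>T\<^esub>
      tensor_lift T (\<lambda>b \<gamma>. tensor_lift T (\<lambda>\<gamma>0 \<gamma>1.
        pure_tensor K D H (\<zero>\<^bsub>tensor K \<Omega>B H\<^esub>, pure_tensor K B \<Omega>H b \<gamma>0) \<gamma>1) (rcoact \<Omega>H \<gamma>)) (snd \<omega>))"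

text \<open>The forms \<open>\<beta> \<otimes> 1\<close>, by which \<open>\<Omega>B\<close> is embedded in the crossed product calculus.\<close>

definition base_forms ::
  "('k, 'r) ring_scheme \<Rightarrow> ('k, 'h, 'x) hopf_scheme \<Rightarrow> ('k, 'b, 'y) module_scheme \<Rightarrow>
   ('k, 'm, 'h, 'w) bicovariant_calculus_scheme \<Rightarrow> ('k, 'v, 'b, 'z) calculus_scheme \<Rightarrow>
   (('v \<times> 'h) list set \<times> ('b \<times> 'm) list set) set"
  where "base_forms K H B \<Omega>H \<Omega>B =
    (\<lambda>\<beta>. (pure_tensor K \<Omega>B H \<beta> \<one>\<^bsub>H\<^esub>, \<zero>\<^bsub>tensor K B \<Omega>H\<^esub>)) ` carrier \<Omega>B"

section \<open>Vertical map and connections\<close>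

text \<open>In this section \<open>A\<close> is a right \<open>H\<close>-comodule algebra with coaction \<open>\<delta>A\<close> and right
  \<open>H\<close>-covariant calculus \<open>\<Omega>A\<close>, whose coaction is \<open>\<delta>\<Omega>\<close>.\<close>

text \<open>\<open>S(h1) d(h2)\<close>: only this sum, not each of its terms, is left coinvariant, so it has to be
  formed in \<open>\<Omega>H\<close> before tensoring with \<open>coinv_forms\<close>.\<close>

definition maurer_cartan ::
  "('k, 'h, 'x) hopf_scheme \<Rightarrow> ('k, 'm, 'h, 'w) bicovariant_calculus_scheme \<Rightarrow> 'h \<Rightarrow> 'm"
  where "maurer_cartan H \<Omega>H h =
    tensor_lift \<Omega>H (\<lambda>h1 h2. lact \<Omega>H (antipode H h1) (diff \<Omega>H h2)) (comult H h)"

definition vertical_map ::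
  "('k, 'r) ring_scheme \<Rightarrow> ('k, 'h, 'x) hopf_scheme \<Rightarrow>
   ('k, 'm, 'h, 'w) bicovariant_calculus_scheme \<Rightarrow>
   ('k, 'a, 'y) module_scheme \<Rightarrow> ('a \<Rightarrow> ('a \<times> 'h) list set) \<Rightarrow>
   ('k, 'v, 'a, 'z) calculus_scheme \<Rightarrow> 'v \<Rightarrow> ('a \<times> 'm) list set"
  where "vertical_map K H \<Omega>H A \<delta>A \<Omega>A =
    (let T = tensor K A (coinv_forms K H \<Omega>H) in
      THE v. v \<in> extensional (carrier \<Omega>A) \<and> linear_map K \<Omega>A T v \<and>
        (\<forall>a\<in>carrier A. \<forall>a'\<in>carrier A.
          v (lact \<Omega>A a (diff \<Omega>A a')) =
            tensor_lift T (\<lambda>a'0 u. pure_tensor K A (coinv_forms K H \<Omega>H)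
              (a \<otimes>\<^bsub>A\<^esub> a'0) (maurer_cartan H \<Omega>H u)) (\<delta>A a')))"

text \<open>The diagonal coaction \<open>a \<otimes> \<gamma> \<mapsto> (a0 \<otimes> \<gamma>0) \<otimes> a1 \<gamma>1\<close>.\<close>

definition diagonal_coact ::
  "('k, 'r) ring_scheme \<Rightarrow> ('k, 'h, 'x) hopf_scheme \<Rightarrow>
   ('k, 'm, 'h, 'w) bicovariant_calculus_scheme \<Rightarrow>
   ('k, 'a, 'y) module_scheme \<Rightarrow> ('a \<Rightarrow> ('a \<times> 'h) list set) \<Rightarrow>
   ('a \<times> 'm) list set \<Rightarrow> (('a \<times> 'm) list set \<times> 'h) list set"
  where "diagonal_coact K H \<Omega>H A \<delta>A =
    (let S = tensor K A (coinv_forms K H \<Omega>H); T = tensor K S H in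
      tensor_lift T (\<lambda>a \<gamma>. tensor_lift T (\<lambda>a0 a1. tensor_lift T (\<lambda>\<gamma>0 \<gamma>1.
        pure_tensor K S H (pure_tensor K A (coinv_forms K H \<Omega>H) a0 \<gamma>0) (a1 \<otimes>\<^bsub>H\<^esub> \<gamma>1))
      (coinv_rcoact K H \<Omega>H \<gamma>)) (\<delta>A a)))"

definition connection ::
  "('k, 'r) ring_scheme \<Rightarrow> ('k, 'h, 'x) hopf_scheme \<Rightarrow>
   ('k, 'm, 'h, 'w) bicovariant_calculus_scheme \<Rightarrow>
   ('k, 'a, 'y) module_scheme \<Rightarrow> ('a \<Rightarrow> ('a \<times> 'h) list set) \<Rightarrow>
   ('k, 'v, 'a, 'z) calculus_scheme \<Rightarrow> ('v \<Rightarrow> ('v \<times> 'h) list set) \<Rightarrow>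
   (('a \<times> 'm) list set \<Rightarrow> 'v) \<Rightarrow> bool"
  where "connection K H \<Omega>H A \<delta>A \<Omega>A \<delta>\<Omega> c \<longleftrightarrow>
    (let S = tensor K A (coinv_forms K H \<Omega>H) in
      linear_map K S \<Omega>A c \<and>
      (\<forall>a\<in>carrier A. \<forall>t\<in>carrier S.
        c (tensor_map K A (coinv_forms K H \<Omega>H) (\<lambda>a'. a \<otimes>\<^bsub>A\<^esub> a') (\<lambda>\<gamma>. \<gamma>) t) = lact \<Omega>A a (c t)) \<and>
      (\<forall>t\<in>carrier S.
        \<delta>\<Omega> (c t) = tensor_map K \<Omega>A H c (\<lambda>h. h) (diagonal_coact K H \<Omega>H A \<delta>A t)) \<and>
      (\<forall>t\<in>carrier S. vertical_map K H \<Omega>H A \<delta>A \<Omega>A (c t) = t))"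

text \<open>\<open>F\<close> is the space of forms on the base, as a subset of \<open>\<Omega>A\<close>.\<close>

definition strong_connection ::
  "('k, 'r) ring_scheme \<Rightarrow> ('k, 'h, 'x) hopf_scheme \<Rightarrow>
   ('k, 'm, 'h, 'w) bicovariant_calculus_scheme \<Rightarrow>
   ('k, 'a, 'y) module_scheme \<Rightarrow> ('a \<Rightarrow> ('a \<times> 'h) list set) \<Rightarrow>
   ('k, 'v, 'a, 'z) calculus_scheme \<Rightarrow> ('v \<Rightarrow> ('v \<times> 'h) list set) \<Rightarrow> 'v set \<Rightarrow>
   (('a \<times> 'm) list set \<Rightarrow> 'v) \<Rightarrow> bool"
  where "strong_connection K H \<Omega>H A \<delta>A \<Omega>A \<delta>\<Omega> F c \<longleftrightarrow>
    connection K H \<Omega>H A \<delta>A \<Omega>A \<delta>\<Omega> c \<and>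
    (\<forall>a\<in>carrier A.
      diff \<Omega>A a \<ominus>\<^bsub>\<Omega>A\<^esub> c (vertical_map K H \<Omega>H A \<delta>A \<Omega>A (diff \<Omega>A a))
        \<in> kspan K \<Omega>A {ract \<Omega>A \<beta> a' | \<beta> a'. \<beta> \<in> F \<and> a' \<in> carrier A})"

end

theory Submission
  imports Defs
begin

text \<open>Write \<open>P \<gamma> = S(\<gamma>\<^sub>-\<^sub>1) \<gamma>\<^sub>0\<close> for a form \<open>\<gamma>\<close> on \<open>H\<close>.  By the fundamental theorem of Hopf modules \<open>P\<close> takes values
  in the left coinvariant forms, \<open>\<gamma> = \<gamma>\<^sub>-\<^sub>1 P(\<gamma>\<^sub>0)\<close>, and \<open>P(h \<gamma>) = \<epsilon>(h) \<gamma>\<close> if \<open>\<gamma>\<close> is coinvariant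
  (\<open>coinv_proj_closed\<close>, \<open>coinv_proj_reconstruct\<close>, \<open>coinv_proj_lact\<close>).  Tensoring with \<open>B\<close> makes the vertical
  summand \<open>B \<otimes> \<Omega>(H)\<close> isomorphic to \<open>(B # H) \<otimes> \<^bold>C\<close>, where \<open>\<^bold>C\<close> denotes the coinvariant forms:
  \<open>(b \<otimes> h) \<otimes> \<gamma> \<mapsto> b \<otimes> h \<gamma>\<close> (\<open>mult_map\<close>) and \<open>b \<otimes> \<gamma> \<mapsto> (b \<otimes> \<gamma>\<^sub>-\<^sub>1) \<otimes> P(\<gamma>\<^sub>0)\<close> (\<open>split_map\<close>) are mutually
  inverse.  The connection \<open>conn\<close> is \<open>mult_map\<close> followed by the inclusion of the vertical summand.  It is
  left linear and right colinear because the left coaction of \<open>h \<gamma>\<close> is \<open>h\<^sub>1 \<otimes> h\<^sub>2 \<gamma>\<close> and the right one is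
  \<open>h\<^sub>1 \<gamma>\<^sub>0 \<otimes> h\<^sub>2 \<gamma>\<^sub>1\<close>.

  The vertical map turns out to be the projection onto the vertical summand followed by \<open>split_map\<close>
  (\<open>vertical_map_eq\<close>).  It is defined as the unique linear map with prescribed values on the forms \<open>a da'\<close>,
  so two things have to be shown.  That \<open>split_map\<close> has these values can be tested after the injective and left
  linear \<open>mult_map\<close>, which reduces it to \<open>h\<^sub>1 S(h\<^sub>2) dh\<^sub>3 = dh\<close>.  Uniqueness is the statement that the forms \<open>a da'\<close> span
  the crossed product calculus (\<open>forms_generated\<close>): the identity
  \<open>b \<otimes> h' dh = (b \<sigma>\<^sup>-\<^sup>1(h'\<^sub>1 \<otimes> h\<^sub>1) \<otimes> h'\<^sub>2) d(1 \<otimes> h\<^sub>2)\<close> yields the vertical forms, and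
  \<open>b db' \<otimes> h = (b \<otimes> 1) d(b' \<otimes> h) - b b' \<otimes> dh\<close> then yields the horizontal ones.

  It follows that the vertical map composed with \<open>conn\<close> is the identity, and that \<open>conn\<close> composed with the
  vertical map is the projection onto the vertical summand.  The connection is strong since the complementary
  projection maps into \<open>\<Omega>(B) \<otimes> H\<close>, whose elements are sums of \<open>\<beta> \<otimes> h = (\<beta> \<otimes> 1)(1 \<otimes> h)\<close>.

  All computations are done with Sweedler sums, that is, with nested \<open>tensor_lift\<close>s.  Since \<open>tensor_lift\<close> is a sum over
  one chosen representative, a linear map or an equation of summands passes through it summand by
  summand.  Multilinearity of the summand enters where the tensor is rewritten: coassociativity, counit,
  antipode, and coactions of products.\<close>

section \<open>Linear maps\<close>

lemma linear_mapI:
  assumes "\<And>x. x \<in> carrier M \<Longrightarrow> f x \<in> carrier N"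
    and "\<And>x y. \<lbrakk>x \<in> carrier M; y \<in> carrier M\<rbrakk> \<Longrightarrow> f (x \<oplus>\<^bsub>M\<^esub> y) = f x \<oplus>\<^bsub>N\<^esub> f y"
    and "\<And>a x. \<lbrakk>a \<in> carrier K; x \<in> carrier M\<rbrakk> \<Longrightarrow> f (a \<odot>\<^bsub>M\<^esub> x) = a \<odot>\<^bsub>N\<^esub> f x"
  shows "linear_map K M N f"
  using assms unfolding linear_map_def by blast

lemma linear_map_closed: "linear_map K M N f \<Longrightarrow> x \<in> carrier M \<Longrightarrow> f x \<in> carrier N"
  unfolding linear_map_def by blast

lemma linear_map_add:
  "linear_map K M N f \<Longrightarrow> x \<in> carrier M \<Longrightarrow> y \<in> carrier M \<Longrightarrow> f (x \<oplus>\<^bsub>M\<^esub> y) = f x \<oplus>\<^bsub>N\<^esub> f y"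
  unfolding linear_map_def by blast

lemma linear_map_smult:
  "linear_map K M N f \<Longrightarrow> a \<in> carrier K \<Longrightarrow> x \<in> carrier M \<Longrightarrow> f (a \<odot>\<^bsub>M\<^esub> x) = a \<odot>\<^bsub>N\<^esub> f x"
  unfolding linear_map_def by blast

lemma linear_map_zero:
  assumes "kspace K M" and "kspace K N" and f: "linear_map K M N f"
  shows "f \<zero>\<^bsub>M\<^esub> = \<zero>\<^bsub>N\<^esub>"
proof -
  interpret M: kspace K M by fact
  interpret N: kspace K N by fact
  have "f \<zero>\<^bsub>M\<^esub> = f (\<zero>\<^bsub>K\<^esub> \<odot>\<^bsub>M\<^esub> \<zero>\<^bsub>M\<^esub>)" by simp
  also have "\<dots> = \<zero>\<^bsub>K\<^esub> \<odot>\<^bsub>N\<^esub> f \<zero>\<^bsub>M\<^esub>" by (rule linear_map_smult[OF f]) simp_all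
  also have "\<dots> = \<zero>\<^bsub>N\<^esub>" using linear_map_closed[OF f] by simp
  finally show ?thesis .
qed

lemma linear_map_cong:
  assumes "kspace K M" and "\<And>x. x \<in> carrier M \<Longrightarrow> f x = g x"
  shows "linear_map K M N f \<longleftrightarrow> linear_map K M N g"
proof -
  interpret kspace K M by fact
  show ?thesis using assms(2) unfolding linear_map_def
    by (auto simp: Pi_iff)
qed

lemma linear_map_id: "linear_map K M M (\<lambda>x. x)"
  by (rule linear_mapI) auto

lemma linear_map_comp:
  assumes "linear_map K M N f" and "linear_map K L M e"
  shows "linear_map K L N (\<lambda>x. f (e x))"
  by (rule linear_mapI)
     (simp_all add: linear_map_closed[OF assms(2)] linear_map_closed[OF assms(1)]
        linear_map_add[OF assms(2)] linear_map_add[OF assms(1)]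
        linear_map_smult[OF assms(2)] linear_map_smult[OF assms(1)])

lemma bilinear_mapI:
  assumes "\<And>x. x \<in> carrier M \<Longrightarrow> linear_map K N P (\<lambda>y. f x y)"
    and "\<And>y. y \<in> carrier N \<Longrightarrow> linear_map K M P (\<lambda>x. f x y)"
  shows "bilinear_map K M N P f"
  using assms unfolding bilinear_map_def by blast

lemma bilinear_map_left:
  "bilinear_map K M N P f \<Longrightarrow> y \<in> carrier N \<Longrightarrow> linear_map K L M e \<Longrightarrow> linear_map K L P (\<lambda>x. f (e x) y)"
  unfolding bilinear_map_def using linear_map_comp by blast

lemma bilinear_map_right:
  "bilinear_map K M N P f \<Longrightarrow> x \<in> carrier M \<Longrightarrow> linear_map K L N e \<Longrightarrow> linear_map K L P (\<lambda>y. f x (e y))"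
  unfolding bilinear_map_def using linear_map_comp by blast

lemma bilinear_map_closed:
  "bilinear_map K M N P f \<Longrightarrow> x \<in> carrier M \<Longrightarrow> y \<in> carrier N \<Longrightarrow> f x y \<in> carrier P"
  unfolding bilinear_map_def linear_map_def by blast

lemma linear_map_smult_const:
  assumes "kspace K M" and "a \<in> carrier K" and e: "linear_map K L M e"
  shows "linear_map K L M (\<lambda>x. a \<odot>\<^bsub>M\<^esub> e x)"
proof -
  interpret kspace K M by fact
  have "linear_map K M M (\<lambda>x. a \<odot>\<^bsub>M\<^esub> x)"
    using assms(2) by (intro linear_mapI) (auto simp: smult_r_distr smult_assoc1[symmetric] m_comm)
  thus ?thesis using e by (rule linear_map_comp)
qed

lemma linear_map_pair:
  assumes "linear_map K L M f" and "linear_map K L N g"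
  shows "linear_map K L (direct_sum M N) (\<lambda>x. (f x, g x))"
  using assms unfolding linear_map_def direct_sum_def by auto

lemma linear_map_snd: "linear_map K L (direct_sum M N) e \<Longrightarrow> linear_map K L N (\<lambda>x. snd (e x))"
  unfolding linear_map_def direct_sum_def by (auto simp: Pi_iff mem_Times_iff)

lemma linear_map_zero_const:
  assumes "kspace K N" shows "linear_map K L N (\<lambda>x. \<zero>\<^bsub>N\<^esub>)"
proof -
  interpret kspace K N by fact
  show ?thesis by (rule linear_mapI) auto
qed

lemma kspace_direct_sum:
  assumes "kspace K M" and "kspace K N"
  shows "kspace K (direct_sum M N)"
proof -
  interpret M: kspace K M by fact
  interpret N: kspace K N by fact
  have "abelian_group (direct_sum M N)"
  proof (rule abelian_groupI)
    fix x assume "x \<in> carrier (direct_sum M N)"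
    thus "\<exists>y\<in>carrier (direct_sum M N). y \<oplus>\<^bsub>direct_sum M N\<^esub> x = \<zero>\<^bsub>direct_sum M N\<^esub>"
      by (intro bexI[of _ "(\<ominus>\<^bsub>M\<^esub> fst x, \<ominus>\<^bsub>N\<^esub> snd x)"])
         (auto simp: direct_sum_def M.l_neg N.l_neg)
  qed (auto simp: direct_sum_def M.a_ac N.a_ac)
  hence "module K (direct_sum M N)"
    by (intro moduleI M.is_cring)
       (auto simp: direct_sum_def M.smult_l_distr N.smult_l_distr M.smult_r_distr N.smult_r_distr
          M.smult_assoc1 N.smult_assoc1)
  thus ?thesis by (intro kspace.intro M.field_axioms)
qed

text \<open>A vector space may be given another multiplication and unit, or be extended to a bimodule, as is done for
  the crossed product and its calculus.\<close>

lemma kspace_cong: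
  fixes M :: "('k, 'm, 'x) module_scheme" and M' :: "('k, 'm, 'y) module_scheme"
  assumes "kspace K M"
    and [simp]: "carrier M' = carrier M" "add M' = add M" "zero M' = zero M" "smult M' = smult M"
  shows "kspace K M'"
proof -
  interpret M: kspace K M by fact
  have "abelian_group M'"
    by (rule abelian_groupI) (auto simp: M.a_ac intro: M.l_neg M.a_inv_closed)
  hence "module K M'"
    by (intro moduleI M.is_cring) (auto simp: M.smult_l_distr M.smult_r_distr M.smult_assoc1)
  thus ?thesis by (intro kspace.intro M.field_axioms)
qed

text \<open>Negatives are multiples by \<open>-1\<close>.\<close>

lemma submodule_kspaceI:
  assumes "kspace K M" and "S \<subseteq> carrier M" and "\<zero>\<^bsub>M\<^esub> \<in> S"
    and add: "\<And>x y. \<lbrakk>x \<in> S; y \<in> S\<rbrakk> \<Longrightarrow> x \<oplus>\<^bsub>M\<^esub> y \<in> S"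
    and smult: "\<And>a x. \<lbrakk>a \<in> carrier K; x \<in> S\<rbrakk> \<Longrightarrow> a \<odot>\<^bsub>M\<^esub> x \<in> S"
  shows "submodule S K M"
proof -
  interpret kspace K M by fact
  have "abelian_group K" using is_cring cring.axioms(1) ring.is_abelian_group by blast
  hence minus: "\<ominus>\<^bsub>K\<^esub> \<one>\<^bsub>K\<^esub> \<in> carrier K" by (rule abelian_group.a_inv_closed) simp
  show ?thesis
  proof (rule submoduleI[OF assms(2,3) _ add smult])
    fix x assume x: "x \<in> S"
    hence "(\<ominus>\<^bsub>K\<^esub> \<one>\<^bsub>K\<^esub>) \<odot>\<^bsub>M\<^esub> x = \<ominus>\<^bsub>M\<^esub> x" using assms(2) by (subst smult_l_minus) auto
    thus "\<ominus>\<^bsub>M\<^esub> x \<in> S" using smult[OF minus x] by simp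
  qed
qed

lemma kspan_subset: "submodule N K M \<Longrightarrow> S \<subseteq> N \<Longrightarrow> x \<in> kspan K M S \<Longrightarrow> x \<in> N"
  unfolding kspan_def by blast

text \<open>Used to pass from a spanning set to the whole space: if \<open>f i\<close> maps the spanning set into \<open>N\<close> for
  all \<open>i\<close>, then this preimage contains it.\<close>

lemma linear_preimage_submodule:
  assumes "kspace K L" "kspace K M" and N: "submodule N K M" and f: "\<And>i. i \<in> I \<Longrightarrow> linear_map K L M (f i)"
  shows "submodule {x \<in> carrier L. \<forall>i\<in>I. f i x \<in> N} K L"
proof -
  interpret L: kspace K L by fact
  interpret M: kspace K M by fact
  note E = M.submoduleE[OF N]
  have "\<zero>\<^bsub>M\<^esub> \<in> N"
    using N submodule.axioms(1) subgroup.one_closed by fastforce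
  thus ?thesis
    by (intro submodule_kspaceI[OF assms(1)])
       (auto simp: linear_map_zero[OF assms(1,2) f] linear_map_add[OF f] linear_map_smult[OF f] E(4,5))
qed

section \<open>Tensor products\<close>

text \<open>The sum that \<open>tensor_lift\<close> forms from the chosen representative.\<close>

definition list_lift :: "('k, 'p, 'z) module_scheme \<Rightarrow> ('m \<Rightarrow> 'n \<Rightarrow> 'p) \<Rightarrow> ('m \<times> 'n) list \<Rightarrow> 'p"
  where "list_lift P f xs = foldr (\<lambda>(m, n) p. f m n \<oplus>\<^bsub>P\<^esub> p) xs \<zero>\<^bsub>P\<^esub>"

lemma list_lift_simps [simp]:
  "list_lift P f [] = \<zero>\<^bsub>P\<^esub>"
  "list_lift P f ((m, n) # xs) = f m n \<oplus>\<^bsub>P\<^esub> list_lift P f xs"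
  unfolding list_lift_def by simp_all

lemma tensor_lift_rep: "tensor_lift P f X = list_lift P f (SOME xs. xs \<in> X)"
  unfolding tensor_lift_def list_lift_def ..

lemma list_lift_closed:
  assumes "kspace K P" and "\<And>m n. \<lbrakk>m \<in> U; n \<in> V\<rbrakk> \<Longrightarrow> f m n \<in> carrier P"
    and "xs \<in> lists (U \<times> V)"
  shows "list_lift P f xs \<in> carrier P"
proof -
  interpret P: kspace K P by fact
  show ?thesis using assms(3) by (induction xs) (auto simp: assms(2))
qed

lemma list_lift_append:
  assumes "kspace K P" and "\<And>m n. \<lbrakk>m \<in> U; n \<in> V\<rbrakk> \<Longrightarrow> f m n \<in> carrier P"
    and "xs \<in> lists (U \<times> V)" and "ys \<in> lists (U \<times> V)"
  shows "list_lift P f (xs @ ys) = list_lift P f xs \<oplus>\<^bsub>P\<^esub> list_lift P f ys"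
proof -
  interpret P: kspace K P by fact
  have ys: "list_lift P f ys \<in> carrier P" by (rule list_lift_closed) (use assms in auto)
  show ?thesis using assms(3)
  proof (induction xs)
    case Nil
    show ?case using ys by simp
  next
    case (Cons x xs)
    obtain m n where x: "x = (m, n)" by (cases x)
    have "list_lift P f xs \<in> carrier P" by (rule list_lift_closed) (use assms Cons in auto)
    thus ?case using Cons ys assms(2) x by (auto simp: P.a_assoc)
  qed
qed

lemma list_lift_cong:
  assumes "\<And>m n. \<lbrakk>m \<in> U; n \<in> V\<rbrakk> \<Longrightarrow> f m n = g m n" and "xs \<in> lists (U \<times> V)"
  shows "list_lift P f xs = list_lift P g xs"
  using assms(2) by (induction xs) (auto simp: assms(1))

lemma list_lift_linear:
  assumes "kspace K P" and "kspace K Q" and \<phi>: "linear_map K P Q \<phi>"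
    and "\<And>m n. \<lbrakk>m \<in> U; n \<in> V\<rbrakk> \<Longrightarrow> f m n \<in> carrier P"
    and "xs \<in> lists (U \<times> V)"
  shows "\<phi> (list_lift P f xs) = list_lift Q (\<lambda>m n. \<phi> (f m n)) xs"
  using assms(5)
proof (induction xs)
  case Nil
  show ?case using linear_map_zero[OF assms(1-3)] by simp
next
  case (Cons x xs)
  obtain m n where x: "x = (m, n)" by (cases x)
  have "list_lift P f xs \<in> carrier P" by (rule list_lift_closed) (use assms Cons in auto)
  thus ?case using Cons assms(4) x by (auto simp: linear_map_add[OF \<phi>])
qed

lemma list_lift_add:
  assumes "kspace K P" and "\<And>m n. \<lbrakk>m \<in> U; n \<in> V\<rbrakk> \<Longrightarrow> f m n \<in> carrier P"
    and "\<And>m n. \<lbrakk>m \<in> U; n \<in> V\<rbrakk> \<Longrightarrow> g m n \<in> carrier P"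
    and "xs \<in> lists (U \<times> V)"
  shows "list_lift P (\<lambda>m n. f m n \<oplus>\<^bsub>P\<^esub> g m n) xs = list_lift P f xs \<oplus>\<^bsub>P\<^esub> list_lift P g xs"
  using assms(4)
proof (induction xs)
  interpret P: kspace K P by fact
  {
    case Nil
    show ?case by simp
  next
    case (Cons x xs)
    obtain m n where x: "x = (m, n)" by (cases x)
    have "list_lift P f xs \<in> carrier P" "list_lift P g xs \<in> carrier P"
      by (rule list_lift_closed; use assms Cons in auto)+
    thus ?case using Cons assms(2,3) x by (auto simp: P.a_ac)
  }
qed

locale tensor_pair = M: kspace K M + N: kspace K N for K and M and N
begin

abbreviation "L \<equiv> lists (carrier M \<times> carrier N)"

abbreviation "cls \<equiv> tensor_class K M N"

lemma rel_lists: "tensor_rel K M N xs ys \<Longrightarrow> xs \<in> L \<and> ys \<in> L"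
  by (induction rule: tensor_rel.induct) auto

lemma class_eq: "tensor_rel K M N xs ys \<Longrightarrow> cls xs = cls ys"
  unfolding tensor_class_def by (blast intro: tensor_rel.sym tensor_rel.trans)

lemma class_self: "xs \<in> L \<Longrightarrow> xs \<in> cls xs"
  unfolding tensor_class_def by (auto intro: tensor_rel.refl)

lemma class_mem: "ys \<in> cls xs \<Longrightarrow> tensor_rel K M N xs ys"
  unfolding tensor_class_def by auto

lemma rep: assumes "X \<in> carrier (tensor K M N)"
  shows "(SOME xs. xs \<in> X) \<in> L" and "cls (SOME xs. xs \<in> X) = X"
proof -
  obtain xs where xs: "xs \<in> L" "X = cls xs" using assms by (auto simp: tensor_def)
  have "(SOME ys. ys \<in> X) \<in> X" using xs class_self by (metis someI)
  hence "tensor_rel K M N xs (SOME ys. ys \<in> X)" using xs class_mem by blast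
  thus "(SOME xs. xs \<in> X) \<in> L" and "cls (SOME xs. xs \<in> X) = X" using xs class_eq rel_lists by blast+
qed

lemma add_class: assumes "xs \<in> L" "ys \<in> L"
  shows "cls xs \<oplus>\<^bsub>tensor K M N\<^esub> cls ys = cls (xs @ ys)"
proof -
  have "(\<Union>xs'\<in>cls xs. \<Union>ys'\<in>cls ys. cls (xs' @ ys')) = (\<Union>xs'\<in>cls xs. \<Union>ys'\<in>cls ys. cls (xs @ ys))"
    by (intro SUP_cong HOL.refl class_eq tensor_rel.sym[OF tensor_rel.append]) (auto dest: class_mem)
  also have "\<dots> = cls (xs @ ys)" using class_self[OF assms(1)] class_self[OF assms(2)] by auto
  finally show ?thesis unfolding tensor_def by simp
qed

lemma rel_smult:
  assumes a: "a \<in> carrier K" and "tensor_rel K M N xs ys"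
  shows "tensor_rel K M N (map (\<lambda>(m, n). (a \<odot>\<^bsub>M\<^esub> m, n)) xs) (map (\<lambda>(m, n). (a \<odot>\<^bsub>M\<^esub> m, n)) ys)"
  using assms(2)
proof (induction rule: tensor_rel.induct)
  case (refl xs)
  thus ?case using a by (intro tensor_rel.refl) (auto simp: in_lists_conv_set)
next
  case (commute xs ys)
  thus ?case using a unfolding map_append by (intro tensor_rel.commute) (auto simp: in_lists_conv_set)
next
  case (smult b m n)
  have "tensor_rel K M N [(b \<odot>\<^bsub>M\<^esub> (a \<odot>\<^bsub>M\<^esub> m), n)] [(a \<odot>\<^bsub>M\<^esub> m, b \<odot>\<^bsub>N\<^esub> n)]"
    using smult a by (intro tensor_rel.smult) auto
  thus ?case using smult a by (simp add: M.smult_assoc1[symmetric] M.m_comm)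
next
  case (sym xs ys)
  show ?case by (rule tensor_rel.sym) (rule sym)
next
  case (trans xs ys zs)
  show ?case by (rule tensor_rel.trans) (rule trans)+
qed (use a in \<open>auto intro: tensor_rel.append tensor_rel.add_left tensor_rel.add_right tensor_rel.zero
        simp: M.smult_r_distr\<close>)

lemma smult_class: assumes "a \<in> carrier K" "xs \<in> L"
  shows "a \<odot>\<^bsub>tensor K M N\<^esub> cls xs = cls (map (\<lambda>(m, n). (a \<odot>\<^bsub>M\<^esub> m, n)) xs)"
proof -
  let ?f = "map (\<lambda>(m, n). (a \<odot>\<^bsub>M\<^esub> m, n))"
  have "(\<Union>xs'\<in>cls xs. cls (?f xs')) = (\<Union>xs'\<in>cls xs. cls (?f xs))"
    by (intro SUP_cong HOL.refl class_eq tensor_rel.sym[OF rel_smult[OF assms(1)]]) (auto dest: class_mem)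
  also have "\<dots> = cls (?f xs)" using class_self[OF assms(2)] by auto
  finally show ?thesis unfolding tensor_def by simp
qed

lemma carrier_class: "X \<in> carrier (tensor K M N) \<longleftrightarrow> (\<exists>xs\<in>L. X = cls xs)"
  by (auto simp: tensor_def)

lemma zero_class: "\<zero>\<^bsub>tensor K M N\<^esub> = cls []"
  by (simp add: tensor_def)

lemma map_smult_lists: "a \<in> carrier K \<Longrightarrow> xs \<in> L \<Longrightarrow> map (\<lambda>(m, n). (a \<odot>\<^bsub>M\<^esub> m, n)) xs \<in> L"
  by (auto simp: in_lists_conv_set)

text \<open>Splitting every entry of the list on the left gives the entries of the two lists on the right, interleaved;
  commutativity separates them.\<close>

lemma rel_smult_distr:
  assumes "a \<in> carrier K" "b \<in> carrier K" "xs \<in> L"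
  shows "tensor_rel K M N (map (\<lambda>(m, n). ((a \<oplus>\<^bsub>K\<^esub> b) \<odot>\<^bsub>M\<^esub> m, n)) xs)
     (map (\<lambda>(m, n). (a \<odot>\<^bsub>M\<^esub> m, n)) xs @ map (\<lambda>(m, n). (b \<odot>\<^bsub>M\<^esub> m, n)) xs)"
  using assms(3)
proof (induction xs)
  case Nil
  show ?case by (auto intro: tensor_rel.refl)
next
  case (Cons x xs)
  obtain m n where x: "x = (m, n)" by (cases x)
  have mn: "m \<in> carrier M" "n \<in> carrier N" using Cons x by auto
  let ?a = "map (\<lambda>(m, n). (a \<odot>\<^bsub>M\<^esub> m, n)) xs" and ?b = "map (\<lambda>(m, n). (b \<odot>\<^bsub>M\<^esub> m, n)) xs"
  have l: "?a \<in> L" "?b \<in> L" using Cons map_smult_lists assms by auto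
  have 1: "tensor_rel K M N [((a \<oplus>\<^bsub>K\<^esub> b) \<odot>\<^bsub>M\<^esub> m, n)] [(a \<odot>\<^bsub>M\<^esub> m, n), (b \<odot>\<^bsub>M\<^esub> m, n)]"
    using assms mn by (auto simp: M.smult_l_distr intro: tensor_rel.add_left)
  have "tensor_rel K M N ([((a \<oplus>\<^bsub>K\<^esub> b) \<odot>\<^bsub>M\<^esub> m, n)] @ map (\<lambda>(m, n). ((a \<oplus>\<^bsub>K\<^esub> b) \<odot>\<^bsub>M\<^esub> m, n)) xs)
     ([(a \<odot>\<^bsub>M\<^esub> m, n), (b \<odot>\<^bsub>M\<^esub> m, n)] @ ?a @ ?b)"
    by (rule tensor_rel.append[OF 1 Cons.IH])
  moreover have "tensor_rel K M N ([(a \<odot>\<^bsub>M\<^esub> m, n)] @ ([(b \<odot>\<^bsub>M\<^esub> m, n)] @ ?a) @ ?b)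
     ([(a \<odot>\<^bsub>M\<^esub> m, n)] @ (?a @ [(b \<odot>\<^bsub>M\<^esub> m, n)]) @ ?b)"
    using assms mn l by (intro tensor_rel.append tensor_rel.commute tensor_rel.refl) auto
  ultimately show ?case using x by (auto intro: tensor_rel.trans)
qed

text \<open>Associativity, commutativity and the zero hold because they hold for lists up to the relation.  An additive
  inverse of \<open>X\<close> is \<open>(-1) X\<close>, as \<open>(-1) X + 1 X = 0 X = 0\<close>.\<close>

lemma tensor_is_kspace: "kspace K (tensor K M N)"
proof -
  have K: "abelian_group K" using M.is_cring cring.axioms(1) ring.is_abelian_group by blast
  have neg: "\<ominus>\<^bsub>K\<^esub> \<one>\<^bsub>K\<^esub> \<oplus>\<^bsub>K\<^esub> \<one>\<^bsub>K\<^esub> = \<zero>\<^bsub>K\<^esub>" by (rule abelian_group.l_neg[OF K]) simp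
  have minus: "\<ominus>\<^bsub>K\<^esub> \<one>\<^bsub>K\<^esub> \<in> carrier K" by (rule abelian_group.a_inv_closed[OF K]) simp
  let ?T = "tensor K M N"
  have closed: "a \<odot>\<^bsub>?T\<^esub> X \<in> carrier ?T" if "a \<in> carrier K" "X \<in> carrier ?T" for a X
    using that map_smult_lists unfolding carrier_class by (metis smult_class)
  have aclosed: "X \<oplus>\<^bsub>?T\<^esub> Y \<in> carrier ?T" if "X \<in> carrier ?T" "Y \<in> carrier ?T" for X Y
    using that unfolding carrier_class by (metis add_class append_in_lists_conv)
  have distr: "(a \<oplus>\<^bsub>K\<^esub> b) \<odot>\<^bsub>?T\<^esub> X = a \<odot>\<^bsub>?T\<^esub> X \<oplus>\<^bsub>?T\<^esub> b \<odot>\<^bsub>?T\<^esub> X"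
    if "a \<in> carrier K" "b \<in> carrier K" "X \<in> carrier ?T" for a b X
  proof -
    note ab = that(1,2)
    obtain xs where xs: "xs \<in> L" "X = cls xs" using \<open>X \<in> carrier ?T\<close> unfolding carrier_class by auto
    thus ?thesis using ab class_eq[OF rel_smult_distr[OF ab xs(1)]]
      by (simp add: smult_class add_class map_smult_lists)
  qed
  have one: "\<one>\<^bsub>K\<^esub> \<odot>\<^bsub>?T\<^esub> X = X" if "X \<in> carrier ?T" for X
  proof -
    obtain xs where xs: "xs \<in> L" "X = cls xs" using \<open>X \<in> carrier ?T\<close> unfolding carrier_class by auto
    have "map (\<lambda>(m, n). (\<one>\<^bsub>K\<^esub> \<odot>\<^bsub>M\<^esub> m, n)) xs = xs" using xs(1) by (induction xs) auto
    thus ?thesis using xs by (simp add: smult_class)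
  qed
  have null: "\<zero>\<^bsub>K\<^esub> \<odot>\<^bsub>?T\<^esub> X = \<zero>\<^bsub>?T\<^esub>" if "X \<in> carrier ?T" for X
  proof -
    obtain xs where xs: "xs \<in> L" "X = cls xs" using \<open>X \<in> carrier ?T\<close> unfolding carrier_class by auto
    have "tensor_rel K M N (map (\<lambda>(m, n). (\<zero>\<^bsub>K\<^esub> \<odot>\<^bsub>M\<^esub> m, n)) xs) []" using xs(1)
    proof (induction xs)
      case Nil
      show ?case by (auto intro: tensor_rel.refl)
    next
      case (Cons x xs)
      have "tensor_rel K M N ([(\<zero>\<^bsub>M\<^esub>, snd x)] @ map (\<lambda>(m, n). (\<zero>\<^bsub>K\<^esub> \<odot>\<^bsub>M\<^esub> m, n)) xs) ([] @ [])"
        using Cons by (intro tensor_rel.append tensor_rel.zero) auto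
      thus ?case using Cons by auto
    qed
    thus ?thesis using xs by (simp add: smult_class zero_class class_eq)
  qed
  have "abelian_group ?T"
  proof (rule abelian_groupI)
    fix X Y Z assume "X \<in> carrier ?T" "Y \<in> carrier ?T" "Z \<in> carrier ?T"
    then obtain xs ys zs where "xs \<in> L" "X = cls xs" "ys \<in> L" "Y = cls ys" "zs \<in> L" "Z = cls zs"
      unfolding carrier_class by auto
    thus "X \<oplus>\<^bsub>?T\<^esub> Y \<oplus>\<^bsub>?T\<^esub> Z = X \<oplus>\<^bsub>?T\<^esub> (Y \<oplus>\<^bsub>?T\<^esub> Z)" by (simp add: add_class)
  next
    fix X Y assume "X \<in> carrier ?T" "Y \<in> carrier ?T"
    then obtain xs ys where "xs \<in> L" "X = cls xs" "ys \<in> L" "Y = cls ys"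
      unfolding carrier_class by auto
    thus "X \<oplus>\<^bsub>?T\<^esub> Y = Y \<oplus>\<^bsub>?T\<^esub> X" by (simp add: add_class class_eq[OF tensor_rel.commute])
  next
    fix X assume X: "X \<in> carrier ?T"
    then obtain xs where "xs \<in> L" "X = cls xs" unfolding carrier_class by auto
    thus "\<zero>\<^bsub>?T\<^esub> \<oplus>\<^bsub>?T\<^esub> X = X" by (simp add: zero_class add_class)
    have "(\<ominus>\<^bsub>K\<^esub> \<one>\<^bsub>K\<^esub>) \<odot>\<^bsub>?T\<^esub> X \<oplus>\<^bsub>?T\<^esub> \<one>\<^bsub>K\<^esub> \<odot>\<^bsub>?T\<^esub> X = \<zero>\<^bsub>?T\<^esub>"
      using X by (subst distr[symmetric]) (auto simp: null neg minus)
    thus "\<exists>Y\<in>carrier ?T. Y \<oplus>\<^bsub>?T\<^esub> X = \<zero>\<^bsub>?T\<^esub>" using X one closed[OF minus] by metis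
  qed (auto simp: aclosed, auto simp: carrier_class zero_class)
  moreover have "a \<odot>\<^bsub>?T\<^esub> (X \<oplus>\<^bsub>?T\<^esub> Y) = a \<odot>\<^bsub>?T\<^esub> X \<oplus>\<^bsub>?T\<^esub> a \<odot>\<^bsub>?T\<^esub> Y"
    if "a \<in> carrier K" "X \<in> carrier ?T" "Y \<in> carrier ?T" for a X Y
  proof -
    obtain xs ys where "xs \<in> L" "X = cls xs" "ys \<in> L" "Y = cls ys"
      using \<open>X \<in> carrier ?T\<close> \<open>Y \<in> carrier ?T\<close> unfolding carrier_class by auto
    thus ?thesis
      using \<open>a \<in> carrier K\<close> map_smult_lists smult_class[of a "xs @ ys"] by (simp add: smult_class add_class)
  qed
  moreover have "(a \<otimes>\<^bsub>K\<^esub> b) \<odot>\<^bsub>?T\<^esub> X = a \<odot>\<^bsub>?T\<^esub> (b \<odot>\<^bsub>?T\<^esub> X)"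
    if "a \<in> carrier K" "b \<in> carrier K" "X \<in> carrier ?T" for a b X
  proof -
    obtain xs where xs: "xs \<in> L" "X = cls xs" using \<open>X \<in> carrier ?T\<close> unfolding carrier_class by auto
    have "map (\<lambda>(m, n). ((a \<otimes>\<^bsub>K\<^esub> b) \<odot>\<^bsub>M\<^esub> m, n)) xs
      = map (\<lambda>(m, n). (a \<odot>\<^bsub>M\<^esub> m, n)) (map (\<lambda>(m, n). (b \<odot>\<^bsub>M\<^esub> m, n)) xs)"
      using xs(1) that by (auto simp: M.smult_assoc1)
    thus ?thesis using xs that by (simp add: smult_class map_smult_lists del: map_map)
  qed
  ultimately have "module K ?T" by (intro moduleI M.is_cring closed distr one)
  thus ?thesis by (intro kspace.intro M.field_axioms)
qed

lemma pure_bilinear: "bilinear_map K M N (tensor K M N) (pure_tensor K M N)"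
proof -
  have [simp]: "cls [(a \<odot>\<^bsub>M\<^esub> m, n)] = cls [(m, a \<odot>\<^bsub>N\<^esub> n)]" if "a \<in> carrier K" "m \<in> carrier M" "n \<in> carrier N" for a m n
    using that by (intro class_eq tensor_rel.smult)
  show ?thesis
    by (intro bilinear_mapI linear_mapI)
       (auto simp: pure_tensor_def carrier_class add_class smult_class
          intro!: class_eq tensor_rel.add_left tensor_rel.add_right tensor_rel.refl exI[of _ "[(_, _)]"] simp: Bex_def)
qed

text \<open>Each generator of the relation is one of the bilinearity laws for \<open>f\<close>, or holds in any abelian group.\<close>

lemma lift_rel:
  assumes "kspace K P" and f: "bilinear_map K M N P f" and "tensor_rel K M N xs ys"
  shows "list_lift P f xs = list_lift P f ys"
proof -
  interpret P: kspace K P by fact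
  have c: "f m n \<in> carrier P" if "m \<in> carrier M" "n \<in> carrier N" for m n
    using that f bilinear_map_closed by fast
  have l: "list_lift P f xs \<in> carrier P" if "xs \<in> L" for xs
    by (rule list_lift_closed[OF assms(1) _ that]) (rule c)
  have app: "list_lift P f (xs @ ys) = list_lift P f xs \<oplus>\<^bsub>P\<^esub> list_lift P f ys" if "xs \<in> L" "ys \<in> L" for xs ys
    by (rule list_lift_append[OF assms(1) _ that]) (rule c)
  have f1: "linear_map K N P (f m)" if "m \<in> carrier M" for m using f that unfolding bilinear_map_def by blast
  have f2: "linear_map K M P (\<lambda>m. f m n)" if "n \<in> carrier N" for n using f that unfolding bilinear_map_def by blast
  show ?thesis using assms(3)
  proof (induction rule: tensor_rel.induct)
    case (append xs xs' ys ys')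
    thus ?case using rel_lists by (simp add: app)
  next
    case (commute xs ys)
    thus ?case by (simp add: app l P.a_comm)
  next
    case (add_left m m' n)
    thus ?case using linear_map_add[OF f2] c by simp
  next
    case (add_right m n n')
    thus ?case using linear_map_add[OF f1] c by simp
  next
    case (smult a m n)
    thus ?case using linear_map_smult[OF f1] linear_map_smult[OF f2] by simp
  next
    case (zero n)
    thus ?case using linear_map_zero[OF M.kspace_axioms assms(1) f2] by simp
  qed auto
qed

lemma lift_class:
  assumes "kspace K P" and "bilinear_map K M N P f" and "xs \<in> L"
  shows "tensor_lift P f (cls xs) = list_lift P f xs"
proof -
  have "(SOME ys. ys \<in> cls xs) \<in> cls xs" using class_self[OF assms(3)] by (rule someI)
  thus ?thesis unfolding tensor_lift_rep
    using lift_rel[OF assms(1,2) tensor_rel.sym[OF class_mem]] by blast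
qed

lemma class_list_lift: "xs \<in> L \<Longrightarrow> cls xs = list_lift (tensor K M N) (pure_tensor K M N) xs"
proof (induction xs)
  case Nil
  show ?case by (simp add: zero_class)
next
  case (Cons x xs)
  have "cls (x # xs) = cls [x] \<oplus>\<^bsub>tensor K M N\<^esub> cls xs" using Cons by (subst add_class) auto
  thus ?case using Cons by (cases x) (auto simp: pure_tensor_def)
qed

end

lemma kspace_tensor [simp, intro]: "kspace K M \<Longrightarrow> kspace K N \<Longrightarrow> kspace K (tensor K M N)"
  by (rule tensor_pair.tensor_is_kspace) (rule tensor_pair.intro)

lemma pure_tensor_bilinear:
  "kspace K M \<Longrightarrow> kspace K N \<Longrightarrow> bilinear_map K M N (tensor K M N) (pure_tensor K M N)"
  by (rule tensor_pair.pure_bilinear) (rule tensor_pair.intro)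

lemma pure_tensor_closed [simp, intro]:
  "kspace K M \<Longrightarrow> kspace K N \<Longrightarrow> m \<in> carrier M \<Longrightarrow> n \<in> carrier N \<Longrightarrow>
    pure_tensor K M N m n \<in> carrier (tensor K M N)"
  using bilinear_map_closed[OF pure_tensor_bilinear] .

lemma rep_in_lists:
  "t \<in> carrier (tensor K M N) \<Longrightarrow> kspace K M \<Longrightarrow> kspace K N \<Longrightarrow> (SOME xs. xs \<in> t) \<in> lists (carrier M \<times> carrier N)"
  by (rule tensor_pair.rep(1)) (rule tensor_pair.intro)

lemma tensor_lift_closed:
  assumes "t \<in> carrier (tensor K M N)" "kspace K M" "kspace K N" "kspace K P"
    and "\<And>m n. \<lbrakk>m \<in> carrier M; n \<in> carrier N\<rbrakk> \<Longrightarrow> f m n \<in> carrier P"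
  shows "tensor_lift P f t \<in> carrier P"
  unfolding tensor_lift_rep by (rule list_lift_closed[OF assms(4,5) rep_in_lists[OF assms(1-3)]])

lemma tensor_lift_cong:
  assumes "t \<in> carrier (tensor K M N)" "kspace K M" "kspace K N"
    and "\<And>m n. \<lbrakk>m \<in> carrier M; n \<in> carrier N\<rbrakk> \<Longrightarrow> f m n = g m n"
  shows "tensor_lift P f t = tensor_lift P g t"
  unfolding tensor_lift_rep by (rule list_lift_cong[OF assms(4) rep_in_lists[OF assms(1-3)]])

text \<open>Both sides are sums over the same representative of \<open>t\<close>, so the equation is additivity of \<open>\<phi>\<close>; the same
  reason gives \<open>tensor_lift_cong\<close> and \<open>tensor_lift_add\<close>.\<close>

lemma linear_tensor_lift:
  assumes "t \<in> carrier (tensor K M N)" "kspace K M" "kspace K N" "kspace K P" "kspace K Q"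
    and "linear_map K P Q \<phi>" and "\<And>m n. \<lbrakk>m \<in> carrier M; n \<in> carrier N\<rbrakk> \<Longrightarrow> f m n \<in> carrier P"
  shows "\<phi> (tensor_lift P f t) = tensor_lift Q (\<lambda>m n. \<phi> (f m n)) t"
  unfolding tensor_lift_rep by (rule list_lift_linear[OF assms(4-7) rep_in_lists[OF assms(1-3)]])

lemma tensor_lift_add:
  assumes "t \<in> carrier (tensor K M N)" "kspace K M" "kspace K N" "kspace K P"
    and "\<And>m n. \<lbrakk>m \<in> carrier M; n \<in> carrier N\<rbrakk> \<Longrightarrow> f m n \<in> carrier P"
    and "\<And>m n. \<lbrakk>m \<in> carrier M; n \<in> carrier N\<rbrakk> \<Longrightarrow> g m n \<in> carrier P"
  shows "tensor_lift P (\<lambda>m n. f m n \<oplus>\<^bsub>P\<^esub> g m n) t = tensor_lift P f t \<oplus>\<^bsub>P\<^esub> tensor_lift P g t"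
  unfolding tensor_lift_rep by (rule list_lift_add[OF assms(4-6) rep_in_lists[OF assms(1-3)]])

lemma tensor_lift_linear:
  assumes M: "kspace K M" and N: "kspace K N" and P: "kspace K P" and f: "bilinear_map K M N P f"
  shows "linear_map K (tensor K M N) P (tensor_lift P f)"
proof -
  interpret tensor_pair K M N using M N by (rule tensor_pair.intro)
  interpret P: kspace K P by fact
  have c: "f m n \<in> carrier P" if "m \<in> carrier M" "n \<in> carrier N" for m n
    using that f bilinear_map_closed by fast
  have f2: "linear_map K M P (\<lambda>m. f m n)" if "n \<in> carrier N" for n using f that unfolding bilinear_map_def by blast
  have l: "list_lift P f xs \<in> carrier P" if "xs \<in> L" for xs
    by (rule list_lift_closed[OF P _ that]) (rule c)
  show ?thesis
  proof (rule linear_mapI)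
    fix X assume "X \<in> carrier (tensor K M N)"
    thus "tensor_lift P f X \<in> carrier P" using M N P c by (rule tensor_lift_closed)
  next
    fix X Y assume "X \<in> carrier (tensor K M N)" "Y \<in> carrier (tensor K M N)"
    then obtain xs ys where "xs \<in> L" "ys \<in> L" "X = cls xs" "Y = cls ys" unfolding carrier_class by auto
    thus "tensor_lift P f (X \<oplus>\<^bsub>tensor K M N\<^esub> Y) = tensor_lift P f X \<oplus>\<^bsub>P\<^esub> tensor_lift P f Y"
      using list_lift_append[OF P c] by (simp add: add_class lift_class[OF P f])
  next
    fix a X assume a: "a \<in> carrier K" and "X \<in> carrier (tensor K M N)"
    then obtain xs where xs: "xs \<in> L" "X = cls xs" unfolding carrier_class by auto
    have "list_lift P f (map (\<lambda>(m, n). (a \<odot>\<^bsub>M\<^esub> m, n)) xs) = a \<odot>\<^bsub>P\<^esub> list_lift P f xs"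
      using xs(1)
    proof (induction xs)
      case Nil
      show ?case using a by simp
    next
      case (Cons x xs)
      obtain m n where "x = (m, n)" by (cases x)
      thus ?case using Cons a l c linear_map_smult[OF f2] by (auto simp: P.smult_r_distr)
    qed
    thus "tensor_lift P f (a \<odot>\<^bsub>tensor K M N\<^esub> X) = a \<odot>\<^bsub>P\<^esub> tensor_lift P f X"
      using xs a by (simp add: smult_class lift_class[OF P f] map_smult_lists)
  qed
qed

lemma tensor_lift_pure:
  assumes M: "kspace K M" and N: "kspace K N" and P: "kspace K P" and f: "bilinear_map K M N P f"
    and m: "m \<in> carrier M" and n: "n \<in> carrier N"
  shows "tensor_lift P f (pure_tensor K M N m n) = f m n"
proof -
  interpret tensor_pair K M N using M N by (rule tensor_pair.intro)
  interpret P: kspace K P by fact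
  have "f m n \<in> carrier P" using bilinear_map_closed[OF f] m n by fast
  thus ?thesis using m n lift_class[OF P f, of "[(m, n)]"] by (simp add: pure_tensor_def)
qed

lemma tensor_lift_pure_id:
  assumes M: "kspace K M" and N: "kspace K N" and t: "t \<in> carrier (tensor K M N)"
  shows "tensor_lift (tensor K M N) (pure_tensor K M N) t = t"
proof -
  interpret tensor_pair K M N using M N by (rule tensor_pair.intro)
  show ?thesis unfolding tensor_lift_rep using rep[OF t] class_list_lift by metis
qed

lemma linear_map_eq_tensor_lift:
  assumes M: "kspace K M" and N: "kspace K N" and P: "kspace K P" and t: "t \<in> carrier (tensor K M N)"
    and \<phi>: "linear_map K (tensor K M N) P \<phi>"
  shows "\<phi> t = tensor_lift P (\<lambda>m n. \<phi> (pure_tensor K M N m n)) t"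
proof -
  have "\<phi> t = \<phi> (tensor_lift (tensor K M N) (pure_tensor K M N) t)"
    using tensor_lift_pure_id[OF M N t] by simp
  also have "\<dots> = tensor_lift P (\<lambda>m n. \<phi> (pure_tensor K M N m n)) t"
    by (rule linear_tensor_lift[OF t M N kspace_tensor[OF M N] P \<phi>]) (use M N in auto)
  finally show ?thesis .
qed

lemma tensor_ext:
  assumes M: "kspace K M" and N: "kspace K N" and P: "kspace K P" and t: "t \<in> carrier (tensor K M N)"
    and \<phi>: "linear_map K (tensor K M N) P \<phi>" and \<psi>: "linear_map K (tensor K M N) P \<psi>"
    and "\<And>m n. \<lbrakk>m \<in> carrier M; n \<in> carrier N\<rbrakk> \<Longrightarrow> \<phi> (pure_tensor K M N m n) = \<psi> (pure_tensor K M N m n)"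
  shows "\<phi> t = \<psi> t"
  unfolding linear_map_eq_tensor_lift[OF M N P t \<phi>] linear_map_eq_tensor_lift[OF M N P t \<psi>]
  by (rule tensor_lift_cong[OF t M N assms(7)])

lemma tensor_lift_lift:
  assumes t: "t \<in> carrier (tensor K M N)" and "kspace K M" "kspace K N" "kspace K M'" "kspace K N'" "kspace K P"
    and "bilinear_map K M' N' P G"
    and "\<And>m n. \<lbrakk>m \<in> carrier M; n \<in> carrier N\<rbrakk> \<Longrightarrow> f m n \<in> carrier (tensor K M' N')"
  shows "tensor_lift P G (tensor_lift (tensor K M' N') f t) = tensor_lift P (\<lambda>m n. tensor_lift P G (f m n)) t"
  by (rule linear_tensor_lift[OF t]) (use assms tensor_lift_linear in auto)

text \<open>This rule and the next one settle linearity of a Sweedler sum in \<open>x\<close>, according to whether \<open>x\<close> occurs in the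
  tensor that is summed over or in the summand.  The first premise comes first because it determines
  the spaces that the remaining ones refer to.\<close>

lemma linear_map_tensor_lift_arg:
  assumes "linear_map K L (tensor K M N) e" "kspace K M" "kspace K N" "kspace K P" "bilinear_map K M N P f"
  shows "linear_map K L P (\<lambda>x. tensor_lift P f (e x))"
  using tensor_lift_linear[OF assms(2-5)] assms(1) by (rule linear_map_comp)

lemma linear_map_tensor_lift_param:
  assumes t: "t \<in> carrier (tensor K M N)" and M: "kspace K M" and N: "kspace K N" and P: "kspace K P"
    and f: "\<And>m n. \<lbrakk>m \<in> carrier M; n \<in> carrier N\<rbrakk> \<Longrightarrow> linear_map K L P (\<lambda>x. f x m n)"
  shows "linear_map K L P (\<lambda>x. tensor_lift P (f x) t)"
proof (rule linear_mapI)
  fix x y assume xy: "x \<in> carrier L" "y \<in> carrier L"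
  have "tensor_lift P (f (x \<oplus>\<^bsub>L\<^esub> y)) t = tensor_lift P (\<lambda>m n. f x m n \<oplus>\<^bsub>P\<^esub> f y m n) t"
    by (rule tensor_lift_cong[OF t M N]) (use xy linear_map_add[OF f] in auto)
  also have "\<dots> = tensor_lift P (f x) t \<oplus>\<^bsub>P\<^esub> tensor_lift P (f y) t"
    by (rule tensor_lift_add[OF t M N P]) (use xy linear_map_closed[OF f] in auto)
  finally show "tensor_lift P (f (x \<oplus>\<^bsub>L\<^esub> y)) t = tensor_lift P (f x) t \<oplus>\<^bsub>P\<^esub> tensor_lift P (f y) t" .
next
  fix a x assume ax: "a \<in> carrier K" "x \<in> carrier L"
  have "tensor_lift P (f (a \<odot>\<^bsub>L\<^esub> x)) t = tensor_lift P (\<lambda>m n. a \<odot>\<^bsub>P\<^esub> f x m n) t"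
    by (rule tensor_lift_cong[OF t M N]) (use ax linear_map_smult[OF f] in auto)
  also have "\<dots> = a \<odot>\<^bsub>P\<^esub> tensor_lift P (f x) t"
    by (rule linear_tensor_lift[OF t M N P P, symmetric])
       (use ax linear_map_closed[OF f] linear_map_smult_const[OF P _ linear_map_id] in auto)
  finally show "tensor_lift P (f (a \<odot>\<^bsub>L\<^esub> x)) t = a \<odot>\<^bsub>P\<^esub> tensor_lift P (f x) t" .
next
  fix x assume "x \<in> carrier L"
  thus "tensor_lift P (f x) t \<in> carrier P"
    using linear_map_closed[OF f] by (intro tensor_lift_closed[OF t M N P]) auto
qed

lemma tensor_map_lift:
  assumes "t \<in> carrier (tensor K M N)" "kspace K M" "kspace K N" "kspace K M'" "kspace K N'" "kspace K P"
    and "\<And>m. m \<in> carrier M \<Longrightarrow> f m \<in> carrier M'" "\<And>n. n \<in> carrier N \<Longrightarrow> g n \<in> carrier N'"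
    and "bilinear_map K M' N' P G"
  shows "tensor_lift P G (tensor_map K M' N' f g t) = tensor_lift P (\<lambda>m n. G (f m) (g n)) t"
proof -
  have "tensor_lift P G (tensor_map K M' N' f g t)
      = tensor_lift P (\<lambda>m n. tensor_lift P G (pure_tensor K M' N' (f m) (g n))) t"
    unfolding tensor_map_def by (rule tensor_lift_lift) (use assms in auto)
  also have "\<dots> = tensor_lift P (\<lambda>m n. G (f m) (g n)) t"
    by (rule tensor_lift_cong[OF assms(1-3)]) (use assms in \<open>auto intro: tensor_lift_pure\<close>)
  finally show ?thesis .
qed

lemma tensor_map_closed:
  assumes "t \<in> carrier (tensor K M N)" "kspace K M" "kspace K N" "kspace K M'" "kspace K N'"
    and "\<And>m. m \<in> carrier M \<Longrightarrow> f m \<in> carrier M'" "\<And>n. n \<in> carrier N \<Longrightarrow> g n \<in> carrier N'"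
  shows "tensor_map K M' N' f g t \<in> carrier (tensor K M' N')"
  unfolding tensor_map_def by (rule tensor_lift_closed) (use assms in auto)

lemma tensor_map_linear:
  assumes "kspace K M" "kspace K N" "kspace K M'" "kspace K N'"
    and "linear_map K M M' f" "linear_map K N N' g"
  shows "linear_map K (tensor K M N) (tensor K M' N') (tensor_map K M' N' f g)"
proof -
  have "bilinear_map K M N (tensor K M' N') (\<lambda>m n. pure_tensor K M' N' (f m) (g n))"
    by (intro bilinear_mapI bilinear_map_left[OF pure_tensor_bilinear] bilinear_map_right[OF pure_tensor_bilinear])
       (use assms linear_map_closed in auto)
  thus ?thesis unfolding tensor_map_def by (rule tensor_lift_linear[rotated 3]) (use assms in auto)
qed

lemma tensor_map_pure:
  assumes "kspace K M" "kspace K N" "kspace K M'" "kspace K N'"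
    and "linear_map K M M' f" "linear_map K N N' g" and "m \<in> carrier M" "n \<in> carrier N"
  shows "tensor_map K M' N' f g (pure_tensor K M N m n) = pure_tensor K M' N' (f m) (g n)"
proof -
  have "bilinear_map K M N (tensor K M' N') (\<lambda>m n. pure_tensor K M' N' (f m) (g n))"
    by (intro bilinear_mapI bilinear_map_left[OF pure_tensor_bilinear] bilinear_map_right[OF pure_tensor_bilinear])
       (use assms linear_map_closed in auto)
  thus ?thesis unfolding tensor_map_def using assms by (intro tensor_lift_pure) auto
qed

lemma tensor_map2_lift:
  assumes t: "t \<in> carrier (tensor K M N)" and M: "kspace K M" and N: "kspace K N"
    and t': "t' \<in> carrier (tensor K M' N')" and M': "kspace K M'" and N': "kspace K N'"
    and U: "kspace K U" and V: "kspace K V" and P: "kspace K P" and F: "bilinear_map K U V P F"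
    and f: "\<And>m m'. \<lbrakk>m \<in> carrier M; m' \<in> carrier M'\<rbrakk> \<Longrightarrow> f m m' \<in> carrier U"
    and g: "\<And>n n'. \<lbrakk>n \<in> carrier N; n' \<in> carrier N'\<rbrakk> \<Longrightarrow> g n n' \<in> carrier V"
  shows "tensor_lift P F (tensor_map2 K U V f g t t')
    = tensor_lift P (\<lambda>m n. tensor_lift P (\<lambda>m' n'. F (f m m') (g n n')) t') t"
proof -
  have "tensor_lift P F (tensor_map2 K U V f g t t')
    = tensor_lift P (\<lambda>m n. tensor_lift P F (tensor_lift (tensor K U V)
        (\<lambda>m' n'. pure_tensor K U V (f m m') (g n n')) t')) t"
    unfolding tensor_map2_def
    by (rule tensor_lift_lift[OF t M N U V P F]) (use U V f g in \<open>auto intro!: tensor_lift_closed[OF t' M' N']\<close>)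
  also have "\<dots> = tensor_lift P (\<lambda>m n. tensor_lift P (\<lambda>m' n'. F (f m m') (g n n')) t') t"
  proof (rule tensor_lift_cong[OF t M N])
    fix m n assume mn: "m \<in> carrier M" "n \<in> carrier N"
    have "tensor_lift P F (tensor_lift (tensor K U V) (\<lambda>m' n'. pure_tensor K U V (f m m') (g n n')) t')
      = tensor_lift P (\<lambda>m' n'. tensor_lift P F (pure_tensor K U V (f m m') (g n n'))) t'"
      by (rule tensor_lift_lift[OF t' M' N' U V P F]) (use U V f g mn in auto)
    also have "\<dots> = tensor_lift P (\<lambda>m' n'. F (f m m') (g n n')) t'"
      by (rule tensor_lift_cong[OF t' M' N'], rule tensor_lift_pure[OF U V P F]) (use f g mn in auto)
    finally show "tensor_lift P F (tensor_lift (tensor K U V) (\<lambda>m' n'. pure_tensor K U V (f m m') (g n n')) t')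
      = tensor_lift P (\<lambda>m' n'. F (f m m') (g n n')) t'" .
  qed
  finally show ?thesis .
qed

text \<open>A coassociativity axiom, read as a rule for threefold Sweedler sums.  The four spaces and two maps are
  kept general in order to cover the comultiplication, one-sided coactions, and the compatibility of a left with a
  right coaction.\<close>

lemma sweedler_assoc:
  assumes L: "kspace K L" and M: "kspace K M" and N: "kspace K N" and U: "kspace K U" and V: "kspace K V" and P: "kspace K P"
    and t: "t \<in> carrier (tensor K U N)" and t': "t' \<in> carrier (tensor K L V)"
    and d: "\<And>u. u \<in> carrier U \<Longrightarrow> d u \<in> carrier (tensor K L M)"
    and e: "\<And>v. v \<in> carrier V \<Longrightarrow> e v \<in> carrier (tensor K M N)"
    and coassoc: "tensor_assoc K L M N (tensor_map K (tensor K L M) N d (\<lambda>y. y) t)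
      = tensor_map K L (tensor K M N) (\<lambda>y. y) e t'"
    and F1: "\<And>m n. \<lbrakk>m \<in> carrier M; n \<in> carrier N\<rbrakk> \<Longrightarrow> linear_map K L P (\<lambda>l. F l m n)"
    and F2: "\<And>l n. \<lbrakk>l \<in> carrier L; n \<in> carrier N\<rbrakk> \<Longrightarrow> linear_map K M P (\<lambda>m. F l m n)"
    and F3: "\<And>l m. \<lbrakk>l \<in> carrier L; m \<in> carrier M\<rbrakk> \<Longrightarrow> linear_map K N P (\<lambda>n. F l m n)"
  shows "tensor_lift P (\<lambda>u n. tensor_lift P (\<lambda>l m. F l m n) (d u)) t
    = tensor_lift P (\<lambda>l v. tensor_lift P (\<lambda>m n. F l m n) (e v)) t'"
proof -
  let ?T = "tensor K L (tensor K M N)"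
  let ?G = "\<lambda>l s. tensor_lift P (\<lambda>m n. F l m n) s"
  let ?a = "\<lambda>n l m. pure_tensor K L (tensor K M N) l (pure_tensor K M N m n)"
  have bil: "bilinear_map K M N P (\<lambda>m n. F l m n)" if "l \<in> carrier L" for l
    using that by (intro bilinear_mapI F2 F3)
  have G: "bilinear_map K L (tensor K M N) P ?G"
    by (intro bilinear_mapI linear_map_tensor_lift_param[OF _ M N P] tensor_lift_linear[OF M N P] bil F1)
  have pl: "linear_map K L ?T (\<lambda>l. pure_tensor K L (tensor K M N) l s)" if "s \<in> carrier (tensor K M N)" for s
    using that L M N by (intro bilinear_map_left[OF pure_tensor_bilinear] linear_map_id) auto
  have a: "bilinear_map K L M ?T (?a n)" if "n \<in> carrier N" for n
    using that L M N
    by (intro bilinear_mapI pl bilinear_map_right[OF pure_tensor_bilinear]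
      bilinear_map_left[OF pure_tensor_bilinear] linear_map_id) auto
  have a': "linear_map K N ?T (\<lambda>n. ?a n l m)" if "l \<in> carrier L" "m \<in> carrier M" for l m
    using that L M N
    by (intro bilinear_map_right[OF pure_tensor_bilinear] linear_map_id) auto
  have lin: "bilinear_map K (tensor K L M) N ?T (\<lambda>t n. tensor_lift ?T (?a n) t)"
    using L M N
    by (intro bilinear_mapI linear_map_tensor_lift_param[OF _ L M] tensor_lift_linear[OF L M] a a') auto
  have ap: "tensor_lift P ?G (?a n l m) = F l m n" if "l \<in> carrier L" "m \<in> carrier M" "n \<in> carrier N" for l m n
  proof -
    have "tensor_lift P ?G (?a n l m) = ?G l (pure_tensor K M N m n)"
      using that L M N P by (intro tensor_lift_pure G) auto
    also have "\<dots> = F l m n" using that bil by (intro tensor_lift_pure M N P) auto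
    finally show ?thesis .
  qed
  have "tensor_lift P ?G (tensor_map K L (tensor K M N) (\<lambda>y. y) e t')
     = tensor_lift P (\<lambda>l v. ?G l (e v)) t'"
    by (rule tensor_map_lift) (use assms G in auto)
  moreover have "tensor_lift P ?G (tensor_assoc K L M N (tensor_map K (tensor K L M) N d (\<lambda>y. y) t))
     = tensor_lift P (\<lambda>u n. tensor_lift P (\<lambda>l m. F l m n) (d u)) t"
  proof -
    have "tensor_lift P ?G (tensor_assoc K L M N (tensor_map K (tensor K L M) N d (\<lambda>y. y) t))
      = tensor_lift P ?G (tensor_lift ?T (\<lambda>u n. tensor_lift ?T (?a n) (d u)) t)"
      unfolding tensor_assoc_def by (subst tensor_map_lift[OF t U N _ N _ d _ lin]) (use L M N in auto)
    also have "\<dots> = tensor_lift P (\<lambda>u n. tensor_lift P ?G (tensor_lift ?T (?a n) (d u))) t"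
      by (rule tensor_lift_lift[OF t U N L _ P G])
         (use M N L in \<open>auto intro!: tensor_lift_closed[OF d]\<close>)
    also have "\<dots> = tensor_lift P (\<lambda>u n. tensor_lift P (\<lambda>l m. tensor_lift P ?G (?a n l m)) (d u)) t"
      by (rule tensor_lift_cong[OF t U N], rule tensor_lift_lift[OF d L M L _ P G]) (use L M N in auto)
    also have "\<dots> = tensor_lift P (\<lambda>u n. tensor_lift P (\<lambda>l m. F l m n) (d u)) t"
      by (rule tensor_lift_cong[OF t U N], rule tensor_lift_cong[OF d L M]) (auto intro: ap)
    finally show ?thesis .
  qed
  ultimately show ?thesis using coassoc by simp
qed

lemma tensor_lift_swap:
  assumes t: "t \<in> carrier (tensor K M N)" "kspace K M" "kspace K N"
    and t': "t' \<in> carrier (tensor K M' N')" "kspace K M'" "kspace K N'" and P: "kspace K P"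
    and F: "\<And>m n m' n'. \<lbrakk>m \<in> carrier M; n \<in> carrier N; m' \<in> carrier M'; n' \<in> carrier N'\<rbrakk> \<Longrightarrow> F m n m' n' \<in> carrier P"
  shows "tensor_lift P (\<lambda>m n. tensor_lift P (\<lambda>m' n'. F m n m' n') t') t
    = tensor_lift P (\<lambda>m' n'. tensor_lift P (\<lambda>m n. F m n m' n') t) t'"
proof -
  interpret P: kspace K P by fact
  have "list_lift P (\<lambda>m n. tensor_lift P (\<lambda>m' n'. F m n m' n') t') xs
    = tensor_lift P (\<lambda>m' n'. list_lift P (\<lambda>m n. F m n m' n') xs) t'"
    if "xs \<in> lists (carrier M \<times> carrier N)" for xs
    using that
  proof (induction xs)
    case Nil
    show ?case
      using linear_tensor_lift[OF t' P P linear_map_zero_const[OF P], of "\<lambda>m n. \<zero>\<^bsub>P\<^esub>"] by simp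
  next
    case (Cons x xs)
    obtain m n where x: "x = (m, n)" by (cases x)
    have "list_lift P (\<lambda>m n. F m n m' n') xs \<in> carrier P" if "m' \<in> carrier M'" "n' \<in> carrier N'" for m' n'
      by (rule list_lift_closed[OF P, where U = "carrier M" and V = "carrier N"]) (use F Cons that in auto)
    hence "tensor_lift P (\<lambda>m' n'. F m n m' n' \<oplus>\<^bsub>P\<^esub> list_lift P (\<lambda>m n. F m n m' n') xs) t'
      = tensor_lift P (\<lambda>m' n'. F m n m' n') t' \<oplus>\<^bsub>P\<^esub> tensor_lift P (\<lambda>m' n'. list_lift P (\<lambda>m n. F m n m' n') xs) t'"
      using F Cons x by (intro tensor_lift_add[OF t' P]) auto
    thus ?case using Cons x by simp
  qed
  from this[OF rep_in_lists[OF t]] show ?thesis unfolding tensor_lift_rep[of P _ t] .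
qed

lemma tensor_lift_in_submodule:
  assumes t: "t \<in> carrier (tensor K M N)" "kspace K M" "kspace K N" and N: "submodule N0 K P"
    and f: "\<And>m n. \<lbrakk>m \<in> carrier M; n \<in> carrier N\<rbrakk> \<Longrightarrow> f m n \<in> N0"
  shows "tensor_lift P f t \<in> N0"
proof -
  interpret N: submodule N0 K P by fact
  have "list_lift P f xs \<in> N0" if "xs \<in> lists (carrier M \<times> carrier N)" for xs
    using that by (induction xs) (use f N.one_closed N.m_closed in auto)
  from this[OF rep_in_lists[OF t]] show ?thesis unfolding tensor_lift_rep[of P _ t] .
qed

lemma tensor_rel_mono:
  assumes "tensor_rel K M N xs ys"
    and "carrier M = carrier M'" "add M = add M'" "zero M = zero M'" "smult M = smult M'"
    and "carrier N = carrier N'" "add N = add N'" "zero N = zero N'" "smult N = smult N'"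
  shows "tensor_rel K M' N' xs ys"
  using assms(1)
  by (induction rule: tensor_rel.induct)
     (use assms(2-) in \<open>simp_all add: tensor_rel.intros(1,4-)\<close>, blast intro: tensor_rel.intros(2), blast intro: tensor_rel.intros(3))

text \<open>A tensor product sees nothing of a multiplication or action that its factors may carry.\<close>

lemma tensor_rel_cong:
  assumes "carrier M = carrier M'" "add M = add M'" "zero M = zero M'" "smult M = smult M'"
    and "carrier N = carrier N'" "add N = add N'" "zero N = zero N'" "smult N = smult N'"
  shows "tensor_rel K M N = tensor_rel K M' N'"
  by (intro ext iffI; erule tensor_rel_mono) (use assms in simp_all)

lemma tensor_cong:
  assumes "carrier M = carrier M'" "add M = add M'" "zero M = zero M'" "smult M = smult M'"
  shows "tensor K M N = tensor K M' N" "pure_tensor K M N = pure_tensor K M' N"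
    "tensor_map K M N = tensor_map K M' N"
proof -
  have c: "tensor_class K M N = tensor_class K M' N"
    unfolding tensor_class_def tensor_rel_cong[OF assms HOL.refl HOL.refl HOL.refl HOL.refl] ..
  show 1: "tensor K M N = tensor K M' N" unfolding tensor_def c assms ..
  show 2: "pure_tensor K M N = pure_tensor K M' N" unfolding pure_tensor_def c ..
  show "tensor_map K M N = tensor_map K M' N" unfolding tensor_map_def 1 2 ..
qed

section \<open>Sweedler sums in a Hopf algebra\<close>

lemma (in k_algebra) mult_bilinear: "bilinear_map K A A A (mult A)"
  by (intro bilinear_mapI linear_mapI)
     (auto simp: l_distr r_distr smult_mult_left[symmetric] smult_mult_right[symmetric])

lemma linear_map_counit_smult:
  assumes "hopf_algebra K H" and "kspace K M" and m: "m \<in> carrier M" and e: "linear_map K L H e"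
  shows "linear_map K L M (\<lambda>x. counit H (e x) \<odot>\<^bsub>M\<^esub> m)"
proof -
  interpret hopf_algebra K H by fact
  interpret M: kspace K M by fact
  have c: "counit H x \<in> carrier K" if "x \<in> carrier H" for x using counit_closed that by auto
  have "linear_map K H M (\<lambda>x. counit H x \<odot>\<^bsub>M\<^esub> m)"
    using m c by (intro linear_mapI) (auto simp: counit_add counit_smult M.smult_l_distr M.smult_assoc1)
  thus ?thesis using e by (rule linear_map_comp)
qed

context hopf_algebra
begin

lemma kspace_H [simp, intro]: "kspace K H"
  by (rule kspace_axioms)

lemma counit_in_field [simp]: "x \<in> carrier H \<Longrightarrow> counit H x \<in> carrier K"
  using counit_closed by auto

lemma comult_closed [simp]: "x \<in> carrier H \<Longrightarrow> comult H x \<in> carrier (tensor K H H)"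
  by (rule linear_map_closed[OF comult_linear])

lemma antipode_closed [simp]: "x \<in> carrier H \<Longrightarrow> antipode H x \<in> carrier H"
  by (rule linear_map_closed[OF antipode_linear])

lemma lift_comult_closed [simp]:
  "\<lbrakk>x \<in> carrier H; kspace K P; \<And>m n. \<lbrakk>m \<in> carrier H; n \<in> carrier H\<rbrakk> \<Longrightarrow> f m n \<in> carrier P\<rbrakk> \<Longrightarrow>
    tensor_lift P f (comult H x) \<in> carrier P"
  by (rule tensor_lift_closed) auto

lemma lift_comult_cong:
  "\<lbrakk>x \<in> carrier H; \<And>m n. \<lbrakk>m \<in> carrier H; n \<in> carrier H\<rbrakk> \<Longrightarrow> f m n = g m n\<rbrakk> \<Longrightarrow>
    tensor_lift P f (comult H x) = tensor_lift P g (comult H x)"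
  by (rule tensor_lift_cong) auto

lemma linear_lift_comult:
  assumes "linear_map K P Q \<phi>" "kspace K P" "kspace K Q" "x \<in> carrier H"
    and "\<And>m n. \<lbrakk>m \<in> carrier H; n \<in> carrier H\<rbrakk> \<Longrightarrow> f m n \<in> carrier P"
  shows "\<phi> (tensor_lift P f (comult H x)) = tensor_lift Q (\<lambda>m n. \<phi> (f m n)) (comult H x)"
  by (rule linear_tensor_lift[where K = K]) (use assms in auto)

lemmas linear_map_mult_left = bilinear_map_left[OF mult_bilinear]

lemmas linear_map_mult_right = bilinear_map_right[OF mult_bilinear]

lemmas linear_map_antipode = linear_map_comp[OF antipode_linear]

lemmas linear_map_comult = linear_map_comp[OF comult_linear]

lemmas linear_map_counit = linear_map_counit_smult[OF hopf_algebra_axioms]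

text \<open>In a goal \<open>linear_map K L M (\<lambda>x. e)\<close> the head symbol of \<open>e\<close> and the place where \<open>x\<close> occurs select at most one of
  these rules, so repeated resolution, with \<open>simp\<close> for the membership premises, proves multilinearity of
  Sweedler terms.  The closedness rules at the end instantiate the spaces that \<open>linear_map_tensor_lift_param\<close> leaves
  open.\<close>

lemmas hopf_linear = linear_map_id bilinear_mapI linear_map_mult_left linear_map_mult_right
  linear_map_antipode linear_map_comult linear_map_counit
  linear_map_smult_const
  bilinear_map_left[OF pure_tensor_bilinear] bilinear_map_right[OF pure_tensor_bilinear]
  linear_map_tensor_lift_param linear_map_tensor_lift_arg tensor_lift_linear pure_tensor_closed comult_closed

lemma coassoc_lift:
  assumes "x \<in> carrier H" "kspace K P"
    and "\<And>b c. \<lbrakk>b \<in> carrier H; c \<in> carrier H\<rbrakk> \<Longrightarrow> linear_map K H P (\<lambda>a. F a b c)"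
    and "\<And>a c. \<lbrakk>a \<in> carrier H; c \<in> carrier H\<rbrakk> \<Longrightarrow> linear_map K H P (\<lambda>b. F a b c)"
    and "\<And>a b. \<lbrakk>a \<in> carrier H; b \<in> carrier H\<rbrakk> \<Longrightarrow> linear_map K H P (\<lambda>c. F a b c)"
  shows "tensor_lift P (\<lambda>u c. tensor_lift P (\<lambda>a b. F a b c) (comult H u)) (comult H x)
    = tensor_lift P (\<lambda>a v. tensor_lift P (\<lambda>b c. F a b c) (comult H v)) (comult H x)"
  by (rule sweedler_assoc[OF kspace_H kspace_H kspace_H kspace_H kspace_H assms(2) _ _ _ _ coassoc assms(3-5)])
     (use assms in auto)

lemma counit_left_lift:
  assumes "linear_map K H P F" "kspace K P" "x \<in> carrier H"
  shows "tensor_lift P (\<lambda>a b. counit H a \<odot>\<^bsub>P\<^esub> F b) (comult H x) = F x"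
proof -
  have "F x = F (tensor_lift H (\<lambda>a b. counit H a \<odot>\<^bsub>H\<^esub> b) (comult H x))" using assms by (simp add: counit_left)
  also have "\<dots> = tensor_lift P (\<lambda>a b. F (counit H a \<odot>\<^bsub>H\<^esub> b)) (comult H x)"
    by (rule linear_lift_comult) (use assms in auto)
  also have "\<dots> = tensor_lift P (\<lambda>a b. counit H a \<odot>\<^bsub>P\<^esub> F b) (comult H x)"
    by (rule lift_comult_cong) (use assms in \<open>auto simp: linear_map_smult\<close>)
  finally show ?thesis ..
qed

lemma counit_right_lift:
  assumes "linear_map K H P F" "kspace K P" "x \<in> carrier H"
  shows "tensor_lift P (\<lambda>a b. counit H b \<odot>\<^bsub>P\<^esub> F a) (comult H x) = F x"
proof -
  have "F x = F (tensor_lift H (\<lambda>a b. counit H b \<odot>\<^bsub>H\<^esub> a) (comult H x))" using assms by (simp add: counit_right)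
  also have "\<dots> = tensor_lift P (\<lambda>a b. F (counit H b \<odot>\<^bsub>H\<^esub> a)) (comult H x)"
    by (rule linear_lift_comult) (use assms in auto)
  also have "\<dots> = tensor_lift P (\<lambda>a b. counit H b \<odot>\<^bsub>P\<^esub> F a) (comult H x)"
    by (rule lift_comult_cong) (use assms in \<open>auto simp: linear_map_smult\<close>)
  finally show ?thesis ..
qed

lemma antipode_left_lift:
  assumes "linear_map K H P F" "kspace K P" "x \<in> carrier H"
  shows "tensor_lift P (\<lambda>a b. F (antipode H a \<otimes>\<^bsub>H\<^esub> b)) (comult H x) = counit H x \<odot>\<^bsub>P\<^esub> F \<one>\<^bsub>H\<^esub>"
proof -
  have "tensor_lift P (\<lambda>a b. F (antipode H a \<otimes>\<^bsub>H\<^esub> b)) (comult H x)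
    = F (tensor_lift H (\<lambda>a b. antipode H a \<otimes>\<^bsub>H\<^esub> b) (comult H x))"
    by (rule linear_lift_comult[symmetric]) (use assms in auto)
  thus ?thesis using assms by (simp add: antipode_left linear_map_smult)
qed

lemma antipode_right_lift:
  assumes "linear_map K H P F" "kspace K P" "x \<in> carrier H"
  shows "tensor_lift P (\<lambda>a b. F (a \<otimes>\<^bsub>H\<^esub> antipode H b)) (comult H x) = counit H x \<odot>\<^bsub>P\<^esub> F \<one>\<^bsub>H\<^esub>"
proof -
  have "tensor_lift P (\<lambda>a b. F (a \<otimes>\<^bsub>H\<^esub> antipode H b)) (comult H x)
    = F (tensor_lift H (\<lambda>a b. a \<otimes>\<^bsub>H\<^esub> antipode H b) (comult H x))"
    by (rule linear_lift_comult[symmetric]) (use assms in auto)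
  thus ?thesis using assms by (simp add: antipode_right linear_map_smult)
qed

lemma lift_comult_one:
  assumes "bilinear_map K H H P F" "kspace K P"
  shows "tensor_lift P F (comult H \<one>\<^bsub>H\<^esub>) = F \<one>\<^bsub>H\<^esub> \<one>\<^bsub>H\<^esub>"
  unfolding comult_one by (rule tensor_lift_pure) (use assms in auto)

lemma antipode_one: "antipode H \<one>\<^bsub>H\<^esub> = \<one>\<^bsub>H\<^esub>"
proof -
  have "bilinear_map K H H H (\<lambda>a b. antipode H a \<otimes>\<^bsub>H\<^esub> b)"
    by (rule hopf_linear | (simp; fail))+
  from lift_comult_one[OF this] show ?thesis using antipode_left[of "\<one>\<^bsub>H\<^esub>"] by (simp add: counit_one)
qed

end

section \<open>Left coinvariant forms\<close>

text \<open>Stated for plain vector spaces, these equations carry over to bicovariant calculi by instantiating the record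
  extension.\<close>

lemma carrier_update_ops:
  "add (M\<lparr>carrier := U\<rparr>) = add M" "zero (M\<lparr>carrier := U\<rparr>) = zero M"
  "smult (M\<lparr>carrier := U\<rparr>) = smult M" "carrier (M\<lparr>carrier := U\<rparr>) = U"
  for M :: "('k, 'm, 'x) module_scheme"
  by simp_all

lemma coinv_forms_carrier:
  "carrier (coinv_forms K H \<Omega>) = {\<gamma> \<in> carrier \<Omega>. lcoact \<Omega> \<gamma> = pure_tensor K H \<Omega> \<one>\<^bsub>H\<^esub> \<gamma>}"
  unfolding coinv_forms_def by (rule carrier_update_ops(4))

lemma coinv_forms_eq: "coinv_forms K H \<Omega> = \<Omega>\<lparr>carrier := carrier (coinv_forms K H \<Omega>)\<rparr>"
  unfolding coinv_forms_carrier by (rule coinv_forms_def)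

context bicovariant_fodc
begin

abbreviation "Coinv \<equiv> coinv_forms K H \<Omega>"

lemma kspace_\<Omega> [simp, intro]: "kspace K \<Omega>"
  by (rule calc.\<Gamma>.kspace_axioms)

lemma lcoact_closed [simp]: "\<gamma> \<in> carrier \<Omega> \<Longrightarrow> lcoact \<Omega> \<gamma> \<in> carrier (tensor K H \<Omega>)"
  by (rule linear_map_closed[OF bicom.L.coact_linear])

lemma rcoact_closed [simp]: "\<gamma> \<in> carrier \<Omega> \<Longrightarrow> rcoact \<Omega> \<gamma> \<in> carrier (tensor K \<Omega> H)"
  by (rule linear_map_closed[OF bicom.R.coact_linear])

lemma lact_closed [simp]: "h \<in> carrier H \<Longrightarrow> \<gamma> \<in> carrier \<Omega> \<Longrightarrow> lact \<Omega> h \<gamma> \<in> carrier \<Omega>"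
  by (rule bilinear_map_closed[OF calc.lact_bilinear])

lemma ract_closed [simp]: "h \<in> carrier H \<Longrightarrow> \<gamma> \<in> carrier \<Omega> \<Longrightarrow> ract \<Omega> \<gamma> h \<in> carrier \<Omega>"
  by (rule bilinear_map_closed[OF calc.ract_bilinear])

lemma diff_closed [simp]: "h \<in> carrier H \<Longrightarrow> diff \<Omega> h \<in> carrier \<Omega>"
  by (rule linear_map_closed[OF calc.diff_linear])

lemmas bicov_linear = hopf_linear
  bilinear_map_left[OF calc.lact_bilinear] bilinear_map_right[OF calc.lact_bilinear]
  bilinear_map_left[OF calc.ract_bilinear] bilinear_map_right[OF calc.ract_bilinear]
  linear_map_comp[OF calc.diff_linear] linear_map_comp[OF bicom.L.coact_linear]
  linear_map_comp[OF bicom.R.coact_linear] lcoact_closed rcoact_closed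

lemma lift_lcoact_closed [simp]:
  "\<lbrakk>\<gamma> \<in> carrier \<Omega>; kspace K P; \<And>m n. \<lbrakk>m \<in> carrier H; n \<in> carrier \<Omega>\<rbrakk> \<Longrightarrow> f m n \<in> carrier P\<rbrakk> \<Longrightarrow>
    tensor_lift P f (lcoact \<Omega> \<gamma>) \<in> carrier P"
  by (rule tensor_lift_closed) auto

lemma lift_lcoact_cong:
  "\<lbrakk>\<gamma> \<in> carrier \<Omega>; \<And>m n. \<lbrakk>m \<in> carrier H; n \<in> carrier \<Omega>\<rbrakk> \<Longrightarrow> f m n = g m n\<rbrakk> \<Longrightarrow>
    tensor_lift P f (lcoact \<Omega> \<gamma>) = tensor_lift P g (lcoact \<Omega> \<gamma>)"
  by (rule tensor_lift_cong) auto

lemma linear_lift_lcoact: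
  assumes "linear_map K P Q \<phi>" "kspace K P" "kspace K Q" "\<gamma> \<in> carrier \<Omega>"
    and "\<And>m n. \<lbrakk>m \<in> carrier H; n \<in> carrier \<Omega>\<rbrakk> \<Longrightarrow> f m n \<in> carrier P"
  shows "\<phi> (tensor_lift P f (lcoact \<Omega> \<gamma>)) = tensor_lift Q (\<lambda>m n. \<phi> (f m n)) (lcoact \<Omega> \<gamma>)"
  by (rule linear_tensor_lift[where K = K]) (use assms in auto)

lemma lift_rcoact_closed [simp]:
  "\<lbrakk>\<gamma> \<in> carrier \<Omega>; kspace K P; \<And>m n. \<lbrakk>m \<in> carrier \<Omega>; n \<in> carrier H\<rbrakk> \<Longrightarrow> f m n \<in> carrier P\<rbrakk> \<Longrightarrow>
    tensor_lift P f (rcoact \<Omega> \<gamma>) \<in> carrier P"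
  by (rule tensor_lift_closed) auto

lemma lift_rcoact_cong:
  "\<lbrakk>\<gamma> \<in> carrier \<Omega>; \<And>m n. \<lbrakk>m \<in> carrier \<Omega>; n \<in> carrier H\<rbrakk> \<Longrightarrow> f m n = g m n\<rbrakk> \<Longrightarrow>
    tensor_lift P f (rcoact \<Omega> \<gamma>) = tensor_lift P g (rcoact \<Omega> \<gamma>)"
  by (rule tensor_lift_cong) auto

lemma lcoact_coassoc_lift:
  assumes "\<gamma> \<in> carrier \<Omega>" "kspace K P"
    and "\<And>b c. \<lbrakk>b \<in> carrier H; c \<in> carrier \<Omega>\<rbrakk> \<Longrightarrow> linear_map K H P (\<lambda>a. F a b c)"
    and "\<And>a c. \<lbrakk>a \<in> carrier H; c \<in> carrier \<Omega>\<rbrakk> \<Longrightarrow> linear_map K H P (\<lambda>b. F a b c)"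
    and "\<And>a b. \<lbrakk>a \<in> carrier H; b \<in> carrier H\<rbrakk> \<Longrightarrow> linear_map K \<Omega> P (\<lambda>c. F a b c)"
  shows "tensor_lift P (\<lambda>u c. tensor_lift P (\<lambda>a b. F a b c) (comult H u)) (lcoact \<Omega> \<gamma>)
    = tensor_lift P (\<lambda>a v. tensor_lift P (\<lambda>b c. F a b c) (lcoact \<Omega> v)) (lcoact \<Omega> \<gamma>)"
  by (rule sweedler_assoc[OF kspace_H kspace_H kspace_\<Omega> kspace_H kspace_\<Omega> assms(2) _ _ _ _ bicom.L.coact_coassoc assms(3-5)])
     (use assms in auto)

lemma coact_commute_lift:
  assumes "\<gamma> \<in> carrier \<Omega>" "kspace K P"
    and "\<And>b c. \<lbrakk>b \<in> carrier \<Omega>; c \<in> carrier H\<rbrakk> \<Longrightarrow> linear_map K H P (\<lambda>a. F a b c)"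
    and "\<And>a c. \<lbrakk>a \<in> carrier H; c \<in> carrier H\<rbrakk> \<Longrightarrow> linear_map K \<Omega> P (\<lambda>b. F a b c)"
    and "\<And>a b. \<lbrakk>a \<in> carrier H; b \<in> carrier \<Omega>\<rbrakk> \<Longrightarrow> linear_map K H P (\<lambda>c. F a b c)"
  shows "tensor_lift P (\<lambda>u c. tensor_lift P (\<lambda>a b. F a b c) (lcoact \<Omega> u)) (rcoact \<Omega> \<gamma>)
    = tensor_lift P (\<lambda>a v. tensor_lift P (\<lambda>b c. F a b c) (rcoact \<Omega> v)) (lcoact \<Omega> \<gamma>)"
  by (rule sweedler_assoc[OF kspace_H kspace_\<Omega> kspace_H kspace_\<Omega> kspace_\<Omega> assms(2) _ _ _ _ bicom.coact_commute assms(3-5)])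
     (use assms in auto)

lemma lcoact_counit_lift:
  assumes "linear_map K \<Omega> P F" "kspace K P" "\<gamma> \<in> carrier \<Omega>"
  shows "tensor_lift P (\<lambda>a c. counit H a \<odot>\<^bsub>P\<^esub> F c) (lcoact \<Omega> \<gamma>) = F \<gamma>"
proof -
  have "F \<gamma> = F (tensor_lift \<Omega> (\<lambda>a c. counit H a \<odot>\<^bsub>\<Omega>\<^esub> c) (lcoact \<Omega> \<gamma>))"
    using assms by (simp add: bicom.L.coact_counit)
  also have "\<dots> = tensor_lift P (\<lambda>a c. F (counit H a \<odot>\<^bsub>\<Omega>\<^esub> c)) (lcoact \<Omega> \<gamma>)"
    by (rule linear_lift_lcoact) (use assms in auto)
  also have "\<dots> = tensor_lift P (\<lambda>a c. counit H a \<odot>\<^bsub>P\<^esub> F c) (lcoact \<Omega> \<gamma>)"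
    by (rule lift_lcoact_cong) (use assms in \<open>auto simp: linear_map_smult\<close>)
  finally show ?thesis ..
qed

lemma lift_lcoact_lact:
  assumes "bilinear_map K H \<Omega> P F" "kspace K P" "h \<in> carrier H" "\<gamma> \<in> carrier \<Omega>"
  shows "tensor_lift P F (lcoact \<Omega> (lact \<Omega> h \<gamma>))
    = tensor_lift P (\<lambda>h1 h2. tensor_lift P (\<lambda>g \<omega>. F (h1 \<otimes>\<^bsub>H\<^esub> g) (lact \<Omega> h2 \<omega>)) (lcoact \<Omega> \<gamma>)) (comult H h)"
  unfolding lcoact_lact[OF assms(3,4)] by (rule tensor_map2_lift) (use assms in auto)

lemma lift_rcoact_lact:
  assumes "bilinear_map K \<Omega> H P F" "kspace K P" "h \<in> carrier H" "\<gamma> \<in> carrier \<Omega>"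
  shows "tensor_lift P F (rcoact \<Omega> (lact \<Omega> h \<gamma>))
    = tensor_lift P (\<lambda>h1 h2. tensor_lift P (\<lambda>\<omega> g. F (lact \<Omega> h1 \<omega>) (h2 \<otimes>\<^bsub>H\<^esub> g)) (rcoact \<Omega> \<gamma>)) (comult H h)"
  unfolding rcoact_lact[OF assms(3,4)] by (rule tensor_map2_lift) (use assms in auto)

lemma lift_lcoact_diff:
  assumes "bilinear_map K H \<Omega> P F" "kspace K P" "h \<in> carrier H"
  shows "tensor_lift P F (lcoact \<Omega> (diff \<Omega> h)) = tensor_lift P (\<lambda>h1 h2. F h1 (diff \<Omega> h2)) (comult H h)"
  unfolding lcoact_diff[OF assms(3)] by (rule tensor_map_lift) (use assms in auto)

lemma Coinv_iff: "\<gamma> \<in> carrier Coinv \<longleftrightarrow> \<gamma> \<in> carrier \<Omega> \<and> lcoact \<Omega> \<gamma> = pure_tensor K H \<Omega> \<one>\<^bsub>H\<^esub> \<gamma>"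
  by (simp add: coinv_forms_carrier)

lemma Coinv_subset [simp]: "\<gamma> \<in> carrier Coinv \<Longrightarrow> \<gamma> \<in> carrier \<Omega>"
  by (simp add: Coinv_iff)

lemma Coinv_ops [simp]: "add Coinv = add \<Omega>" "zero Coinv = zero \<Omega>" "smult Coinv = smult \<Omega>"
  unfolding coinv_forms_def by (rule carrier_update_ops)+

lemma lift_lcoact_coinv:
  assumes "bilinear_map K H \<Omega> P F" "kspace K P" "\<gamma> \<in> carrier Coinv"
  shows "tensor_lift P F (lcoact \<Omega> \<gamma>) = F \<one>\<^bsub>H\<^esub> \<gamma>"
proof -
  have "lcoact \<Omega> \<gamma> = pure_tensor K H \<Omega> \<one>\<^bsub>H\<^esub> \<gamma>" using assms by (simp add: Coinv_iff)
  thus ?thesis using assms by (simp add: tensor_lift_pure[OF kspace_H kspace_\<Omega>])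
qed

text \<open>The left coaction of \<open>h \<gamma>\<close> is \<open>h\<^sub>1 \<gamma>\<^sub>-\<^sub>1 \<otimes> h\<^sub>2 \<gamma>\<^sub>0\<close>, and \<open>\<gamma>\<^sub>-\<^sub>1 \<otimes> \<gamma>\<^sub>0 = 1 \<otimes> \<gamma>\<close> by coinvariance.\<close>

lemma lift_lcoact_lact_coinv:
  assumes F: "bilinear_map K H \<Omega> P F" and P: "kspace K P" and "h \<in> carrier H" and "\<gamma> \<in> carrier Coinv"
  shows "tensor_lift P F (lcoact \<Omega> (lact \<Omega> h \<gamma>)) = tensor_lift P (\<lambda>h1 h2. F h1 (lact \<Omega> h2 \<gamma>)) (comult H h)"
proof -
  have "tensor_lift P F (lcoact \<Omega> (lact \<Omega> h \<gamma>))
    = tensor_lift P (\<lambda>h1 h2. tensor_lift P (\<lambda>g \<omega>. F (h1 \<otimes>\<^bsub>H\<^esub> g) (lact \<Omega> h2 \<omega>)) (lcoact \<Omega> \<gamma>)) (comult H h)"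
    by (rule lift_lcoact_lact) (use assms in auto)
  also have "\<dots> = tensor_lift P (\<lambda>h1 h2. F h1 (lact \<Omega> h2 \<gamma>)) (comult H h)"
  proof (rule lift_comult_cong)
    fix h1 h2 assume h: "h1 \<in> carrier H" "h2 \<in> carrier H"
    have "bilinear_map K H \<Omega> P (\<lambda>g \<omega>. F (h1 \<otimes>\<^bsub>H\<^esub> g) (lact \<Omega> h2 \<omega>))"
      by (rule bicov_linear bilinear_map_left[OF F] bilinear_map_right[OF F] | (simp add: h; fail))+
    from lift_lcoact_coinv[OF this P assms(4)] h
    show "tensor_lift P (\<lambda>g \<omega>. F (h1 \<otimes>\<^bsub>H\<^esub> g) (lact \<Omega> h2 \<omega>)) (lcoact \<Omega> \<gamma>) = F h1 (lact \<Omega> h2 \<gamma>)" by simp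
  qed fact
  finally show ?thesis .
qed

lemma submodule_Coinv: "submodule (carrier Coinv) K \<Omega>"
proof -
  interpret T: kspace K "tensor K H \<Omega>" by auto
  have lin: "linear_map K \<Omega> (tensor K H \<Omega>) (\<lambda>\<gamma>. pure_tensor K H \<Omega> \<one>\<^bsub>H\<^esub> \<gamma>)"
    by (rule bicov_linear | (simp; fail))+
  note 1 = linear_map_add[OF lin] linear_map_smult[OF lin] linear_map_add[OF bicom.L.coact_linear]
    linear_map_smult[OF bicom.L.coact_linear] linear_map_zero[OF kspace_\<Omega> T.kspace_axioms lin]
    linear_map_zero[OF kspace_\<Omega> T.kspace_axioms bicom.L.coact_linear]
  have s: "a \<odot>\<^bsub>\<Omega>\<^esub> \<gamma> \<in> carrier Coinv" if "a \<in> carrier K" "\<gamma> \<in> carrier Coinv" for a \<gamma>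
    using that by (simp add: Coinv_iff 1)
  show ?thesis
    by (rule submodule_kspaceI[OF kspace_\<Omega>]) (auto simp: s, auto simp: Coinv_iff 1)
qed

lemma kspace_Coinv [simp, intro]: "kspace K Coinv"
proof -
  have "module K (\<Omega>\<lparr>carrier := carrier Coinv\<rparr>)"
    using submodule.submodule_is_module[OF submodule_Coinv calc.\<Gamma>.module_axioms] .
  moreover have "\<Omega>\<lparr>carrier := carrier Coinv\<rparr> = Coinv" by (rule coinv_forms_eq[symmetric])
  ultimately show ?thesis by (metis kspace.intro field_axioms)
qed

lemma linear_map_Coinv_incl: "linear_map K L Coinv e \<Longrightarrow> linear_map K L \<Omega> e"
  unfolding linear_map_def Pi_iff by simp

lemma linear_map_Coinv_dom: "linear_map K \<Omega> P e \<Longrightarrow> linear_map K Coinv P e"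
  unfolding linear_map_def by auto

text \<open>The projection \<open>\<gamma> \<mapsto> S(\<gamma>\<^sub>-\<^sub>1) \<gamma>\<^sub>0\<close> of the fundamental theorem of Hopf modules.\<close>

definition coinv_proj :: "'m \<Rightarrow> 'm"
  where "coinv_proj \<gamma> = tensor_lift \<Omega> (\<lambda>g \<omega>. lact \<Omega> (antipode H g) \<omega>) (lcoact \<Omega> \<gamma>)"

lemma coinv_proj_linear: "linear_map K \<Omega> \<Omega> coinv_proj"
  unfolding coinv_proj_def by (rule bicov_linear | (simp; fail))+

lemma coinv_proj_in_forms [simp]: "\<gamma> \<in> carrier \<Omega> \<Longrightarrow> coinv_proj \<gamma> \<in> carrier \<Omega>"
  by (rule linear_map_closed[OF coinv_proj_linear])

lemmas bicov_proj_linear = bicov_linear linear_map_comp[OF coinv_proj_linear]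

text \<open>The left coaction of \<open>dh\<close> is \<open>h\<^sub>1 \<otimes> dh\<^sub>2\<close>.\<close>

lemma maurer_cartan_eq: "h \<in> carrier H \<Longrightarrow> maurer_cartan H \<Omega> h = coinv_proj (diff \<Omega> h)"
  unfolding maurer_cartan_def coinv_proj_def
  by (rule lift_lcoact_diff[symmetric]) (rule bicov_linear | (simp; fail))+

text \<open>\<open>S(h\<^sub>1) (h\<^sub>2 \<gamma>) = \<epsilon>(h) \<gamma>\<close>.\<close>

lemma coinv_proj_lact:
  assumes h: "h \<in> carrier H" and g: "\<gamma> \<in> carrier Coinv"
  shows "coinv_proj (lact \<Omega> h \<gamma>) = counit H h \<odot>\<^bsub>\<Omega>\<^esub> \<gamma>"
proof -
  have "coinv_proj (lact \<Omega> h \<gamma>) = tensor_lift \<Omega> (\<lambda>h1 h2. lact \<Omega> (antipode H h1) (lact \<Omega> h2 \<gamma>)) (comult H h)"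
    unfolding coinv_proj_def
    by (rule lift_lcoact_lact_coinv[OF _ _ h g]) (rule bicov_linear | (simp; fail))+
  also have "\<dots> = tensor_lift \<Omega> (\<lambda>h1 h2. lact \<Omega> (antipode H h1 \<otimes>\<^bsub>H\<^esub> h2) \<gamma>) (comult H h)"
    using h g by (intro lift_comult_cong) (auto simp: calc.lact_mult)
  also have "\<dots> = counit H h \<odot>\<^bsub>\<Omega>\<^esub> lact \<Omega> \<one>\<^bsub>H\<^esub> \<gamma>"
    by (rule antipode_left_lift) (rule bicov_linear | (simp add: h g; fail))+
  finally show ?thesis using g by (simp add: calc.lact_one)
qed

lemma coinv_proj_coinv: "\<gamma> \<in> carrier Coinv \<Longrightarrow> coinv_proj \<gamma> = \<gamma>"
  using coinv_proj_lact[of "\<one>\<^bsub>H\<^esub>" \<gamma>] by (simp add: calc.lact_one counit_one)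

text \<open>\<open>\<gamma>\<^sub>-\<^sub>2 S(\<gamma>\<^sub>-\<^sub>1) \<gamma>\<^sub>0 = \<gamma>\<close>, by coassociativity and the antipode axiom.\<close>

lemma coinv_proj_reconstruct:
  assumes g: "\<gamma> \<in> carrier \<Omega>"
  shows "tensor_lift \<Omega> (\<lambda>a v. lact \<Omega> a (coinv_proj v)) (lcoact \<Omega> \<gamma>) = \<gamma>"
proof -
  have "tensor_lift \<Omega> (\<lambda>a v. lact \<Omega> a (coinv_proj v)) (lcoact \<Omega> \<gamma>)
    = tensor_lift \<Omega> (\<lambda>a v. tensor_lift \<Omega> (\<lambda>b c. lact \<Omega> (a \<otimes>\<^bsub>H\<^esub> antipode H b) c) (lcoact \<Omega> v)) (lcoact \<Omega> \<gamma>)"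
  proof (rule lift_lcoact_cong[OF g])
    fix a v assume av: "a \<in> carrier H" "v \<in> carrier \<Omega>"
    have "lact \<Omega> a (coinv_proj v) = tensor_lift \<Omega> (\<lambda>b c. lact \<Omega> a (lact \<Omega> (antipode H b) c)) (lcoact \<Omega> v)"
      unfolding coinv_proj_def
      by (rule linear_lift_lcoact[where P = \<Omega>]) (rule bicov_linear | (simp add: av; fail))+
    also have "\<dots> = tensor_lift \<Omega> (\<lambda>b c. lact \<Omega> (a \<otimes>\<^bsub>H\<^esub> antipode H b) c) (lcoact \<Omega> v)"
      using av by (intro lift_lcoact_cong) (auto simp: calc.lact_mult)
    finally show "lact \<Omega> a (coinv_proj v) = tensor_lift \<Omega> (\<lambda>b c. lact \<Omega> (a \<otimes>\<^bsub>H\<^esub> antipode H b) c) (lcoact \<Omega> v)" .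
  qed
  also have "\<dots> = tensor_lift \<Omega> (\<lambda>u c. tensor_lift \<Omega> (\<lambda>a b. lact \<Omega> (a \<otimes>\<^bsub>H\<^esub> antipode H b) c) (comult H u)) (lcoact \<Omega> \<gamma>)"
    by (rule lcoact_coassoc_lift[symmetric]) (rule bicov_linear | (simp add: g; fail))+
  also have "\<dots> = tensor_lift \<Omega> (\<lambda>u c. counit H u \<odot>\<^bsub>\<Omega>\<^esub> c) (lcoact \<Omega> \<gamma>)"
  proof (rule lift_lcoact_cong[OF g])
    fix u c assume uc: "u \<in> carrier H" "c \<in> carrier \<Omega>"
    have "tensor_lift \<Omega> (\<lambda>a b. lact \<Omega> (a \<otimes>\<^bsub>H\<^esub> antipode H b) c) (comult H u) = counit H u \<odot>\<^bsub>\<Omega>\<^esub> lact \<Omega> \<one>\<^bsub>H\<^esub> c"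
      by (rule antipode_right_lift) (rule bicov_linear | (simp add: uc; fail))+
    thus "tensor_lift \<Omega> (\<lambda>a b. lact \<Omega> (a \<otimes>\<^bsub>H\<^esub> antipode H b) c) (comult H u) = counit H u \<odot>\<^bsub>\<Omega>\<^esub> c"
      using uc by (simp add: calc.lact_one)
  qed
  also have "\<dots> = \<gamma>" using g by (rule bicom.L.coact_counit)
  finally show ?thesis .
qed

abbreviation "H\<Omega> \<equiv> tensor K H \<Omega>"

text \<open>The componentwise action of \<open>H \<otimes> H\<close> on \<open>H \<otimes> \<Omega>\<close>, in terms of which the left coaction of \<open>h \<gamma>\<close> is
  \<open>\<Delta>(h)\<close> applied to that of \<open>\<gamma>\<close>.\<close>

definition tensor_lact :: "('h \<times> 'h) list set \<Rightarrow> ('h \<times> 'm) list set \<Rightarrow> ('h \<times> 'm) list set"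
  where "tensor_lact = tensor_map2 K H \<Omega> (mult H) (lact \<Omega>)"

lemma tensor_lact_bilinear: "bilinear_map K (tensor K H H) H\<Omega> H\<Omega> tensor_lact"
  unfolding tensor_lact_def tensor_map2_def by (rule bicov_linear | (simp; fail))+

lemma tensor_lact_pure:
  assumes "a \<in> carrier H" "b \<in> carrier H" "g \<in> carrier H" "\<omega> \<in> carrier \<Omega>"
  shows "tensor_lact (pure_tensor K H H a b) (pure_tensor K H \<Omega> g \<omega>) = pure_tensor K H \<Omega> (a \<otimes>\<^bsub>H\<^esub> g) (lact \<Omega> b \<omega>)"
proof -
  have "tensor_lact (pure_tensor K H H a b) (pure_tensor K H \<Omega> g \<omega>)
     = tensor_lift H\<Omega> (\<lambda>n n'. pure_tensor K H \<Omega> (a \<otimes>\<^bsub>H\<^esub> n) (lact \<Omega> b n')) (pure_tensor K H \<Omega> g \<omega>)"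
    unfolding tensor_lact_def tensor_map2_def
    by (rule tensor_lift_pure) (rule bicov_linear | (simp add: assms; fail))+
  also have "\<dots> = pure_tensor K H \<Omega> (a \<otimes>\<^bsub>H\<^esub> g) (lact \<Omega> b \<omega>)"
    by (rule tensor_lift_pure) (rule bicov_linear | (simp add: assms; fail))+
  finally show ?thesis .
qed

definition tensor_mult :: "('h \<times> 'h) list set \<Rightarrow> ('h \<times> 'h) list set \<Rightarrow> ('h \<times> 'h) list set"
  where "tensor_mult = tensor_map2 K H H (mult H) (mult H)"

lemma tensor_mult_bilinear: "bilinear_map K (tensor K H H) (tensor K H H) (tensor K H H) tensor_mult"
  unfolding tensor_mult_def tensor_map2_def by (rule bicov_linear | (simp; fail))+

lemma tensor_mult_pure:
  assumes "a \<in> carrier H" "b \<in> carrier H" "c \<in> carrier H" "d \<in> carrier H"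
  shows "tensor_mult (pure_tensor K H H a b) (pure_tensor K H H c d) = pure_tensor K H H (a \<otimes>\<^bsub>H\<^esub> c) (b \<otimes>\<^bsub>H\<^esub> d)"
proof -
  have "tensor_mult (pure_tensor K H H a b) (pure_tensor K H H c d)
     = tensor_lift (tensor K H H) (\<lambda>n n'. pure_tensor K H H (a \<otimes>\<^bsub>H\<^esub> n) (b \<otimes>\<^bsub>H\<^esub> n')) (pure_tensor K H H c d)"
    unfolding tensor_mult_def tensor_map2_def
    by (rule tensor_lift_pure) (rule bicov_linear | (simp add: assms; fail))+
  also have "\<dots> = pure_tensor K H H (a \<otimes>\<^bsub>H\<^esub> c) (b \<otimes>\<^bsub>H\<^esub> d)"
    by (rule tensor_lift_pure) (rule bicov_linear | (simp add: assms; fail))+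
  finally show ?thesis .
qed

lemmas tensor_alg_linear = bilinear_map_left[OF tensor_lact_bilinear] bilinear_map_right[OF tensor_lact_bilinear]
  bilinear_map_left[OF tensor_mult_bilinear] bilinear_map_right[OF tensor_mult_bilinear]

lemma tensor_lact_closed [simp]:
  "t \<in> carrier (tensor K H H) \<Longrightarrow> w \<in> carrier H\<Omega> \<Longrightarrow> tensor_lact t w \<in> carrier H\<Omega>"
  by (rule bilinear_map_closed[OF tensor_lact_bilinear])

lemma tensor_mult_closed [simp]:
  "t \<in> carrier (tensor K H H) \<Longrightarrow> w \<in> carrier (tensor K H H) \<Longrightarrow> tensor_mult t w \<in> carrier (tensor K H H)"
  by (rule bilinear_map_closed[OF tensor_mult_bilinear])

lemma tensor_lact_mult:
  assumes t: "t \<in> carrier (tensor K H H)" and s: "s \<in> carrier (tensor K H H)" and w: "w \<in> carrier H\<Omega>"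
  shows "tensor_lact (tensor_mult t s) w = tensor_lact t (tensor_lact s w)"
proof (rule tensor_ext[where P = H\<Omega> and \<phi> = "\<lambda>w. tensor_lact (tensor_mult t s) w", OF kspace_H kspace_\<Omega> _ w])
  fix g \<omega> assume g: "g \<in> carrier H" "\<omega> \<in> carrier \<Omega>"
  let ?w = "pure_tensor K H \<Omega> g \<omega>"
  show "tensor_lact (tensor_mult t s) ?w = tensor_lact t (tensor_lact s ?w)"
  proof (rule tensor_ext[where P = H\<Omega> and \<phi> = "\<lambda>s. tensor_lact (tensor_mult t s) ?w", OF kspace_H kspace_H _ s])
    fix c d assume cd: "c \<in> carrier H" "d \<in> carrier H"
    let ?s = "pure_tensor K H H c d"
    show "tensor_lact (tensor_mult t ?s) ?w = tensor_lact t (tensor_lact ?s ?w)"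
    proof (rule tensor_ext[where P = H\<Omega> and \<phi> = "\<lambda>t. tensor_lact (tensor_mult t ?s) ?w", OF kspace_H kspace_H _ t])
      fix a b assume ab: "a \<in> carrier H" "b \<in> carrier H"
      show "tensor_lact (tensor_mult (pure_tensor K H H a b) ?s) ?w = tensor_lact (pure_tensor K H H a b) (tensor_lact ?s ?w)"
        using ab cd g by (simp add: tensor_lact_pure tensor_mult_pure m_assoc calc.lact_mult)
    qed (rule bicov_linear tensor_alg_linear | (simp add: g cd t; fail))+
  qed (rule bicov_linear tensor_alg_linear | (simp add: g t s; fail))+
qed (rule bicov_linear tensor_alg_linear | (simp add: t s; fail))+

text \<open>\<open>\<Delta>(\<gamma>\<^sub>-\<^sub>1) (1 \<otimes> P(\<gamma>\<^sub>0)) = \<gamma>\<^sub>-\<^sub>2 \<otimes> \<gamma>\<^sub>-\<^sub>1 P(\<gamma>\<^sub>0) = \<gamma>\<^sub>-\<^sub>1 \<otimes> \<gamma>\<^sub>0\<close>, the last step by \<open>coinv_proj_reconstruct\<close>.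
  In this form the comultiplication of \<open>S(\<gamma>\<^sub>-\<^sub>1)\<close> can be absorbed when the coaction of \<open>P \<gamma>\<close> is computed.\<close>

lemma lcoact_via_proj:
  assumes g: "\<gamma> \<in> carrier \<Omega>"
  shows "tensor_lift H\<Omega> (\<lambda>a v. tensor_lact (comult H a) (pure_tensor K H \<Omega> \<one>\<^bsub>H\<^esub> (coinv_proj v))) (lcoact \<Omega> \<gamma>) = lcoact \<Omega> \<gamma>"
proof -
  have "tensor_lift H\<Omega> (\<lambda>a v. tensor_lact (comult H a) (pure_tensor K H \<Omega> \<one>\<^bsub>H\<^esub> (coinv_proj v))) (lcoact \<Omega> \<gamma>)
    = tensor_lift H\<Omega> (\<lambda>a v. tensor_lift H\<Omega> (\<lambda>x y. pure_tensor K H \<Omega> x (lact \<Omega> y (coinv_proj v))) (comult H a)) (lcoact \<Omega> \<gamma>)"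
  proof (rule lift_lcoact_cong[OF g])
    fix a v assume av: "a \<in> carrier H" "v \<in> carrier \<Omega>"
    let ?w = "pure_tensor K H \<Omega> \<one>\<^bsub>H\<^esub> (coinv_proj v)"
    have "tensor_lact (comult H a) ?w = tensor_lift H\<Omega> (\<lambda>x y. tensor_lact (pure_tensor K H H x y) ?w) (comult H a)"
      by (rule linear_map_eq_tensor_lift[where K = K]) (rule bicov_linear tensor_alg_linear | (simp add: av; fail))+
    also have "\<dots> = tensor_lift H\<Omega> (\<lambda>x y. pure_tensor K H \<Omega> x (lact \<Omega> y (coinv_proj v))) (comult H a)"
      using av by (intro lift_comult_cong) (auto simp: tensor_lact_pure)
    finally show "tensor_lact (comult H a) ?w = tensor_lift H\<Omega> (\<lambda>x y. pure_tensor K H \<Omega> x (lact \<Omega> y (coinv_proj v))) (comult H a)" .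
  qed
  also have "\<dots> = tensor_lift H\<Omega> (\<lambda>x v. tensor_lift H\<Omega> (\<lambda>y z. pure_tensor K H \<Omega> x (lact \<Omega> y (coinv_proj z))) (lcoact \<Omega> v)) (lcoact \<Omega> \<gamma>)"
    by (rule lcoact_coassoc_lift) (rule bicov_proj_linear | (simp add: g; fail))+
  also have "\<dots> = tensor_lift H\<Omega> (\<lambda>x v. pure_tensor K H \<Omega> x v) (lcoact \<Omega> \<gamma>)"
  proof (rule lift_lcoact_cong[OF g])
    fix x v assume xv: "x \<in> carrier H" "v \<in> carrier \<Omega>"
    have "tensor_lift H\<Omega> (\<lambda>y z. pure_tensor K H \<Omega> x (lact \<Omega> y (coinv_proj z))) (lcoact \<Omega> v)
      = pure_tensor K H \<Omega> x (tensor_lift \<Omega> (\<lambda>y z. lact \<Omega> y (coinv_proj z)) (lcoact \<Omega> v))"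
      by (rule linear_lift_lcoact[symmetric]) (rule bicov_proj_linear | (simp add: xv; fail))+
    thus "tensor_lift H\<Omega> (\<lambda>y z. pure_tensor K H \<Omega> x (lact \<Omega> y (coinv_proj z))) (lcoact \<Omega> v) = pure_tensor K H \<Omega> x v"
      using xv by (simp add: coinv_proj_reconstruct)
  qed
  also have "\<dots> = lcoact \<Omega> \<gamma>" using g by (simp add: tensor_lift_pure_id)
  finally show ?thesis .
qed

text \<open>By \<open>lcoact_via_proj\<close> the left coaction of \<open>P \<gamma> = S(\<gamma>\<^sub>-\<^sub>1) \<gamma>\<^sub>0\<close> is
  \<open>\<Delta>(S(\<gamma>\<^sub>-\<^sub>2)) \<Delta>(\<gamma>\<^sub>-\<^sub>1) (1 \<otimes> P(\<gamma>\<^sub>0)) = \<Delta>(S(\<gamma>\<^sub>-\<^sub>2) \<gamma>\<^sub>-\<^sub>1) (1 \<otimes> P(\<gamma>\<^sub>0)) = 1 \<otimes> P \<gamma>\<close>.  This replaces the usual appeal to the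
  formula for the comultiplication of \<open>S(h)\<close>.\<close>

lemma coinv_proj_closed [simp]:
  assumes g: "\<gamma> \<in> carrier \<Omega>"
  shows "coinv_proj \<gamma> \<in> carrier Coinv"
proof -
  let ?w = "\<lambda>v. pure_tensor K H \<Omega> \<one>\<^bsub>H\<^esub> (coinv_proj v)"
  note lin = bicov_proj_linear tensor_alg_linear
  have mult: "tensor_lact (comult H a) (tensor_lact (comult H b) w) = tensor_lact (comult H (a \<otimes>\<^bsub>H\<^esub> b)) w"
    if "a \<in> carrier H" "b \<in> carrier H" "w \<in> carrier H\<Omega>" for a b w
    using that by (simp add: comult_mult tensor_lact_mult tensor_mult_def[symmetric])
  have "lcoact \<Omega> (coinv_proj \<gamma>) = tensor_lift H\<Omega> (\<lambda>a v. lcoact \<Omega> (lact \<Omega> (antipode H a) v)) (lcoact \<Omega> \<gamma>)"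
    unfolding coinv_proj_def
    by (rule linear_lift_lcoact[where P = \<Omega>]) (rule lin bicom.L.coact_linear | (simp add: g; fail))+
  also have "\<dots> = tensor_lift H\<Omega> (\<lambda>a v. tensor_lift H\<Omega> (\<lambda>b c. tensor_lact (comult H (antipode H a \<otimes>\<^bsub>H\<^esub> b)) (?w c)) (lcoact \<Omega> v)) (lcoact \<Omega> \<gamma>)"
  proof (rule lift_lcoact_cong[OF g])
    fix a v assume av: "a \<in> carrier H" "v \<in> carrier \<Omega>"
    have "lcoact \<Omega> (lact \<Omega> (antipode H a) v) = tensor_lact (comult H (antipode H a)) (lcoact \<Omega> v)"
      using av unfolding tensor_lact_def by (simp add: lcoact_lact)
    also have "\<dots> = tensor_lact (comult H (antipode H a)) (tensor_lift H\<Omega> (\<lambda>b c. tensor_lact (comult H b) (?w c)) (lcoact \<Omega> v))"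
      using av by (simp add: lcoact_via_proj)
    also have "\<dots> = tensor_lift H\<Omega> (\<lambda>b c. tensor_lact (comult H (antipode H a)) (tensor_lact (comult H b) (?w c))) (lcoact \<Omega> v)"
      by (rule linear_lift_lcoact) (rule lin | (simp add: av; fail))+
    also have "\<dots> = tensor_lift H\<Omega> (\<lambda>b c. tensor_lact (comult H (antipode H a \<otimes>\<^bsub>H\<^esub> b)) (?w c)) (lcoact \<Omega> v)"
      using av by (intro lift_lcoact_cong) (auto simp: mult)
    finally show "lcoact \<Omega> (lact \<Omega> (antipode H a) v)
      = tensor_lift H\<Omega> (\<lambda>b c. tensor_lact (comult H (antipode H a \<otimes>\<^bsub>H\<^esub> b)) (?w c)) (lcoact \<Omega> v)" .
  qed
  also have "\<dots> = tensor_lift H\<Omega> (\<lambda>u c. tensor_lift H\<Omega> (\<lambda>a b. tensor_lact (comult H (antipode H a \<otimes>\<^bsub>H\<^esub> b)) (?w c)) (comult H u)) (lcoact \<Omega> \<gamma>)"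
    by (rule lcoact_coassoc_lift[symmetric]) (rule lin | (simp add: g; fail))+
  also have "\<dots> = tensor_lift H\<Omega> (\<lambda>u c. counit H u \<odot>\<^bsub>H\<Omega>\<^esub> ?w c) (lcoact \<Omega> \<gamma>)"
  proof (rule lift_lcoact_cong[OF g])
    fix u c assume uc: "u \<in> carrier H" "c \<in> carrier \<Omega>"
    have "tensor_lift H\<Omega> (\<lambda>a b. tensor_lact (comult H (antipode H a \<otimes>\<^bsub>H\<^esub> b)) (?w c)) (comult H u)
      = counit H u \<odot>\<^bsub>H\<Omega>\<^esub> tensor_lact (comult H \<one>\<^bsub>H\<^esub>) (?w c)"
      by (rule antipode_left_lift) (rule lin | (simp add: uc; fail))+
    thus "tensor_lift H\<Omega> (\<lambda>a b. tensor_lact (comult H (antipode H a \<otimes>\<^bsub>H\<^esub> b)) (?w c)) (comult H u)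
      = counit H u \<odot>\<^bsub>H\<Omega>\<^esub> ?w c"
      using uc by (simp add: comult_one tensor_lact_pure calc.lact_one)
  qed
  also have "\<dots> = ?w \<gamma>"
    by (rule lcoact_counit_lift) (rule lin | (simp add: g; fail))+
  finally show ?thesis using g by (simp add: Coinv_iff)
qed

lemma coinv_proj_linear_Coinv: "linear_map K \<Omega> Coinv coinv_proj"
  using coinv_proj_linear unfolding linear_map_def by auto

text \<open>The two coactions commute, so \<open>P(\<gamma>\<^sub>0) \<otimes> \<gamma>\<^sub>1\<close> arises by applying \<open>S\<close> to the left leg of \<open>\<gamma>\<close> and coacting on the
  right afterwards; for coinvariant \<open>\<gamma>\<close> the left leg is \<open>1\<close>.\<close>

lemma lift_rcoact_coinv_proj:
  assumes F: "bilinear_map K \<Omega> H P F" and P: "kspace K P" and g: "\<gamma> \<in> carrier Coinv"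
  shows "tensor_lift P (\<lambda>\<omega> h. F (coinv_proj \<omega>) h) (rcoact \<Omega> \<gamma>) = tensor_lift P F (rcoact \<Omega> \<gamma>)"
proof -
  note lin = bicov_proj_linear bilinear_map_left[OF F] bilinear_map_right[OF F]
  have Fc: "F a b \<in> carrier P" if "a \<in> carrier \<Omega>" "b \<in> carrier H" for a b
    using that by (rule bilinear_map_closed[OF F])
  have "tensor_lift P (\<lambda>\<omega> h. F (coinv_proj \<omega>) h) (rcoact \<Omega> \<gamma>)
    = tensor_lift P (\<lambda>\<omega> h. tensor_lift P (\<lambda>a b. F (lact \<Omega> (antipode H a) b) h) (lcoact \<Omega> \<omega>)) (rcoact \<Omega> \<gamma>)"
  proof (rule lift_rcoact_cong)
    fix \<omega> h assume "\<omega> \<in> carrier \<Omega>" "h \<in> carrier H"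
    thus "F (coinv_proj \<omega>) h = tensor_lift P (\<lambda>a b. F (lact \<Omega> (antipode H a) b) h) (lcoact \<Omega> \<omega>)"
      unfolding coinv_proj_def
      by (intro linear_lift_lcoact[where P = \<Omega> and \<phi> = "\<lambda>x. F x h"] bilinear_map_left[OF F] linear_map_id P) auto
  qed (simp add: g)
  also have "\<dots> = tensor_lift P (\<lambda>a v. tensor_lift P (\<lambda>b h. F (lact \<Omega> (antipode H a) b) h) (rcoact \<Omega> v)) (lcoact \<Omega> \<gamma>)"
    by (rule coact_commute_lift) (rule lin | (simp add: g P; fail))+
  also have "\<dots> = tensor_lift P (\<lambda>b h. F (lact \<Omega> (antipode H \<one>\<^bsub>H\<^esub>) b) h) (rcoact \<Omega> \<gamma>)"
    by (rule lift_lcoact_coinv) (rule lin | (simp add: g P; fail))+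
  also have "\<dots> = tensor_lift P F (rcoact \<Omega> \<gamma>)"
    using g by (intro lift_rcoact_cong) (auto simp: antipode_one calc.lact_one)
  finally show ?thesis .
qed

text \<open>\<open>P\<close> is a left inverse of the inclusion of the coinvariant forms, hence \<open>P \<otimes> id\<close> is one of the inclusion tensored with
  \<open>H\<close>.  So a preimage is unique, and \<open>P(\<gamma>\<^sub>0) \<otimes> \<gamma>\<^sub>1\<close> is one by \<open>lift_rcoact_coinv_proj\<close>.\<close>

lemma coinv_rcoact_eq:
  assumes g: "\<gamma> \<in> carrier Coinv"
  shows "coinv_rcoact K H \<Omega> \<gamma> = tensor_map K Coinv H coinv_proj (\<lambda>h. h) (rcoact \<Omega> \<gamma>)"
proof -
  let ?t = "tensor_map K Coinv H coinv_proj (\<lambda>h. h) (rcoact \<Omega> \<gamma>)"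
  let ?i = "tensor_map K \<Omega> H (\<lambda>x. x) (\<lambda>h. h)"
  have incl: "linear_map K Coinv \<Omega> (\<lambda>x. x)" by (rule linear_map_Coinv_incl[OF linear_map_id])
  note lin = bicov_proj_linear linear_map_comp[OF coinv_proj_linear_Coinv]
  have t: "?t \<in> carrier (tensor K Coinv H)"
    using g by (intro tensor_map_closed[where M = \<Omega> and N = H]) auto
  have "?i ?t = tensor_lift (tensor K \<Omega> H) (\<lambda>\<omega> h. pure_tensor K \<Omega> H (coinv_proj \<omega>) h) (rcoact \<Omega> \<gamma>)"
    unfolding tensor_map_def[of K \<Omega> H]
    by (rule tensor_map_lift[where M = \<Omega> and N = H])
       (use g in \<open>auto intro!: bilinear_mapI bilinear_map_left[OF pure_tensor_bilinear]
          bilinear_map_right[OF pure_tensor_bilinear] incl linear_map_id\<close>)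
  also have "\<dots> = tensor_lift (tensor K \<Omega> H) (pure_tensor K \<Omega> H) (rcoact \<Omega> \<gamma>)"
    by (rule lift_rcoact_coinv_proj) (use g pure_tensor_bilinear in auto)
  also have "\<dots> = rcoact \<Omega> \<gamma>" using g by (intro tensor_lift_pure_id) auto
  finally have it: "?i ?t = rcoact \<Omega> \<gamma>" .
  have left_inverse: "tensor_map K Coinv H coinv_proj (\<lambda>h. h) (?i s) = s" if s: "s \<in> carrier (tensor K Coinv H)" for s
  proof -
    have "tensor_map K Coinv H coinv_proj (\<lambda>h. h) (?i s)
      = tensor_lift (tensor K Coinv H) (\<lambda>\<omega> h. pure_tensor K Coinv H (coinv_proj \<omega>) h) s"
      unfolding tensor_map_def[of K Coinv H]
      by (rule tensor_map_lift[where M = Coinv and N = H]) (rule lin | (simp add: s; fail))+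
    also have "\<dots> = tensor_lift (tensor K Coinv H) (pure_tensor K Coinv H) s"
      by (rule tensor_lift_cong[OF s]) (auto simp: coinv_proj_coinv)
    also have "\<dots> = s" using s by (intro tensor_lift_pure_id) auto
    finally show ?thesis .
  qed
  show ?thesis unfolding coinv_rcoact_def
    using t it left_inverse by (intro the_equality conjI) (assumption, assumption, metis)
qed

lemma lift_coinv_rcoact:
  assumes F: "bilinear_map K \<Omega> H P F" and P: "kspace K P" and g: "\<gamma> \<in> carrier Coinv"
  shows "tensor_lift P F (coinv_rcoact K H \<Omega> \<gamma>) = tensor_lift P F (rcoact \<Omega> \<gamma>)"
proof -
  have F': "bilinear_map K Coinv H P F"
    using F linear_map_Coinv_dom unfolding bilinear_map_def by auto
  have "tensor_lift P F (coinv_rcoact K H \<Omega> \<gamma>) = tensor_lift P (\<lambda>\<omega> h. F (coinv_proj \<omega>) h) (rcoact \<Omega> \<gamma>)"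
    unfolding coinv_rcoact_eq[OF g]
    by (rule tensor_map_lift[where M = \<Omega> and N = H]) (use F' P g in auto)
  thus ?thesis using lift_rcoact_coinv_proj[OF assms] by simp
qed

lemma coinv_rcoact_closed [simp]:
  "\<gamma> \<in> carrier Coinv \<Longrightarrow> coinv_rcoact K H \<Omega> \<gamma> \<in> carrier (tensor K Coinv H)"
  unfolding coinv_rcoact_eq by (rule tensor_map_closed[where M = \<Omega> and N = H]) auto

lemma coinv_rcoact_linear: "linear_map K Coinv (tensor K Coinv H) (coinv_rcoact K H \<Omega>)"
proof -
  have "linear_map K \<Omega> (tensor K Coinv H) (\<lambda>\<gamma>. tensor_map K Coinv H coinv_proj (\<lambda>h. h) (rcoact \<Omega> \<gamma>))"
    by (rule linear_map_comp[OF tensor_map_linear bicom.R.coact_linear])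
       (use coinv_proj_linear_Coinv linear_map_id in auto)
  from linear_map_Coinv_dom[OF this] show ?thesis
    by (subst linear_map_cong[OF kspace_Coinv, where g = "\<lambda>\<gamma>. tensor_map K Coinv H coinv_proj (\<lambda>h. h) (rcoact \<Omega> \<gamma>)"])
       (simp_all add: coinv_rcoact_eq)
qed

end

section \<open>The crossed product calculus\<close>

locale crossed_product_calculus =
  bicovariant_fodc K H \<Omega>H + twisted_module_fodc K H B act \<sigma> \<sigma>' \<Omega>B actf
  for K (structure) and H :: "('k, 'h, 'x) hopf_scheme" (structure)
    and B :: "('k, 'b, 'y) module_scheme" (structure)
    and act :: "'h \<Rightarrow> 'b \<Rightarrow> 'b" and \<sigma> \<sigma>' :: "('h \<times> 'h) list set \<Rightarrow> 'b"
    and \<Omega>H :: "('k, 'm, 'h, 'w) bicovariant_calculus_scheme"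
    and \<Omega>B :: "('k, 'v, 'b, 'z) calculus_scheme" and actf :: "'h \<Rightarrow> 'v \<Rightarrow> 'v"
begin

abbreviation "BH \<equiv> tensor K B H"

abbreviation "Hor \<equiv> tensor K \<Omega>B H"

abbreviation "Ver \<equiv> tensor K B \<Omega>H"

abbreviation "Forms \<equiv> direct_sum Hor Ver"

abbreviation "BHC \<equiv> tensor K BH Coinv"

abbreviation "mulA \<equiv> crossed_mult K H B act \<sigma>"

lemma kspaces [simp, intro]: "kspace K B" "kspace K \<Omega>B" "kspace K Forms"
  by (rule B.kspace_axioms calcB.\<Gamma>.kspace_axioms kspace_direct_sum kspace_tensor kspace_\<Omega> kspace_H)+

lemma crossed_closed [simp]:
  "h \<in> carrier H \<Longrightarrow> b \<in> carrier B \<Longrightarrow> act h b \<in> carrier B"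
  "h \<in> carrier H \<Longrightarrow> \<beta> \<in> carrier \<Omega>B \<Longrightarrow> actf h \<beta> \<in> carrier \<Omega>B"
  "t \<in> carrier (tensor K H H) \<Longrightarrow> \<sigma> t \<in> carrier B"
  "t \<in> carrier (tensor K H H) \<Longrightarrow> \<sigma>' t \<in> carrier B"
  "b \<in> carrier B \<Longrightarrow> \<beta> \<in> carrier \<Omega>B \<Longrightarrow> lact \<Omega>B b \<beta> \<in> carrier \<Omega>B"
  "b \<in> carrier B \<Longrightarrow> \<beta> \<in> carrier \<Omega>B \<Longrightarrow> ract \<Omega>B \<beta> b \<in> carrier \<Omega>B"
  "b \<in> carrier B \<Longrightarrow> diff \<Omega>B b \<in> carrier \<Omega>B"
  by (auto intro: bilinear_map_closed[OF act_bilinear] bilinear_map_closed[OF actf_bilinear]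
    linear_map_closed[OF \<sigma>_linear] linear_map_closed[OF \<sigma>'_linear] bilinear_map_closed[OF calcB.lact_bilinear]
    bilinear_map_closed[OF calcB.ract_bilinear] linear_map_closed[OF calcB.diff_linear])

lemma Forms_ops [simp]:
  "carrier Forms = carrier Hor \<times> carrier Ver" "\<zero>\<^bsub>Forms\<^esub> = (\<zero>\<^bsub>Hor\<^esub>, \<zero>\<^bsub>Ver\<^esub>)"
  "x \<oplus>\<^bsub>Forms\<^esub> y = (fst x \<oplus>\<^bsub>Hor\<^esub> fst y, snd x \<oplus>\<^bsub>Ver\<^esub> snd y)"
  "a \<odot>\<^bsub>Forms\<^esub> x = (a \<odot>\<^bsub>Hor\<^esub> fst x, a \<odot>\<^bsub>Ver\<^esub> snd x)"
  by (simp_all add: direct_sum_def)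

lemmas crossed_linear = linear_map_Coinv_incl[OF linear_map_id] bicov_linear
  bilinear_map_left[OF act_bilinear] bilinear_map_right[OF act_bilinear]
  bilinear_map_left[OF actf_bilinear] bilinear_map_right[OF actf_bilinear]
  bilinear_map_left[OF B.mult_bilinear] bilinear_map_right[OF B.mult_bilinear]
  linear_map_comp[OF \<sigma>_linear] linear_map_comp[OF \<sigma>'_linear] linear_map_comp[OF calcB.diff_linear]
  bilinear_map_left[OF calcB.lact_bilinear] bilinear_map_right[OF calcB.lact_bilinear]
  bilinear_map_left[OF calcB.ract_bilinear] bilinear_map_right[OF calcB.ract_bilinear]
  linear_map_comp[OF coinv_proj_linear] linear_map_comp[OF coinv_proj_linear_Coinv]
  linear_map_zero_const linear_map_pair

lemma crossed_mult_bilinear: "bilinear_map K BH BH BH mulA"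
  unfolding crossed_mult_def Let_def sweedler3_def by (rule crossed_linear | (simp; fail))+

lemma crossed_mult_pure:
  assumes [simp]: "b' \<in> carrier B" "h' \<in> carrier H" "b \<in> carrier B" "h \<in> carrier H"
  shows "mulA (pure_tensor K B H b' h') (pure_tensor K B H b h) =
    tensor_lift BH (\<lambda>u p3. tensor_lift BH (\<lambda>p1 p2. tensor_lift BH (\<lambda>q1 q2.
      pure_tensor K B H (b' \<otimes>\<^bsub>B\<^esub> act p1 b \<otimes>\<^bsub>B\<^esub> \<sigma> (pure_tensor K H H p2 q1)) (p3 \<otimes>\<^bsub>H\<^esub> q2))
      (comult H h)) (comult H u)) (comult H h')"
  unfolding crossed_mult_def Let_def sweedler3_def
  apply (rule HOL.trans, rule tensor_lift_pure)
  (* The last subgoal evaluates the inner sum; the others are the side conditions of the outer one. *)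
        prefer 7
  subgoal by (rule tensor_lift_pure) (rule crossed_linear | (simp; fail))+
  by (rule crossed_linear | (simp; fail))+

text \<open>Both actions on the crossed product calculus preserve the horizontal and the vertical summand.  Each of the
  four restrictions ignores the component filled in with \<open>undefined\<close>.\<close>

definition lact_hor :: "('b \<times> 'h) list set \<Rightarrow> ('v \<times> 'h) list set \<Rightarrow> ('v \<times> 'h) list set"
  where "lact_hor a t = fst (crossed_lact K H B act \<sigma> \<Omega>H \<Omega>B actf a (t, undefined))"

definition lact_ver :: "('b \<times> 'h) list set \<Rightarrow> ('b \<times> 'm) list set \<Rightarrow> ('b \<times> 'm) list set"
  where "lact_ver a t = snd (crossed_lact K H B act \<sigma> \<Omega>H \<Omega>B actf a (undefined, t))"

definition ract_hor :: "('v \<times> 'h) list set \<Rightarrow> ('b \<times> 'h) list set \<Rightarrow> ('v \<times> 'h) list set"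
  where "ract_hor t a = fst (crossed_ract K H B act \<sigma> \<Omega>H \<Omega>B (t, undefined) a)"

definition ract_ver :: "('b \<times> 'm) list set \<Rightarrow> ('b \<times> 'h) list set \<Rightarrow> ('b \<times> 'm) list set"
  where "ract_ver t a = snd (crossed_ract K H B act \<sigma> \<Omega>H \<Omega>B (undefined, t) a)"

lemma crossed_lact_eq: "crossed_lact K H B act \<sigma> \<Omega>H \<Omega>B actf a \<omega> = (lact_hor a (fst \<omega>), lact_ver a (snd \<omega>))"
  unfolding lact_hor_def lact_ver_def crossed_lact_def Let_def by simp

lemma crossed_ract_eq: "crossed_ract K H B act \<sigma> \<Omega>H \<Omega>B \<omega> a = (ract_hor (fst \<omega>) a, ract_ver (snd \<omega>) a)"
  unfolding ract_hor_def ract_ver_def crossed_ract_def Let_def by simp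

lemma crossed_actions_bilinear:
  "bilinear_map K BH Hor Hor lact_hor" "bilinear_map K BH Ver Ver lact_ver"
  "bilinear_map K Hor BH Hor ract_hor" "bilinear_map K Ver BH Ver ract_ver"
  unfolding lact_hor_def lact_ver_def ract_hor_def ract_ver_def crossed_lact_def crossed_ract_def
    Let_def sweedler3_def fst_conv snd_conv
  by (rule crossed_linear | (simp; fail))+

lemma lact_hor_pure:
  assumes [simp]: "b' \<in> carrier B" "h' \<in> carrier H" "\<beta> \<in> carrier \<Omega>B" "h \<in> carrier H"
  shows "lact_hor (pure_tensor K B H b' h') (pure_tensor K \<Omega>B H \<beta> h) =
    tensor_lift Hor (\<lambda>u p3. tensor_lift Hor (\<lambda>p1 p2. tensor_lift Hor (\<lambda>q1 q2.
      pure_tensor K \<Omega>B H (ract \<Omega>B (lact \<Omega>B b' (actf p1 \<beta>)) (\<sigma> (pure_tensor K H H p2 q1))) (p3 \<otimes>\<^bsub>H\<^esub> q2))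
      (comult H h)) (comult H u)) (comult H h')"
  unfolding lact_hor_def crossed_lact_def Let_def sweedler3_def fst_conv
  apply (rule HOL.trans, rule tensor_lift_pure)
  (* The last subgoal evaluates the inner sum; the others are the side conditions of the outer one. *)
        prefer 7
  subgoal by (rule tensor_lift_pure) (rule crossed_linear | (simp; fail))+
  by (rule crossed_linear | (simp; fail))+

lemma lact_ver_pure:
  assumes [simp]: "b' \<in> carrier B" "h' \<in> carrier H" "b \<in> carrier B" "\<gamma> \<in> carrier \<Omega>H"
  shows "lact_ver (pure_tensor K B H b' h') (pure_tensor K B \<Omega>H b \<gamma>) =
    tensor_lift Ver (\<lambda>u p3. tensor_lift Ver (\<lambda>p1 p2. tensor_lift Ver (\<lambda>g \<omega>.
      pure_tensor K B \<Omega>H (b' \<otimes>\<^bsub>B\<^esub> act p1 b \<otimes>\<^bsub>B\<^esub> \<sigma> (pure_tensor K H H p2 g)) (lact \<Omega>H p3 \<omega>))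
      (lcoact \<Omega>H \<gamma>)) (comult H u)) (comult H h')"
  unfolding lact_ver_def crossed_lact_def Let_def sweedler3_def snd_conv
  apply (rule HOL.trans, rule tensor_lift_pure)
  (* The last subgoal evaluates the inner sum; the others are the side conditions of the outer one. *)
        prefer 7
  subgoal by (rule tensor_lift_pure) (rule crossed_linear | (simp; fail))+
  by (rule crossed_linear | (simp; fail))+

lemma ract_hor_pure:
  assumes [simp]: "b' \<in> carrier B" "h' \<in> carrier H" "\<beta> \<in> carrier \<Omega>B" "h \<in> carrier H"
  shows "ract_hor (pure_tensor K \<Omega>B H \<beta> h) (pure_tensor K B H b' h') =
    tensor_lift Hor (\<lambda>u p3. tensor_lift Hor (\<lambda>p1 p2. tensor_lift Hor (\<lambda>q1 q2.
      pure_tensor K \<Omega>B H (ract \<Omega>B \<beta> (act p1 b' \<otimes>\<^bsub>B\<^esub> \<sigma> (pure_tensor K H H p2 q1))) (p3 \<otimes>\<^bsub>H\<^esub> q2))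
      (comult H h')) (comult H u)) (comult H h)"
  unfolding ract_hor_def crossed_ract_def Let_def sweedler3_def fst_conv
  apply (rule HOL.trans, rule tensor_lift_pure)
  (* The last subgoal evaluates the inner sum; the others are the side conditions of the outer one. *)
        prefer 7
  subgoal by (rule tensor_lift_pure) (rule crossed_linear | (simp; fail))+
  by (rule crossed_linear | (simp; fail))+

lemmas action_linear = bilinear_map_left[OF crossed_actions_bilinear(1)] bilinear_map_right[OF crossed_actions_bilinear(1)]
  bilinear_map_left[OF crossed_actions_bilinear(2)] bilinear_map_right[OF crossed_actions_bilinear(2)]
  bilinear_map_left[OF crossed_actions_bilinear(3)] bilinear_map_right[OF crossed_actions_bilinear(3)]
  bilinear_map_left[OF crossed_actions_bilinear(4)] bilinear_map_right[OF crossed_actions_bilinear(4)]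
  bilinear_map_left[OF crossed_mult_bilinear] bilinear_map_right[OF crossed_mult_bilinear]

lemma actions_closed [simp]:
  "a \<in> carrier BH \<Longrightarrow> t \<in> carrier Hor \<Longrightarrow> lact_hor a t \<in> carrier Hor"
  "a \<in> carrier BH \<Longrightarrow> s \<in> carrier Ver \<Longrightarrow> lact_ver a s \<in> carrier Ver"
  "a \<in> carrier BH \<Longrightarrow> t \<in> carrier Hor \<Longrightarrow> ract_hor t a \<in> carrier Hor"
  "a \<in> carrier BH \<Longrightarrow> s \<in> carrier Ver \<Longrightarrow> ract_ver s a \<in> carrier Ver"
  "a \<in> carrier BH \<Longrightarrow> a' \<in> carrier BH \<Longrightarrow> mulA a a' \<in> carrier BH"
  by (auto intro: bilinear_map_closed[OF crossed_actions_bilinear(1)] bilinear_map_closed[OF crossed_actions_bilinear(2)]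
    bilinear_map_closed[OF crossed_actions_bilinear(3)] bilinear_map_closed[OF crossed_actions_bilinear(4)]
    bilinear_map_closed[OF crossed_mult_bilinear])

lemma actions_zero:
  assumes "a \<in> carrier BH"
  shows "lact_hor a \<zero>\<^bsub>Hor\<^esub> = \<zero>\<^bsub>Hor\<^esub>" "ract_ver \<zero>\<^bsub>Ver\<^esub> a = \<zero>\<^bsub>Ver\<^esub>"
proof -
  have 1: "linear_map K Hor Hor (\<lambda>t. lact_hor a t)" and 2: "linear_map K Ver Ver (\<lambda>t. ract_ver t a)"
    by (rule action_linear linear_map_id assms)+
  show "lact_hor a \<zero>\<^bsub>Hor\<^esub> = \<zero>\<^bsub>Hor\<^esub>" by (rule linear_map_zero[OF _ _ 1]) auto
  show "ract_ver \<zero>\<^bsub>Ver\<^esub> a = \<zero>\<^bsub>Ver\<^esub>" by (rule linear_map_zero[OF _ _ 2]) auto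
qed

section \<open>Vertical forms and coinvariants\<close>

definition mult_map :: "(('b \<times> 'h) list set \<times> 'm) list set \<Rightarrow> ('b \<times> 'm) list set"
  where "mult_map = tensor_lift Ver (\<lambda>a \<gamma>. tensor_lift Ver (\<lambda>b h. pure_tensor K B \<Omega>H b (lact \<Omega>H h \<gamma>)) a)"

definition split_map :: "('b \<times> 'm) list set \<Rightarrow> (('b \<times> 'h) list set \<times> 'm) list set"
  where "split_map = tensor_lift BHC (\<lambda>b \<gamma>. tensor_lift BHC (\<lambda>g \<omega>.
    pure_tensor K BH Coinv (pure_tensor K B H b g) (coinv_proj \<omega>)) (lcoact \<Omega>H \<gamma>))"

lemma mult_map_linear: "linear_map K BHC Ver mult_map"
  unfolding mult_map_def by (rule crossed_linear | (simp; fail))+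

lemma split_map_linear: "linear_map K Ver BHC split_map"
  unfolding split_map_def by (rule crossed_linear | (simp; fail))+

lemmas conn_linear = crossed_linear action_linear linear_map_comp[OF mult_map_linear] linear_map_comp[OF split_map_linear]

lemma mult_map_closed [simp]: "t \<in> carrier BHC \<Longrightarrow> mult_map t \<in> carrier Ver"
  by (rule linear_map_closed[OF mult_map_linear])

lemma split_map_closed [simp]: "t \<in> carrier Ver \<Longrightarrow> split_map t \<in> carrier BHC"
  by (rule linear_map_closed[OF split_map_linear])

lemma mult_map_pure:
  assumes "a \<in> carrier BH" "\<gamma> \<in> carrier Coinv"
  shows "mult_map (pure_tensor K BH Coinv a \<gamma>) = tensor_lift Ver (\<lambda>b h. pure_tensor K B \<Omega>H b (lact \<Omega>H h \<gamma>)) a"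
  unfolding mult_map_def by (rule tensor_lift_pure) (rule crossed_linear | (simp add: assms; fail))+

lemma mult_map_pure_pure:
  assumes "b \<in> carrier B" "h \<in> carrier H" "\<gamma> \<in> carrier Coinv"
  shows "mult_map (pure_tensor K BH Coinv (pure_tensor K B H b h) \<gamma>) = pure_tensor K B \<Omega>H b (lact \<Omega>H h \<gamma>)"
  using assms
  by (subst mult_map_pure, simp, simp, intro tensor_lift_pure) (rule crossed_linear | (simp add: assms; fail))+

lemma split_map_pure:
  assumes "b \<in> carrier B" "\<gamma> \<in> carrier \<Omega>H"
  shows "split_map (pure_tensor K B \<Omega>H b \<gamma>) = tensor_lift BHC (\<lambda>g \<omega>.
    pure_tensor K BH Coinv (pure_tensor K B H b g) (coinv_proj \<omega>)) (lcoact \<Omega>H \<gamma>)"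
  unfolding split_map_def by (rule tensor_lift_pure) (rule crossed_linear | (simp add: assms; fail))+

text \<open>The extensionality principle \<open>tensor_ext\<close>, applied in both factors.\<close>

lemma pure_pure_ext:
  assumes P: "kspace K P" and t: "t \<in> carrier BHC"
    and \<phi>: "linear_map K BHC P \<phi>" and \<psi>: "linear_map K BHC P \<psi>"
    and eq: "\<And>b h \<gamma>. \<lbrakk>b \<in> carrier B; h \<in> carrier H; \<gamma> \<in> carrier Coinv\<rbrakk> \<Longrightarrow>
      \<phi> (pure_tensor K BH Coinv (pure_tensor K B H b h) \<gamma>) = \<psi> (pure_tensor K BH Coinv (pure_tensor K B H b h) \<gamma>)"
  shows "\<phi> t = \<psi> t"
proof (rule tensor_ext[OF _ _ P t \<phi> \<psi>])
  fix a \<gamma> assume a: "a \<in> carrier BH" and g: "\<gamma> \<in> carrier Coinv"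
  show "\<phi> (pure_tensor K BH Coinv a \<gamma>) = \<psi> (pure_tensor K BH Coinv a \<gamma>)"
    by (rule tensor_ext[where \<phi> = "\<lambda>a. \<phi> (pure_tensor K BH Coinv a \<gamma>)", OF _ _ P a])
       (use eq g in \<open>auto intro!: linear_map_comp[OF \<phi>] linear_map_comp[OF \<psi>]
          bilinear_map_left[OF pure_tensor_bilinear] linear_map_id\<close>)
qed auto

text \<open>The left coaction of \<open>h \<gamma>\<close> is \<open>h\<^sub>1 \<otimes> h\<^sub>2 \<gamma>\<close>, and \<open>P(h\<^sub>2 \<gamma>) = \<epsilon>(h\<^sub>2) \<gamma>\<close>.\<close>

lemma split_mult:
  assumes t: "t \<in> carrier BHC"
  shows "split_map (mult_map t) = t"
proof (rule pure_pure_ext[where P = BHC and \<phi> = "\<lambda>t. split_map (mult_map t)" and \<psi> = "\<lambda>t. t", OF _ t])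
  fix b h \<gamma> assume [simp]: "b \<in> carrier B" "h \<in> carrier H" "\<gamma> \<in> carrier Coinv"
  have "split_map (mult_map (pure_tensor K BH Coinv (pure_tensor K B H b h) \<gamma>))
    = tensor_lift BHC (\<lambda>g \<omega>. pure_tensor K BH Coinv (pure_tensor K B H b g) (coinv_proj \<omega>)) (lcoact \<Omega>H (lact \<Omega>H h \<gamma>))"
    by (simp add: mult_map_pure_pure split_map_pure)
  also have "\<dots> = tensor_lift BHC (\<lambda>h1 h2. pure_tensor K BH Coinv (pure_tensor K B H b h1) (coinv_proj (lact \<Omega>H h2 \<gamma>))) (comult H h)"
    by (rule lift_lcoact_lact_coinv) (rule crossed_linear | (simp; fail))+
  also have "\<dots> = tensor_lift BHC (\<lambda>h1 h2. counit H h2 \<odot>\<^bsub>BHC\<^esub> pure_tensor K BH Coinv (pure_tensor K B H b h1) \<gamma>) (comult H h)"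
  proof (rule lift_comult_cong)
    fix h1 h2 assume h: "h1 \<in> carrier H" "h2 \<in> carrier H"
    have "linear_map K Coinv BHC (\<lambda>\<gamma>. pure_tensor K BH Coinv (pure_tensor K B H b h1) \<gamma>)"
      by (rule crossed_linear | (simp add: h; fail))+
    from linear_map_smult[OF this, of "counit H h2" \<gamma>]
    show "pure_tensor K BH Coinv (pure_tensor K B H b h1) (coinv_proj (lact \<Omega>H h2 \<gamma>))
      = counit H h2 \<odot>\<^bsub>BHC\<^esub> pure_tensor K BH Coinv (pure_tensor K B H b h1) \<gamma>"
      by (simp add: coinv_proj_lact h)
  qed simp
  also have "\<dots> = pure_tensor K BH Coinv (pure_tensor K B H b h) \<gamma>"
    by (rule counit_right_lift) (rule crossed_linear | (simp; fail))+
  finally show "split_map (mult_map (pure_tensor K BH Coinv (pure_tensor K B H b h) \<gamma>))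
    = pure_tensor K BH Coinv (pure_tensor K B H b h) \<gamma>" .
qed (rule conn_linear | (simp; fail))+

lemma mult_split:
  assumes t: "t \<in> carrier Ver"
  shows "mult_map (split_map t) = t"
proof (rule tensor_ext[where P = Ver and \<phi> = "\<lambda>t. mult_map (split_map t)" and \<psi> = "\<lambda>t. t", OF _ _ _ t])
  fix b \<gamma> assume [simp]: "b \<in> carrier B" "\<gamma> \<in> carrier \<Omega>H"
  have "mult_map (split_map (pure_tensor K B \<Omega>H b \<gamma>))
    = tensor_lift Ver (\<lambda>g \<omega>. mult_map (pure_tensor K BH Coinv (pure_tensor K B H b g) (coinv_proj \<omega>))) (lcoact \<Omega>H \<gamma>)"
    by (simp add: split_map_pure, rule linear_lift_lcoact[OF mult_map_linear]) auto
  also have "\<dots> = tensor_lift Ver (\<lambda>g \<omega>. pure_tensor K B \<Omega>H b (lact \<Omega>H g (coinv_proj \<omega>))) (lcoact \<Omega>H \<gamma>)"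
    by (rule lift_lcoact_cong) (auto simp: mult_map_pure_pure)
  also have "\<dots> = pure_tensor K B \<Omega>H b (tensor_lift \<Omega>H (\<lambda>g \<omega>. lact \<Omega>H g (coinv_proj \<omega>)) (lcoact \<Omega>H \<gamma>))"
    by (rule linear_lift_lcoact[symmetric]) (rule crossed_linear | (simp; fail))+
  finally show "mult_map (split_map (pure_tensor K B \<Omega>H b \<gamma>)) = pure_tensor K B \<Omega>H b \<gamma>"
    by (simp add: coinv_proj_reconstruct)
qed (rule conn_linear | (simp; fail))+

text \<open>For pure tensors, both sides are
  \<open>b' (h'\<^sub>1 \<cdot> b) \<sigma>(h'\<^sub>2 \<otimes> h\<^sub>1) \<otimes> h'\<^sub>3 h\<^sub>2 \<gamma>\<close>: on the right because the left coaction of \<open>h \<gamma>\<close>, which enters the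
  action on vertical forms, is \<open>h\<^sub>1 \<otimes> h\<^sub>2 \<gamma>\<close>.\<close>

lemma mult_map_mult_pure:
  assumes a: "a \<in> carrier BH" and a': "a' \<in> carrier BH" and g: "\<gamma> \<in> carrier Coinv"
  shows "mult_map (pure_tensor K BH Coinv (mulA a a') \<gamma>) = lact_ver a (mult_map (pure_tensor K BH Coinv a' \<gamma>))"
proof (rule tensor_ext[where P = Ver and \<phi> = "\<lambda>a. mult_map (pure_tensor K BH Coinv (mulA a a') \<gamma>)", OF _ _ _ a])
  fix b' h' assume 1 [simp]: "b' \<in> carrier B" "h' \<in> carrier H"
  let ?a = "pure_tensor K B H b' h'"
  show "mult_map (pure_tensor K BH Coinv (mulA ?a a') \<gamma>) = lact_ver ?a (mult_map (pure_tensor K BH Coinv a' \<gamma>))"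
  proof (rule tensor_ext[where P = Ver and \<phi> = "\<lambda>a'. mult_map (pure_tensor K BH Coinv (mulA ?a a') \<gamma>)", OF _ _ _ a'])
    fix b h assume 2 [simp]: "b \<in> carrier B" "h \<in> carrier H"
    note [simp] = g
    let ?c = "\<lambda>p1 p2 q. b' \<otimes>\<^bsub>B\<^esub> act p1 b \<otimes>\<^bsub>B\<^esub> \<sigma> (pure_tensor K H H p2 q)"
    have \<phi>: "linear_map K BH Ver (\<lambda>a. mult_map (pure_tensor K BH Coinv a \<gamma>))"
      by (rule conn_linear | (simp; fail))+
    have "mult_map (pure_tensor K BH Coinv (mulA ?a (pure_tensor K B H b h)) \<gamma>)
      = tensor_lift Ver (\<lambda>u p3. mult_map (pure_tensor K BH Coinv (tensor_lift BH (\<lambda>p1 p2. tensor_lift BH (\<lambda>q1 q2.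
          pure_tensor K B H (?c p1 p2 q1) (p3 \<otimes>\<^bsub>H\<^esub> q2)) (comult H h)) (comult H u)) \<gamma>)) (comult H h')"
      unfolding crossed_mult_pure[OF 1 2] by (rule linear_lift_comult[OF \<phi>]) auto
    also have "\<dots> = tensor_lift Ver (\<lambda>u p3. tensor_lift Ver (\<lambda>p1 p2. mult_map (pure_tensor K BH Coinv (tensor_lift BH (\<lambda>q1 q2.
          pure_tensor K B H (?c p1 p2 q1) (p3 \<otimes>\<^bsub>H\<^esub> q2)) (comult H h)) \<gamma>)) (comult H u)) (comult H h')"
      by (rule lift_comult_cong, simp, rule linear_lift_comult[OF \<phi>]) auto
    also have "\<dots> = tensor_lift Ver (\<lambda>u p3. tensor_lift Ver (\<lambda>p1 p2. tensor_lift Ver (\<lambda>q1 q2.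
          mult_map (pure_tensor K BH Coinv (pure_tensor K B H (?c p1 p2 q1) (p3 \<otimes>\<^bsub>H\<^esub> q2)) \<gamma>)) (comult H h)) (comult H u)) (comult H h')"
      by (rule lift_comult_cong, simp, rule lift_comult_cong, simp, rule linear_lift_comult[OF \<phi>]) auto
    also have "\<dots> = tensor_lift Ver (\<lambda>u p3. tensor_lift Ver (\<lambda>p1 p2. tensor_lift Ver (\<lambda>q1 q2.
          pure_tensor K B \<Omega>H (?c p1 p2 q1) (lact \<Omega>H p3 (lact \<Omega>H q2 \<gamma>))) (comult H h)) (comult H u)) (comult H h')"
      by (rule lift_comult_cong, simp, rule lift_comult_cong, simp, rule lift_comult_cong, simp)
         (simp add: mult_map_pure_pure calc.lact_mult)
    also have "\<dots> = tensor_lift Ver (\<lambda>u p3. tensor_lift Ver (\<lambda>p1 p2. tensor_lift Ver (\<lambda>q \<omega>.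
          pure_tensor K B \<Omega>H (?c p1 p2 q) (lact \<Omega>H p3 \<omega>)) (lcoact \<Omega>H (lact \<Omega>H h \<gamma>))) (comult H u)) (comult H h')"
    proof (rule lift_comult_cong, simp, rule lift_comult_cong, simp)
      fix u p3 p1 p2 assume p: "p3 \<in> carrier H" "p1 \<in> carrier H" "p2 \<in> carrier H"
      show "tensor_lift Ver (\<lambda>q1 q2. pure_tensor K B \<Omega>H (?c p1 p2 q1) (lact \<Omega>H p3 (lact \<Omega>H q2 \<gamma>))) (comult H h)
        = tensor_lift Ver (\<lambda>q \<omega>. pure_tensor K B \<Omega>H (?c p1 p2 q) (lact \<Omega>H p3 \<omega>)) (lcoact \<Omega>H (lact \<Omega>H h \<gamma>))"
        by (rule lift_lcoact_lact_coinv[symmetric]) (rule crossed_linear | (simp add: p; fail))+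
    qed
    also have "\<dots> = lact_ver ?a (mult_map (pure_tensor K BH Coinv (pure_tensor K B H b h) \<gamma>))"
      by (simp add: mult_map_pure_pure lact_ver_pure)
    finally show "mult_map (pure_tensor K BH Coinv (mulA ?a (pure_tensor K B H b h)) \<gamma>)
      = lact_ver ?a (mult_map (pure_tensor K BH Coinv (pure_tensor K B H b h) \<gamma>))" .
  qed (rule conn_linear | (simp add: g; fail))+
qed (rule conn_linear | (simp add: g a'; fail))+

lemma mult_map_left_linear:
  assumes a: "a \<in> carrier BH" and t: "t \<in> carrier BHC"
  shows "mult_map (tensor_map K BH Coinv (mulA a) (\<lambda>\<gamma>. \<gamma>) t) = lact_ver a (mult_map t)"
proof (rule tensor_ext[where P = Ver and \<phi> = "\<lambda>t. mult_map (tensor_map K BH Coinv (mulA a) (\<lambda>\<gamma>. \<gamma>) t)", OF _ _ _ t])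
  have mul: "linear_map K BH BH (mulA a)" by (rule conn_linear a)+
  show "linear_map K BHC Ver (\<lambda>t. mult_map (tensor_map K BH Coinv (mulA a) (\<lambda>\<gamma>. \<gamma>) t))"
    by (intro linear_map_comp[OF mult_map_linear] tensor_map_linear mul linear_map_id) auto
  fix a' \<gamma> assume 1: "a' \<in> carrier BH" "\<gamma> \<in> carrier Coinv"
  hence "tensor_map K BH Coinv (mulA a) (\<lambda>\<gamma>. \<gamma>) (pure_tensor K BH Coinv a' \<gamma>) = pure_tensor K BH Coinv (mulA a a') \<gamma>"
    by (intro tensor_map_pure mul linear_map_id) auto
  thus "mult_map (tensor_map K BH Coinv (mulA a) (\<lambda>\<gamma>. \<gamma>) (pure_tensor K BH Coinv a' \<gamma>))
    = lact_ver a (mult_map (pure_tensor K BH Coinv a' \<gamma>))"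
    using mult_map_mult_pure[OF a 1] by simp
qed (rule conn_linear | (simp add: a; fail))+

abbreviation "coA \<equiv> crossed_coact K H B"

lemma crossed_coact_linear: "linear_map K BH (tensor K BH H) coA"
  unfolding crossed_coact_def Let_def by (rule crossed_linear | (simp; fail))+

lemma crossed_coact_closed [simp]: "a \<in> carrier BH \<Longrightarrow> coA a \<in> carrier (tensor K BH H)"
  by (rule linear_map_closed[OF crossed_coact_linear])

lemma crossed_coact_pure:
  assumes "b \<in> carrier B" "h \<in> carrier H"
  shows "coA (pure_tensor K B H b h) = tensor_lift (tensor K BH H)
    (\<lambda>h1 h2. pure_tensor K BH H (pure_tensor K B H b h1) h2) (comult H h)"
  unfolding crossed_coact_def Let_def
  by (rule tensor_lift_pure) (rule crossed_linear | (simp add: assms; fail))+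

lemma lift_crossed_coact_pure:
  assumes F: "bilinear_map K BH H P F" and P: "kspace K P" and bh: "b \<in> carrier B" "h \<in> carrier H"
  shows "tensor_lift P F (coA (pure_tensor K B H b h)) = tensor_lift P (\<lambda>h1 h2. F (pure_tensor K B H b h1) h2) (comult H h)"
proof -
  have "tensor_lift P F (coA (pure_tensor K B H b h))
    = tensor_lift P (\<lambda>h1 h2. tensor_lift P F (pure_tensor K BH H (pure_tensor K B H b h1) h2)) (comult H h)"
    unfolding crossed_coact_pure[OF bh]
    by (rule tensor_lift_lift[OF comult_closed[OF bh(2)]]) (use P F bh in auto)
  also have "\<dots> = tensor_lift P (\<lambda>h1 h2. F (pure_tensor K B H b h1) h2) (comult H h)"
    by (rule lift_comult_cong) (use P F bh in \<open>auto intro!: tensor_lift_pure\<close>)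
  finally show ?thesis .
qed

abbreviation "diffA_ver \<equiv> tensor_map K B \<Omega>H (\<lambda>b. b) (diff \<Omega>H)"

abbreviation "diffA_hor \<equiv> tensor_map K \<Omega>B H (diff \<Omega>B) (\<lambda>h. h)"

lemma diffA_linear: "linear_map K BH Ver diffA_ver" "linear_map K BH Hor diffA_hor"
  by (rule tensor_map_linear calc.diff_linear calcB.diff_linear linear_map_id kspaces kspace_H kspace_\<Omega>)+

lemma diffA_closed [simp]:
  "a \<in> carrier BH \<Longrightarrow> diffA_ver a \<in> carrier Ver" "a \<in> carrier BH \<Longrightarrow> diffA_hor a \<in> carrier Hor"
  by (rule linear_map_closed[OF diffA_linear(1)] linear_map_closed[OF diffA_linear(2)]; assumption)+

lemma diffA_pure:
  assumes "b \<in> carrier B" "h \<in> carrier H"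
  shows "diffA_ver (pure_tensor K B H b h) = pure_tensor K B \<Omega>H b (diff \<Omega>H h)"
    and "diffA_hor (pure_tensor K B H b h) = pure_tensor K \<Omega>B H (diff \<Omega>B b) h"
  using assms by (intro tensor_map_pure calc.diff_linear calcB.diff_linear linear_map_id; auto)+

text \<open>The value \<open>a a'\<^sub>0 \<otimes> S(a'\<^sub>1) da'\<^sub>2\<close> prescribed for the vertical map on \<open>a da'\<close>.\<close>

definition vertical_value :: "('b \<times> 'h) list set \<Rightarrow> ('b \<times> 'h) list set \<Rightarrow> (('b \<times> 'h) list set \<times> 'm) list set"
  where "vertical_value a a' = tensor_lift BHC (\<lambda>a'0 u. pure_tensor K BH Coinv (mulA a a'0) (maurer_cartan H \<Omega>H u)) (coA a')"

text \<open>\<open>b \<otimes> h\<^sub>1 S(h\<^sub>2) dh\<^sub>3 = b \<otimes> dh\<close>, obtained as \<open>coinv_proj_reconstruct\<close> for the form \<open>dh\<close>.\<close>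

lemma mult_map_maurer_cartan:
  assumes a: "a \<in> carrier BH"
  shows "tensor_lift Ver (\<lambda>a0 u. mult_map (pure_tensor K BH Coinv a0 (coinv_proj (diff \<Omega>H u)))) (coA a) = diffA_ver a"
proof (rule tensor_ext[where P = Ver and \<phi> = "\<lambda>a. tensor_lift Ver (\<lambda>a0 u. mult_map (pure_tensor K BH Coinv a0 (coinv_proj (diff \<Omega>H u)))) (coA a)", OF _ _ _ a])
  fix b h assume [simp]: "b \<in> carrier B" "h \<in> carrier H"
  have "tensor_lift Ver (\<lambda>a0 u. mult_map (pure_tensor K BH Coinv a0 (coinv_proj (diff \<Omega>H u)))) (coA (pure_tensor K B H b h))
    = tensor_lift Ver (\<lambda>h1 h2. mult_map (pure_tensor K BH Coinv (pure_tensor K B H b h1) (coinv_proj (diff \<Omega>H h2)))) (comult H h)"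
    by (rule lift_crossed_coact_pure) (rule conn_linear | (simp; fail))+
  also have "\<dots> = tensor_lift Ver (\<lambda>h1 h2. pure_tensor K B \<Omega>H b (lact \<Omega>H h1 (coinv_proj (diff \<Omega>H h2)))) (comult H h)"
    by (rule lift_comult_cong) (auto simp: mult_map_pure_pure)
  also have "\<dots> = tensor_lift Ver (\<lambda>g \<omega>. pure_tensor K B \<Omega>H b (lact \<Omega>H g (coinv_proj \<omega>))) (lcoact \<Omega>H (diff \<Omega>H h))"
    by (rule lift_lcoact_diff[symmetric]) (rule conn_linear | (simp; fail))+
  also have "\<dots> = pure_tensor K B \<Omega>H b (tensor_lift \<Omega>H (\<lambda>g \<omega>. lact \<Omega>H g (coinv_proj \<omega>)) (lcoact \<Omega>H (diff \<Omega>H h)))"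
    by (rule linear_lift_lcoact[symmetric]) (rule crossed_linear | (simp; fail))+
  also have "\<dots> = diffA_ver (pure_tensor K B H b h)"
    by (simp add: coinv_proj_reconstruct diffA_pure)
  finally show "tensor_lift Ver (\<lambda>a0 u. mult_map (pure_tensor K BH Coinv a0 (coinv_proj (diff \<Omega>H u)))) (coA (pure_tensor K B H b h))
    = diffA_ver (pure_tensor K B H b h)" .
qed (rule conn_linear diffA_linear linear_map_comp[OF crossed_coact_linear] | (simp; fail))+

text \<open>As \<open>split_map\<close> inverts \<open>mult_map\<close>, it suffices to apply \<open>mult_map\<close> to the right-hand side.  Left linearity takes the
  factor \<open>a\<close> out, and \<open>mult_map_maurer_cartan\<close> evaluates the rest.\<close>

lemma split_map_vertical_value:
  assumes a: "a \<in> carrier BH" and a': "a' \<in> carrier BH"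
  shows "split_map (lact_ver a (diffA_ver a')) = vertical_value a a'"
proof -
  have cl: "vertical_value a a' \<in> carrier BHC"
    unfolding vertical_value_def
    by (rule tensor_lift_closed[OF crossed_coact_closed[OF a']]) (auto simp: maurer_cartan_eq a)
  have "mult_map (vertical_value a a') = tensor_lift Ver (\<lambda>a'0 u. mult_map (pure_tensor K BH Coinv (mulA a a'0) (maurer_cartan H \<Omega>H u))) (coA a')"
    unfolding vertical_value_def
    by (rule linear_tensor_lift[OF crossed_coact_closed[OF a'] _ _ _ _ mult_map_linear]) (auto simp: maurer_cartan_eq a)
  also have "\<dots> = tensor_lift Ver (\<lambda>a'0 u. lact_ver a (mult_map (pure_tensor K BH Coinv a'0 (coinv_proj (diff \<Omega>H u))))) (coA a')"
    by (rule tensor_lift_cong[OF crossed_coact_closed[OF a']]) (auto simp: maurer_cartan_eq a mult_map_mult_pure)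
  also have "\<dots> = lact_ver a (tensor_lift Ver (\<lambda>a'0 u. mult_map (pure_tensor K BH Coinv a'0 (coinv_proj (diff \<Omega>H u)))) (coA a'))"
    by (rule linear_tensor_lift[symmetric, OF crossed_coact_closed[OF a']])
       (rule conn_linear | (simp add: a; fail))+
  also have "\<dots> = lact_ver a (diffA_ver a')" by (simp add: mult_map_maurer_cartan a')
  finally show ?thesis using split_mult[OF cl] by simp
qed

section \<open>Colinearity of the connection\<close>

abbreviation "A \<equiv> crossed_product K H B act \<sigma>"

abbreviation "\<Omega>A \<equiv> crossed_calculus K H B act \<sigma> \<Omega>H \<Omega>B actf"

lemma A_ops: "carrier A = carrier BH" "add A = add BH" "zero A = zero BH" "smult A = smult BH"
  "mult A = mulA"
  by (simp_all add: crossed_product_def)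

lemma \<Omega>A_ops: "carrier \<Omega>A = carrier Forms" "add \<Omega>A = add Forms" "zero \<Omega>A = zero Forms" "smult \<Omega>A = smult Forms"
  "lact \<Omega>A = crossed_lact K H B act \<sigma> \<Omega>H \<Omega>B actf" "ract \<Omega>A = crossed_ract K H B act \<sigma> \<Omega>H \<Omega>B"
  "diff \<Omega>A = crossed_diff K H B \<Omega>H \<Omega>B"
  by (simp_all add: crossed_calculus_def module.defs)

lemmas A_tensor = tensor_cong[OF A_ops(1-4)]

lemmas \<Omega>A_tensor = tensor_cong[OF \<Omega>A_ops(1-4)]

lemma kspace_\<Omega>A: "kspace K \<Omega>A"
  by (rule kspace_cong[OF kspaces(3)]) (simp_all only: \<Omega>A_ops)

lemma linear_map_\<Omega>A:
  "linear_map K M \<Omega>A f \<longleftrightarrow> linear_map K M Forms f" "linear_map K \<Omega>A N g \<longleftrightarrow> linear_map K Forms N g"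
  by (simp_all only: linear_map_def \<Omega>A_ops)

definition conn :: "(('b \<times> 'h) list set \<times> 'm) list set \<Rightarrow> ('v \<times> 'h) list set \<times> ('b \<times> 'm) list set"
  where "conn t = (\<zero>\<^bsub>Hor\<^esub>, mult_map t)"

lemma conn_map_linear: "linear_map K BHC Forms conn"
  unfolding conn_def by (rule conn_linear mult_map_linear | (simp; fail))+

lemma conn_closed [simp]: "t \<in> carrier BHC \<Longrightarrow> conn t \<in> carrier Hor \<times> carrier Ver"
  using linear_map_closed[OF conn_map_linear] by simp

lemma zeros_closed [simp]: "\<zero>\<^bsub>Hor\<^esub> \<in> carrier Hor" "\<zero>\<^bsub>Ver\<^esub> \<in> carrier Ver"
proof -
  interpret Hor: kspace K Hor by auto
  interpret Ver: kspace K Ver by auto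
  show "\<zero>\<^bsub>Hor\<^esub> \<in> carrier Hor" "\<zero>\<^bsub>Ver\<^esub> \<in> carrier Ver" by simp_all
qed

abbreviation "FH \<equiv> tensor K Forms H"

lemma coact_zero_hor:
  assumes u: "u \<in> carrier Ver"
  shows "crossed_calculus_coact K H B \<Omega>H \<Omega>B (\<zero>\<^bsub>Hor\<^esub>, u) =
    tensor_lift FH (\<lambda>b \<gamma>. tensor_lift FH (\<lambda>\<omega> h. pure_tensor K Forms H (\<zero>\<^bsub>Hor\<^esub>, pure_tensor K B \<Omega>H b \<omega>) h) (rcoact \<Omega>H \<gamma>)) u"
proof -
  interpret FH: kspace K FH by auto
  have 1: "linear_map K Hor FH (tensor_lift FH (\<lambda>\<beta> h. tensor_lift FH (\<lambda>h1 h2.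
        pure_tensor K Forms H (pure_tensor K \<Omega>B H \<beta> h1, \<zero>\<^bsub>Ver\<^esub>) h2) (comult H h)))"
    by (rule conn_linear | (simp; fail))+
  have 2: "linear_map K Ver FH (tensor_lift FH (\<lambda>b \<gamma>. tensor_lift FH (\<lambda>\<omega> h. pure_tensor K Forms H (\<zero>\<^bsub>Hor\<^esub>, pure_tensor K B \<Omega>H b \<omega>) h) (rcoact \<Omega>H \<gamma>)))"
    by (rule conn_linear | (simp; fail))+
  have z: "tensor_lift FH (\<lambda>\<beta> h. tensor_lift FH (\<lambda>h1 h2.
        pure_tensor K Forms H (pure_tensor K \<Omega>B H \<beta> h1, \<zero>\<^bsub>Ver\<^esub>) h2) (comult H h)) \<zero>\<^bsub>Hor\<^esub> = \<zero>\<^bsub>FH\<^esub>"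
    by (rule linear_map_zero[OF _ _ 1]) auto
  show ?thesis
    unfolding crossed_calculus_coact_def Let_def fst_conv snd_conv z
    by (rule FH.l_zero) (rule linear_map_closed[OF 2 u])
qed

lemma diagonal_coact_linear: "linear_map K BHC (tensor K BHC H) (diagonal_coact K H \<Omega>H BH coA)"
  unfolding diagonal_coact_def Let_def
  by (rule conn_linear linear_map_comp[OF crossed_coact_linear] crossed_coact_closed coinv_rcoact_closed
      linear_map_comp[OF coinv_rcoact_linear] | (simp; fail))+

text \<open>On \<open>(b \<otimes> h) \<otimes> \<gamma>\<close> both sides are \<open>(b \<otimes> h\<^sub>1 \<gamma>\<^sub>0) \<otimes> h\<^sub>2 \<gamma>\<^sub>1\<close>; the restricted coaction of \<open>\<gamma>\<close> in the diagonal one is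
  replaced by the coaction on all forms with \<open>lift_coinv_rcoact\<close>.\<close>

lemma conn_colinear:
  assumes t: "t \<in> carrier BHC"
  shows "crossed_calculus_coact K H B \<Omega>H \<Omega>B (conn t) = tensor_map K Forms H conn (\<lambda>h. h) (diagonal_coact K H \<Omega>H BH coA t)"
proof -
  let ?F = "\<lambda>b \<omega> h. pure_tensor K Forms H (\<zero>\<^bsub>Hor\<^esub>, pure_tensor K B \<Omega>H b \<omega>) h"
  let ?co = "tensor_lift FH (\<lambda>b \<gamma>. tensor_lift FH (\<lambda>\<omega> h. ?F b \<omega> h) (rcoact \<Omega>H \<gamma>))"
  let ?T = "tensor K BHC H"
  have conn: "linear_map K (tensor K BHC H) FH (tensor_map K Forms H conn (\<lambda>h. h))"
    by (rule tensor_map_linear conn_map_linear linear_map_id | (simp; fail))+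
  have "?co (mult_map t) = tensor_map K Forms H conn (\<lambda>h. h) (diagonal_coact K H \<Omega>H BH coA t)"
  proof (rule pure_pure_ext[where P = FH and \<phi> = "\<lambda>t. ?co (mult_map t)", OF _ t])
    show "linear_map K BHC FH (\<lambda>t. tensor_map K Forms H conn (\<lambda>h. h) (diagonal_coact K H \<Omega>H BH coA t))"
      by (rule linear_map_comp[OF conn diagonal_coact_linear])
  next
    fix b h \<gamma> assume [simp]: "b \<in> carrier B" "h \<in> carrier H" "\<gamma> \<in> carrier Coinv"
    have "?co (mult_map (pure_tensor K BH Coinv (pure_tensor K B H b h) \<gamma>)) = ?co (pure_tensor K B \<Omega>H b (lact \<Omega>H h \<gamma>))"
      by (simp add: mult_map_pure_pure)
    also have "\<dots> = tensor_lift FH (\<lambda>\<omega> h. ?F b \<omega> h) (rcoact \<Omega>H (lact \<Omega>H h \<gamma>))"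
      by (rule tensor_lift_pure) (rule conn_linear | (simp; fail))+
    also have "\<dots> = tensor_lift FH (\<lambda>h1 h2. tensor_lift FH (\<lambda>\<omega> g. ?F b (lact \<Omega>H h1 \<omega>) (h2 \<otimes>\<^bsub>H\<^esub> g)) (rcoact \<Omega>H \<gamma>)) (comult H h)"
      by (rule lift_rcoact_lact) (rule conn_linear | (simp; fail))+
    also have "\<dots> = tensor_lift FH (\<lambda>h1 h2. tensor_map K Forms H conn (\<lambda>h. h)
        (tensor_lift ?T (\<lambda>\<omega> g. pure_tensor K BHC H (pure_tensor K BH Coinv (pure_tensor K B H b h1) \<omega>) (h2 \<otimes>\<^bsub>H\<^esub> g)) (coinv_rcoact K H \<Omega>H \<gamma>))) (comult H h)"
    proof (rule lift_comult_cong)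
      fix h1 h2 assume h [simp]: "h1 \<in> carrier H" "h2 \<in> carrier H"
      have "tensor_map K Forms H conn (\<lambda>h. h)
        (tensor_lift ?T (\<lambda>\<omega> g. pure_tensor K BHC H (pure_tensor K BH Coinv (pure_tensor K B H b h1) \<omega>) (h2 \<otimes>\<^bsub>H\<^esub> g)) (coinv_rcoact K H \<Omega>H \<gamma>))
        = tensor_lift FH (\<lambda>\<omega> g. tensor_map K Forms H conn (\<lambda>h. h)
        (pure_tensor K BHC H (pure_tensor K BH Coinv (pure_tensor K B H b h1) \<omega>) (h2 \<otimes>\<^bsub>H\<^esub> g))) (coinv_rcoact K H \<Omega>H \<gamma>)"
        by (rule linear_tensor_lift[OF coinv_rcoact_closed _ _ _ _ conn]) auto
      also have "\<dots> = tensor_lift FH (\<lambda>\<omega> g. ?F b (lact \<Omega>H h1 \<omega>) (h2 \<otimes>\<^bsub>H\<^esub> g)) (coinv_rcoact K H \<Omega>H \<gamma>)"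
      proof (rule tensor_lift_cong[OF coinv_rcoact_closed])
        fix \<omega> g assume o [simp]: "\<omega> \<in> carrier Coinv" "g \<in> carrier H"
        have "tensor_map K Forms H conn (\<lambda>h. h) (pure_tensor K BHC H (pure_tensor K BH Coinv (pure_tensor K B H b h1) \<omega>) (h2 \<otimes>\<^bsub>H\<^esub> g))
          = pure_tensor K Forms H (conn (pure_tensor K BH Coinv (pure_tensor K B H b h1) \<omega>)) (h2 \<otimes>\<^bsub>H\<^esub> g)"
          by (rule tensor_map_pure[OF _ _ _ _ conn_map_linear linear_map_id]) auto
        thus "tensor_map K Forms H conn (\<lambda>h. h) (pure_tensor K BHC H (pure_tensor K BH Coinv (pure_tensor K B H b h1) \<omega>) (h2 \<otimes>\<^bsub>H\<^esub> g))
          = ?F b (lact \<Omega>H h1 \<omega>) (h2 \<otimes>\<^bsub>H\<^esub> g)"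
          by (simp add: conn_def mult_map_pure_pure)
      qed auto
      also have "\<dots> = tensor_lift FH (\<lambda>\<omega> g. ?F b (lact \<Omega>H h1 \<omega>) (h2 \<otimes>\<^bsub>H\<^esub> g)) (rcoact \<Omega>H \<gamma>)"
        by (rule lift_coinv_rcoact) (rule conn_linear | (simp; fail))+
      finally show "tensor_lift FH (\<lambda>\<omega> g. ?F b (lact \<Omega>H h1 \<omega>) (h2 \<otimes>\<^bsub>H\<^esub> g)) (rcoact \<Omega>H \<gamma>)
        = tensor_map K Forms H conn (\<lambda>h. h)
        (tensor_lift ?T (\<lambda>\<omega> g. pure_tensor K BHC H (pure_tensor K BH Coinv (pure_tensor K B H b h1) \<omega>) (h2 \<otimes>\<^bsub>H\<^esub> g)) (coinv_rcoact K H \<Omega>H \<gamma>))" ..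
    qed simp
    also have "\<dots> = tensor_map K Forms H conn (\<lambda>h. h) (tensor_lift ?T (\<lambda>h1 h2.
        tensor_lift ?T (\<lambda>\<omega> g. pure_tensor K BHC H (pure_tensor K BH Coinv (pure_tensor K B H b h1) \<omega>) (h2 \<otimes>\<^bsub>H\<^esub> g)) (coinv_rcoact K H \<Omega>H \<gamma>)) (comult H h))"
      by (rule linear_lift_comult[OF conn, symmetric]) (auto intro!: tensor_lift_closed[OF coinv_rcoact_closed])
    also have "tensor_lift ?T (\<lambda>h1 h2.
        tensor_lift ?T (\<lambda>\<omega> g. pure_tensor K BHC H (pure_tensor K BH Coinv (pure_tensor K B H b h1) \<omega>) (h2 \<otimes>\<^bsub>H\<^esub> g)) (coinv_rcoact K H \<Omega>H \<gamma>)) (comult H h)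
      = tensor_lift ?T (\<lambda>a0 a1. tensor_lift ?T (\<lambda>\<omega> g. pure_tensor K BHC H (pure_tensor K BH Coinv a0 \<omega>) (a1 \<otimes>\<^bsub>H\<^esub> g)) (coinv_rcoact K H \<Omega>H \<gamma>)) (coA (pure_tensor K B H b h))"
      by (rule lift_crossed_coact_pure[symmetric]) (rule conn_linear coinv_rcoact_closed | (simp; fail))+
    also have "\<dots> = diagonal_coact K H \<Omega>H BH coA (pure_tensor K BH Coinv (pure_tensor K B H b h) \<gamma>)"
      unfolding diagonal_coact_def Let_def
      by (rule tensor_lift_pure[symmetric])
         (rule conn_linear linear_map_comp[OF crossed_coact_linear] crossed_coact_closed coinv_rcoact_closed
            linear_map_comp[OF coinv_rcoact_linear] | (simp; fail))+
    finally show "?co (mult_map (pure_tensor K BH Coinv (pure_tensor K B H b h) \<gamma>))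
      = tensor_map K Forms H conn (\<lambda>h. h) (diagonal_coact K H \<Omega>H BH coA (pure_tensor K BH Coinv (pure_tensor K B H b h) \<gamma>))" .
  qed (rule conn_linear | (simp; fail))+
  thus ?thesis using t by (simp add: conn_def coact_zero_hor)
qed

section \<open>Generation by differentials\<close>

lemma act_one_left: "b \<in> carrier B \<Longrightarrow> b' \<in> carrier B \<Longrightarrow> h \<in> carrier H \<Longrightarrow>
    b \<otimes>\<^bsub>B\<^esub> act \<one>\<^bsub>H\<^esub> b' \<otimes>\<^bsub>B\<^esub> \<sigma> (pure_tensor K H H \<one>\<^bsub>H\<^esub> h) = counit H h \<odot>\<^bsub>B\<^esub> (b \<otimes>\<^bsub>B\<^esub> b')"
  by (simp add: act_one \<sigma>_one_left B.smult_mult_right[symmetric])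

lemma lact_ver_base:
  assumes [simp]: "b \<in> carrier B" "b' \<in> carrier B" "\<gamma> \<in> carrier \<Omega>H"
  shows "lact_ver (pure_tensor K B H b \<one>\<^bsub>H\<^esub>) (pure_tensor K B \<Omega>H b' \<gamma>) = pure_tensor K B \<Omega>H (b \<otimes>\<^bsub>B\<^esub> b') \<gamma>"
proof -
  let ?G = "\<lambda>p1 p2 p3 g \<omega>. pure_tensor K B \<Omega>H (b \<otimes>\<^bsub>B\<^esub> act p1 b' \<otimes>\<^bsub>B\<^esub> \<sigma> (pure_tensor K H H p2 g)) (lact \<Omega>H p3 \<omega>)"
  have "lact_ver (pure_tensor K B H b \<one>\<^bsub>H\<^esub>) (pure_tensor K B \<Omega>H b' \<gamma>)
    = tensor_lift Ver (\<lambda>u p3. tensor_lift Ver (\<lambda>p1 p2. tensor_lift Ver (?G p1 p2 p3) (lcoact \<Omega>H \<gamma>)) (comult H u)) (comult H \<one>\<^bsub>H\<^esub>)"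
    by (simp add: lact_ver_pure)
  also have "\<dots> = tensor_lift Ver (\<lambda>p1 p2. tensor_lift Ver (?G p1 p2 \<one>\<^bsub>H\<^esub>) (lcoact \<Omega>H \<gamma>)) (comult H \<one>\<^bsub>H\<^esub>)"
    by (rule lift_comult_one) (rule conn_linear | (simp; fail))+
  also have "\<dots> = tensor_lift Ver (?G \<one>\<^bsub>H\<^esub> \<one>\<^bsub>H\<^esub> \<one>\<^bsub>H\<^esub>) (lcoact \<Omega>H \<gamma>)"
    by (rule lift_comult_one) (rule conn_linear | (simp; fail))+
  also have "\<dots> = tensor_lift Ver (\<lambda>g \<omega>. counit H g \<odot>\<^bsub>Ver\<^esub> pure_tensor K B \<Omega>H (b \<otimes>\<^bsub>B\<^esub> b') \<omega>) (lcoact \<Omega>H \<gamma>)"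
  proof (rule lift_lcoact_cong)
    fix g \<omega> assume g: "g \<in> carrier H" "\<omega> \<in> carrier \<Omega>H"
    have "linear_map K B Ver (\<lambda>c. pure_tensor K B \<Omega>H c \<omega>)"
      by (rule conn_linear | (simp add: g; fail))+
    from linear_map_smult[OF this, of "counit H g" "b \<otimes>\<^bsub>B\<^esub> b'"] g
    show "?G \<one>\<^bsub>H\<^esub> \<one>\<^bsub>H\<^esub> \<one>\<^bsub>H\<^esub> g \<omega> = counit H g \<odot>\<^bsub>Ver\<^esub> pure_tensor K B \<Omega>H (b \<otimes>\<^bsub>B\<^esub> b') \<omega>"
      by (simp add: act_one_left calc.lact_one)
  qed simp
  also have "\<dots> = pure_tensor K B \<Omega>H (b \<otimes>\<^bsub>B\<^esub> b') \<gamma>"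
    by (rule lcoact_counit_lift) (rule conn_linear | (simp; fail))+
  finally show ?thesis .
qed

text \<open>The formula is restricted to exact forms, where \<open>1 \<cdot> db' = d(1 \<cdot> b') = db'\<close>.\<close>

lemma lact_hor_base_diff:
  assumes [simp]: "b \<in> carrier B" "b' \<in> carrier B" "h \<in> carrier H"
  shows "lact_hor (pure_tensor K B H b \<one>\<^bsub>H\<^esub>) (pure_tensor K \<Omega>B H (diff \<Omega>B b') h) = pure_tensor K \<Omega>B H (lact \<Omega>B b (diff \<Omega>B b')) h"
proof -
  let ?d = "diff \<Omega>B b'"
  let ?G = "\<lambda>p1 p2 p3 q1 q2. pure_tensor K \<Omega>B H (ract \<Omega>B (lact \<Omega>B b (actf p1 ?d)) (\<sigma> (pure_tensor K H H p2 q1))) (p3 \<otimes>\<^bsub>H\<^esub> q2)"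
  have "lact_hor (pure_tensor K B H b \<one>\<^bsub>H\<^esub>) (pure_tensor K \<Omega>B H ?d h)
    = tensor_lift Hor (\<lambda>u p3. tensor_lift Hor (\<lambda>p1 p2. tensor_lift Hor (?G p1 p2 p3) (comult H h)) (comult H u)) (comult H \<one>\<^bsub>H\<^esub>)"
    by (simp add: lact_hor_pure)
  also have "\<dots> = tensor_lift Hor (\<lambda>p1 p2. tensor_lift Hor (?G p1 p2 \<one>\<^bsub>H\<^esub>) (comult H h)) (comult H \<one>\<^bsub>H\<^esub>)"
    by (rule lift_comult_one) (rule conn_linear | (simp; fail))+
  also have "\<dots> = tensor_lift Hor (?G \<one>\<^bsub>H\<^esub> \<one>\<^bsub>H\<^esub> \<one>\<^bsub>H\<^esub>) (comult H h)"
    by (rule lift_comult_one) (rule conn_linear | (simp; fail))+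
  also have "\<dots> = tensor_lift Hor (\<lambda>g \<omega>. counit H g \<odot>\<^bsub>Hor\<^esub> pure_tensor K \<Omega>B H (lact \<Omega>B b ?d) \<omega>) (comult H h)"
  proof (rule lift_comult_cong)
    fix g \<omega> assume g: "g \<in> carrier H" "\<omega> \<in> carrier H"
    have 1: "linear_map K B Hor (\<lambda>c. pure_tensor K \<Omega>B H (ract \<Omega>B (lact \<Omega>B b ?d) c) \<omega>)"
      by (rule conn_linear | (simp add: g; fail))+
    show "?G \<one>\<^bsub>H\<^esub> \<one>\<^bsub>H\<^esub> \<one>\<^bsub>H\<^esub> g \<omega> = counit H g \<odot>\<^bsub>Hor\<^esub> pure_tensor K \<Omega>B H (lact \<Omega>B b ?d) \<omega>"
      using g linear_map_smult[OF 1, of "counit H g" "\<one>\<^bsub>B\<^esub>"]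
      by (simp add: diff_act[symmetric] act_one \<sigma>_one_left calcB.ract_one)
  qed simp
  also have "\<dots> = pure_tensor K \<Omega>B H (lact \<Omega>B b ?d) h"
    by (rule counit_left_lift) (rule conn_linear | (simp; fail))+
  finally show ?thesis .
qed

lemma ract_hor_base:
  assumes [simp]: "\<beta> \<in> carrier \<Omega>B" "h \<in> carrier H"
  shows "ract_hor (pure_tensor K \<Omega>B H \<beta> \<one>\<^bsub>H\<^esub>) (pure_tensor K B H \<one>\<^bsub>B\<^esub> h) = pure_tensor K \<Omega>B H \<beta> h"
proof -
  let ?G = "\<lambda>p1 p2 p3 q1 q2. pure_tensor K \<Omega>B H (ract \<Omega>B \<beta> (act p1 \<one>\<^bsub>B\<^esub> \<otimes>\<^bsub>B\<^esub> \<sigma> (pure_tensor K H H p2 q1))) (p3 \<otimes>\<^bsub>H\<^esub> q2)"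
  have "ract_hor (pure_tensor K \<Omega>B H \<beta> \<one>\<^bsub>H\<^esub>) (pure_tensor K B H \<one>\<^bsub>B\<^esub> h)
    = tensor_lift Hor (\<lambda>u p3. tensor_lift Hor (\<lambda>p1 p2. tensor_lift Hor (?G p1 p2 p3) (comult H h)) (comult H u)) (comult H \<one>\<^bsub>H\<^esub>)"
    by (simp add: ract_hor_pure)
  also have "\<dots> = tensor_lift Hor (\<lambda>p1 p2. tensor_lift Hor (?G p1 p2 \<one>\<^bsub>H\<^esub>) (comult H h)) (comult H \<one>\<^bsub>H\<^esub>)"
    by (rule lift_comult_one) (rule conn_linear | (simp; fail))+
  also have "\<dots> = tensor_lift Hor (?G \<one>\<^bsub>H\<^esub> \<one>\<^bsub>H\<^esub> \<one>\<^bsub>H\<^esub>) (comult H h)"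
    by (rule lift_comult_one) (rule conn_linear | (simp; fail))+
  also have "\<dots> = tensor_lift Hor (\<lambda>g \<omega>. counit H g \<odot>\<^bsub>Hor\<^esub> pure_tensor K \<Omega>B H \<beta> \<omega>) (comult H h)"
  proof (rule lift_comult_cong)
    fix g \<omega> assume g: "g \<in> carrier H" "\<omega> \<in> carrier H"
    have 1: "linear_map K B Hor (\<lambda>c. pure_tensor K \<Omega>B H (ract \<Omega>B \<beta> c) \<omega>)"
      by (rule conn_linear | (simp add: g; fail))+
    show "?G \<one>\<^bsub>H\<^esub> \<one>\<^bsub>H\<^esub> \<one>\<^bsub>H\<^esub> g \<omega> = counit H g \<odot>\<^bsub>Hor\<^esub> pure_tensor K \<Omega>B H \<beta> \<omega>"
      using g linear_map_smult[OF 1, of "counit H g" "\<one>\<^bsub>B\<^esub>"]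
      by (simp add: act_one \<sigma>_one_left calcB.ract_one)
  qed simp
  also have "\<dots> = pure_tensor K \<Omega>B H \<beta> h"
    by (rule counit_left_lift) (rule conn_linear | (simp; fail))+
  finally show ?thesis .
qed

lemma lact_ver_one:
  assumes [simp]: "c \<in> carrier B" "x \<in> carrier H" "\<gamma> \<in> carrier \<Omega>H"
  shows "lact_ver (pure_tensor K B H c x) (pure_tensor K B \<Omega>H \<one>\<^bsub>B\<^esub> \<gamma>) =
    tensor_lift Ver (\<lambda>p q. tensor_lift Ver (\<lambda>g \<omega>.
      pure_tensor K B \<Omega>H (c \<otimes>\<^bsub>B\<^esub> \<sigma> (pure_tensor K H H p g)) (lact \<Omega>H q \<omega>)) (lcoact \<Omega>H \<gamma>)) (comult H x)"
proof -
  let ?F = "\<lambda>p q. tensor_lift Ver (\<lambda>g \<omega>.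
      pure_tensor K B \<Omega>H (c \<otimes>\<^bsub>B\<^esub> \<sigma> (pure_tensor K H H p g)) (lact \<Omega>H q \<omega>)) (lcoact \<Omega>H \<gamma>)"
  let ?G = "\<lambda>p1 p2 p3 g \<omega>. pure_tensor K B \<Omega>H (c \<otimes>\<^bsub>B\<^esub> act p1 \<one>\<^bsub>B\<^esub> \<otimes>\<^bsub>B\<^esub> \<sigma> (pure_tensor K H H p2 g)) (lact \<Omega>H p3 \<omega>)"
  have "lact_ver (pure_tensor K B H c x) (pure_tensor K B \<Omega>H \<one>\<^bsub>B\<^esub> \<gamma>)
    = tensor_lift Ver (\<lambda>u p3. tensor_lift Ver (\<lambda>p1 p2. tensor_lift Ver (?G p1 p2 p3) (lcoact \<Omega>H \<gamma>)) (comult H u)) (comult H x)"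
    by (simp add: lact_ver_pure)
  also have "\<dots> = tensor_lift Ver ?F (comult H x)"
  proof (rule lift_comult_cong)
    fix u p3 assume u [simp]: "u \<in> carrier H" "p3 \<in> carrier H"
    have "tensor_lift Ver (\<lambda>p1 p2. tensor_lift Ver (?G p1 p2 p3) (lcoact \<Omega>H \<gamma>)) (comult H u)
      = tensor_lift Ver (\<lambda>p1 p2. counit H p1 \<odot>\<^bsub>Ver\<^esub> ?F p2 p3) (comult H u)"
    proof (rule lift_comult_cong)
      fix p1 p2 assume p [simp]: "p1 \<in> carrier H" "p2 \<in> carrier H"
      have 1: "linear_map K B Ver (\<lambda>d. tensor_lift Ver (\<lambda>g \<omega>.
          pure_tensor K B \<Omega>H (d \<otimes>\<^bsub>B\<^esub> \<sigma> (pure_tensor K H H p2 g)) (lact \<Omega>H p3 \<omega>)) (lcoact \<Omega>H \<gamma>))"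
        by (rule conn_linear | (simp; fail))+
      show "tensor_lift Ver (?G p1 p2 p3) (lcoact \<Omega>H \<gamma>) = counit H p1 \<odot>\<^bsub>Ver\<^esub> ?F p2 p3"
        using linear_map_smult[OF 1, of "counit H p1" c]
        by (simp add: act_unit B.smult_mult_right[symmetric])
    qed simp
    also have "\<dots> = ?F u p3"
      by (rule counit_left_lift) (rule conn_linear | (simp; fail))+
    finally show "tensor_lift Ver (\<lambda>p1 p2. tensor_lift Ver (?G p1 p2 p3) (lcoact \<Omega>H \<gamma>)) (comult H u) = ?F u p3" .
  qed simp
  finally show ?thesis .
qed

text \<open>By coassociativity in \<open>h\<close> and in \<open>h'\<close> the left-hand side is
  \<open>b \<sigma>\<^sup>-\<^sup>1(h'\<^sub>1 \<otimes> h\<^sub>1) \<sigma>(h'\<^sub>2 \<otimes> h\<^sub>2) \<otimes> h'\<^sub>3 dh\<^sub>3\<close>.\<close>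

lemma vertical_generator:
  assumes [simp]: "b \<in> carrier B" "h' \<in> carrier H" "h \<in> carrier H"
  shows "tensor_lift Ver (\<lambda>x1 x2. tensor_lift Ver (\<lambda>y1 y2.
      lact_ver (pure_tensor K B H (b \<otimes>\<^bsub>B\<^esub> \<sigma>' (pure_tensor K H H x1 y1)) x2) (pure_tensor K B \<Omega>H \<one>\<^bsub>B\<^esub> (diff \<Omega>H y2)))
      (comult H h)) (comult H h')
    = pure_tensor K B \<Omega>H b (lact \<Omega>H h' (diff \<Omega>H h))"
proof -
  let ?F = "\<lambda>x1 y1 p r q s. pure_tensor K B \<Omega>H (b \<otimes>\<^bsub>B\<^esub> \<sigma>' (pure_tensor K H H x1 y1) \<otimes>\<^bsub>B\<^esub> \<sigma> (pure_tensor K H H p r)) (lact \<Omega>H q (diff \<Omega>H s))"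
  have "tensor_lift Ver (\<lambda>x1 x2. tensor_lift Ver (\<lambda>y1 y2.
      lact_ver (pure_tensor K B H (b \<otimes>\<^bsub>B\<^esub> \<sigma>' (pure_tensor K H H x1 y1)) x2) (pure_tensor K B \<Omega>H \<one>\<^bsub>B\<^esub> (diff \<Omega>H y2)))
      (comult H h)) (comult H h')
    = tensor_lift Ver (\<lambda>x1 x2. tensor_lift Ver (\<lambda>y1 y2. tensor_lift Ver (\<lambda>p q. tensor_lift Ver (\<lambda>r s.
        ?F x1 y1 p r q s) (comult H y2)) (comult H x2)) (comult H h)) (comult H h')"
  proof (rule lift_comult_cong, simp, rule lift_comult_cong, simp)
    fix x1 x2 y1 y2 assume x [simp]: "x1 \<in> carrier H" "x2 \<in> carrier H" "y1 \<in> carrier H" "y2 \<in> carrier H"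
    show "lact_ver (pure_tensor K B H (b \<otimes>\<^bsub>B\<^esub> \<sigma>' (pure_tensor K H H x1 y1)) x2) (pure_tensor K B \<Omega>H \<one>\<^bsub>B\<^esub> (diff \<Omega>H y2))
      = tensor_lift Ver (\<lambda>p q. tensor_lift Ver (\<lambda>r s. ?F x1 y1 p r q s) (comult H y2)) (comult H x2)"
    proof (subst lact_ver_one, simp, simp, simp, rule lift_comult_cong, simp)
      fix p q assume p [simp]: "p \<in> carrier H" "q \<in> carrier H"
      show "tensor_lift Ver (\<lambda>g \<omega>. pure_tensor K B \<Omega>H (b \<otimes>\<^bsub>B\<^esub> \<sigma>' (pure_tensor K H H x1 y1) \<otimes>\<^bsub>B\<^esub> \<sigma> (pure_tensor K H H p g)) (lact \<Omega>H q \<omega>)) (lcoact \<Omega>H (diff \<Omega>H y2))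
        = tensor_lift Ver (\<lambda>r s. ?F x1 y1 p r q s) (comult H y2)"
        by (rule lift_lcoact_diff) (rule conn_linear | (simp; fail))+
    qed
  qed
  also have "\<dots> = tensor_lift Ver (\<lambda>x1 x2. tensor_lift Ver (\<lambda>p q. tensor_lift Ver (\<lambda>y1 y2. tensor_lift Ver (\<lambda>r s.
        ?F x1 y1 p r q s) (comult H y2)) (comult H h)) (comult H x2)) (comult H h')"
    by (rule lift_comult_cong, simp, rule tensor_lift_swap[where K = K and M = H and N = H and M' = H and N' = H]) auto
  also have "\<dots> = tensor_lift Ver (\<lambda>x1 x2. tensor_lift Ver (\<lambda>p q. tensor_lift Ver (\<lambda>v s. tensor_lift Ver (\<lambda>y1 r.
        ?F x1 y1 p r q s) (comult H v)) (comult H h)) (comult H x2)) (comult H h')"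
  proof (rule lift_comult_cong, simp, rule lift_comult_cong, simp)
    fix x1 x2 p q assume [simp]: "x1 \<in> carrier H" "x2 \<in> carrier H" "p \<in> carrier H" "q \<in> carrier H"
    show "tensor_lift Ver (\<lambda>y1 y2. tensor_lift Ver (\<lambda>r s. ?F x1 y1 p r q s) (comult H y2)) (comult H h)
      = tensor_lift Ver (\<lambda>v s. tensor_lift Ver (\<lambda>y1 r. ?F x1 y1 p r q s) (comult H v)) (comult H h)"
      by (rule coassoc_lift[symmetric]) (rule conn_linear | (simp; fail))+
  qed
  also have "\<dots> = tensor_lift Ver (\<lambda>u q. tensor_lift Ver (\<lambda>x1 p. tensor_lift Ver (\<lambda>v s. tensor_lift Ver (\<lambda>y1 r.
        ?F x1 y1 p r q s) (comult H v)) (comult H h)) (comult H u)) (comult H h')"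
    by (rule coassoc_lift[symmetric]) (rule conn_linear | (simp; fail))+
  also have "\<dots> = tensor_lift Ver (\<lambda>u q. tensor_lift Ver (\<lambda>v s. tensor_lift Ver (\<lambda>x1 p. tensor_lift Ver (\<lambda>y1 r.
        ?F x1 y1 p r q s) (comult H v)) (comult H u)) (comult H h)) (comult H h')"
    by (rule lift_comult_cong, simp, rule tensor_lift_swap[where K = K and M = H and N = H and M' = H and N' = H]) auto
  also have "\<dots> = tensor_lift Ver (\<lambda>u q. tensor_lift Ver (\<lambda>v s.
      counit H u \<odot>\<^bsub>Ver\<^esub> (counit H v \<odot>\<^bsub>Ver\<^esub> pure_tensor K B \<Omega>H b (lact \<Omega>H q (diff \<Omega>H s)))) (comult H h)) (comult H h')"
  proof (rule lift_comult_cong, simp, rule lift_comult_cong, simp)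
    fix u q v s assume [simp]: "u \<in> carrier H" "q \<in> carrier H" "v \<in> carrier H" "s \<in> carrier H"
    interpret Ver: kspace K Ver by auto
    have \<phi>: "linear_map K B Ver (\<lambda>c. pure_tensor K B \<Omega>H (b \<otimes>\<^bsub>B\<^esub> c) (lact \<Omega>H q (diff \<Omega>H s)))"
      by (rule conn_linear | (simp; fail))+
    have "tensor_lift Ver (\<lambda>x1 p. tensor_lift Ver (\<lambda>y1 r. ?F x1 y1 p r q s) (comult H v)) (comult H u)
      = tensor_lift Ver (\<lambda>x1 p. pure_tensor K B \<Omega>H (b \<otimes>\<^bsub>B\<^esub> tensor_lift B (\<lambda>y1 r.
          \<sigma>' (pure_tensor K H H x1 y1) \<otimes>\<^bsub>B\<^esub> \<sigma> (pure_tensor K H H p r)) (comult H v)) (lact \<Omega>H q (diff \<Omega>H s))) (comult H u)"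
      by (rule lift_comult_cong, simp, subst linear_lift_comult[OF \<phi>], simp, simp, simp, simp,
          rule lift_comult_cong, simp, simp add: B.m_assoc)
    also have "\<dots> = pure_tensor K B \<Omega>H (b \<otimes>\<^bsub>B\<^esub> tensor_lift B (\<lambda>x1 p. tensor_lift B (\<lambda>y1 r.
          \<sigma>' (pure_tensor K H H x1 y1) \<otimes>\<^bsub>B\<^esub> \<sigma> (pure_tensor K H H p r)) (comult H v)) (comult H u)) (lact \<Omega>H q (diff \<Omega>H s))"
      by (rule linear_lift_comult[OF \<phi>, symmetric]) auto
    also have "\<dots> = (counit H u \<otimes>\<^bsub>K\<^esub> counit H v) \<odot>\<^bsub>Ver\<^esub> pure_tensor K B \<Omega>H b (lact \<Omega>H q (diff \<Omega>H s))"
      using linear_map_smult[OF \<phi>, of "counit H u \<otimes>\<^bsub>K\<^esub> counit H v" "\<one>\<^bsub>B\<^esub>"] by (simp add: \<sigma>'_\<sigma>)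
    finally show "tensor_lift Ver (\<lambda>x1 p. tensor_lift Ver (\<lambda>y1 r. ?F x1 y1 p r q s) (comult H v)) (comult H u)
      = counit H u \<odot>\<^bsub>Ver\<^esub> (counit H v \<odot>\<^bsub>Ver\<^esub> pure_tensor K B \<Omega>H b (lact \<Omega>H q (diff \<Omega>H s)))"
      by (simp add: Ver.smult_assoc1)
  qed
  also have "\<dots> = tensor_lift Ver (\<lambda>u q. counit H u \<odot>\<^bsub>Ver\<^esub> pure_tensor K B \<Omega>H b (lact \<Omega>H q (diff \<Omega>H h))) (comult H h')"
  proof (rule lift_comult_cong, simp)
    fix u q assume [simp]: "u \<in> carrier H" "q \<in> carrier H"
    show "tensor_lift Ver (\<lambda>v s. counit H u \<odot>\<^bsub>Ver\<^esub> (counit H v \<odot>\<^bsub>Ver\<^esub> pure_tensor K B \<Omega>H b (lact \<Omega>H q (diff \<Omega>H s)))) (comult H h)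
      = counit H u \<odot>\<^bsub>Ver\<^esub> pure_tensor K B \<Omega>H b (lact \<Omega>H q (diff \<Omega>H h))"
    proof -
      interpret Ver: kspace K Ver by auto
      have 1: "linear_map K Ver Ver (\<lambda>t. counit H u \<odot>\<^bsub>Ver\<^esub> t)" by (rule conn_linear | (simp; fail))+
      have "tensor_lift Ver (\<lambda>v s. counit H v \<odot>\<^bsub>Ver\<^esub> pure_tensor K B \<Omega>H b (lact \<Omega>H q (diff \<Omega>H s))) (comult H h)
        = pure_tensor K B \<Omega>H b (lact \<Omega>H q (diff \<Omega>H h))"
        by (rule counit_left_lift) (rule conn_linear | (simp; fail))+
      thus ?thesis by (subst linear_lift_comult[OF 1, symmetric]) auto
    qed
  qed
  also have "\<dots> = pure_tensor K B \<Omega>H b (lact \<Omega>H h' (diff \<Omega>H h))"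
    by (rule counit_left_lift) (rule conn_linear | (simp; fail))+
  finally show ?thesis .
qed

lemma diff_one: "diff \<Omega>B \<one>\<^bsub>B\<^esub> = \<zero>\<^bsub>\<Omega>B\<^esub>"
proof -
  have "diff \<Omega>B \<one>\<^bsub>B\<^esub> = diff \<Omega>B \<one>\<^bsub>B\<^esub> \<oplus>\<^bsub>\<Omega>B\<^esub> diff \<Omega>B \<one>\<^bsub>B\<^esub>"
    using calcB.diff_Leibniz[of "\<one>\<^bsub>B\<^esub>" "\<one>\<^bsub>B\<^esub>"] by (simp add: calcB.ract_one calcB.lact_one)
  thus ?thesis using calcB.\<Gamma>.add.r_cancel_one' by (metis B.one_closed crossed_closed(7))
qed

lemma linear_embed_hor: "linear_map K Hor Forms (\<lambda>t. (t, \<zero>\<^bsub>Ver\<^esub>))"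
  by (rule conn_linear | (simp; fail))+

lemma linear_embed_ver: "linear_map K Ver Forms (\<lambda>u. (\<zero>\<^bsub>Hor\<^esub>, u))"
  by (rule conn_linear | (simp; fail))+

text \<open>The horizontal part of \<open>a d(1 \<otimes> h)\<close> vanishes because \<open>d1 = 0\<close> in \<open>\<Omega>(B)\<close>, so \<open>vertical_generator\<close> puts the forms
  \<open>b \<otimes> h' dh\<close> into \<open>N\<close>, and with them all vertical forms.  Subtracting the vertical part from
  \<open>(b \<otimes> 1) d(b' \<otimes> h) = b db' \<otimes> h + b b' \<otimes> dh\<close> then gives the horizontal forms.\<close>

lemma forms_generated:
  assumes N: "submodule N K Forms"
    and gen: "\<And>a a'. \<lbrakk>a \<in> carrier BH; a' \<in> carrier BH\<rbrakk> \<Longrightarrow> (lact_hor a (diffA_hor a'), lact_ver a (diffA_ver a')) \<in> N"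
    and \<omega>: "\<omega> \<in> carrier Forms"
  shows "\<omega> \<in> N"
proof -
  interpret F: kspace K Forms by auto
  interpret Hor: kspace K Hor by auto
  interpret Ver: kspace K Ver by auto
  note E = F.submoduleE[OF N]
  have dzero: "pure_tensor K \<Omega>B H \<zero>\<^bsub>\<Omega>B\<^esub> h = \<zero>\<^bsub>Hor\<^esub>" if [simp]: "h \<in> carrier H" for h
  proof -
    have "linear_map K \<Omega>B Hor (\<lambda>\<beta>. pure_tensor K \<Omega>B H \<beta> h)" by (rule conn_linear | (simp; fail))+
    from linear_map_zero[OF _ _ this] show ?thesis by simp
  qed
  have exact_ver: "(\<zero>\<^bsub>Hor\<^esub>, pure_tensor K B \<Omega>H b (lact \<Omega>H h' (diff \<Omega>H h))) \<in> N"
    if [simp]: "b \<in> carrier B" "h' \<in> carrier H" "h \<in> carrier H" for b h' h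
  proof -
    let ?L = "\<lambda>x1 x2 y1 y2. lact_ver (pure_tensor K B H (b \<otimes>\<^bsub>B\<^esub> \<sigma>' (pure_tensor K H H x1 y1)) x2) (pure_tensor K B \<Omega>H \<one>\<^bsub>B\<^esub> (diff \<Omega>H y2))"
    have "(\<zero>\<^bsub>Hor\<^esub>, tensor_lift Ver (\<lambda>x1 x2. tensor_lift Ver (\<lambda>y1 y2. ?L x1 x2 y1 y2) (comult H h)) (comult H h'))
      = tensor_lift Forms (\<lambda>x1 x2. (\<zero>\<^bsub>Hor\<^esub>, tensor_lift Ver (\<lambda>y1 y2. ?L x1 x2 y1 y2) (comult H h))) (comult H h')"
      by (rule linear_lift_comult[OF linear_embed_ver]) auto
    also have "\<dots> = tensor_lift Forms (\<lambda>x1 x2. tensor_lift Forms (\<lambda>y1 y2. (\<zero>\<^bsub>Hor\<^esub>, ?L x1 x2 y1 y2)) (comult H h)) (comult H h')"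
      by (rule lift_comult_cong, simp, rule linear_lift_comult[OF linear_embed_ver]) auto
    \<comment> \<open>Each summand is a form \<open>a d(1 \<otimes> y\<^sub>2)\<close>.\<close>
    also have "\<dots> \<in> N"
    proof (rule tensor_lift_in_submodule[OF comult_closed _ _ N], simp, simp, simp,
        rule tensor_lift_in_submodule[OF comult_closed _ _ N], simp, simp, simp)
      fix x1 x2 y1 y2 assume [simp]: "x1 \<in> carrier H" "x2 \<in> carrier H" "y1 \<in> carrier H" "y2 \<in> carrier H"
      show "(\<zero>\<^bsub>Hor\<^esub>, ?L x1 x2 y1 y2) \<in> N"
        using gen[of "pure_tensor K B H (b \<otimes>\<^bsub>B\<^esub> \<sigma>' (pure_tensor K H H x1 y1)) x2" "pure_tensor K B H \<one>\<^bsub>B\<^esub> y2"]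
        by (simp add: dzero diff_one diffA_pure actions_zero)
    qed
    finally show ?thesis by (simp add: vertical_generator)
  qed
  have pure_ver: "(\<zero>\<^bsub>Hor\<^esub>, pure_tensor K B \<Omega>H b \<gamma>) \<in> N" if b: "b \<in> carrier B" and g: "\<gamma> \<in> carrier \<Omega>H" for b \<gamma>
  proof -
    let ?M = "{\<gamma> \<in> carrier \<Omega>H. \<forall>b\<in>carrier B. (\<zero>\<^bsub>Hor\<^esub>, pure_tensor K B \<Omega>H b \<gamma>) \<in> N}"
    have sub: "submodule ?M K \<Omega>H"
      by (rule linear_preimage_submodule[OF _ _ N]) (rule conn_linear | (simp; fail))+
    have "\<gamma> \<in> ?M" by (rule kspan_subset[OF sub]) (use exact_ver g calc.diff_span in auto)
    thus ?thesis using b by auto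
  qed
  have ver: "(\<zero>\<^bsub>Hor\<^esub>, u) \<in> N" if u: "u \<in> carrier Ver" for u
  proof -
    have "(\<zero>\<^bsub>Hor\<^esub>, u) = tensor_lift Forms (\<lambda>b \<gamma>. (\<zero>\<^bsub>Hor\<^esub>, pure_tensor K B \<Omega>H b \<gamma>)) u"
      by (rule linear_map_eq_tensor_lift[OF _ _ _ u linear_embed_ver]) auto
    also have "\<dots> \<in> N" by (rule tensor_lift_in_submodule[OF u _ _ N]) (auto intro: pure_ver)
    finally show ?thesis .
  qed
  have exact_hor: "(pure_tensor K \<Omega>B H (lact \<Omega>B b (diff \<Omega>B b')) h, \<zero>\<^bsub>Ver\<^esub>) \<in> N"
    if [simp]: "b \<in> carrier B" "b' \<in> carrier B" "h \<in> carrier H" for b b' h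
  proof -
    let ?Z = "(pure_tensor K \<Omega>B H (lact \<Omega>B b (diff \<Omega>B b')) h, \<zero>\<^bsub>Ver\<^esub>)"
    let ?Y = "(\<zero>\<^bsub>Hor\<^esub>, pure_tensor K B \<Omega>H (b \<otimes>\<^bsub>B\<^esub> b') (diff \<Omega>H h))"
    have mem: "?Z \<in> carrier Forms" "?Y \<in> carrier Forms" by simp_all
    \<comment> \<open>\<open>?Z \<oplus> ?Y\<close> is \<open>(b \<otimes> 1) d(b' \<otimes> h)\<close>.\<close>
    have "?Z \<oplus>\<^bsub>Forms\<^esub> ?Y \<in> N"
      using gen[of "pure_tensor K B H b \<one>\<^bsub>H\<^esub>" "pure_tensor K B H b' h"]
      by (simp add: diffA_pure lact_ver_base lact_hor_base_diff)
    moreover have "?Y \<in> N" by (rule pure_ver) auto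
    ultimately have "(?Z \<oplus>\<^bsub>Forms\<^esub> ?Y) \<oplus>\<^bsub>Forms\<^esub> (\<ominus>\<^bsub>Forms\<^esub> ?Y) \<in> N" using E(3,5) by blast
    also have "(?Z \<oplus>\<^bsub>Forms\<^esub> ?Y) \<oplus>\<^bsub>Forms\<^esub> (\<ominus>\<^bsub>Forms\<^esub> ?Y) = ?Z"
      using mem by (simp add: F.a_assoc F.r_neg del: Forms_ops)
    finally show ?thesis .
  qed
  have pure_hor: "(pure_tensor K \<Omega>B H \<beta> h, \<zero>\<^bsub>Ver\<^esub>) \<in> N" if b: "\<beta> \<in> carrier \<Omega>B" and h: "h \<in> carrier H" for \<beta> h
  proof -
    let ?M = "{\<beta> \<in> carrier \<Omega>B. \<forall>h\<in>carrier H. (pure_tensor K \<Omega>B H \<beta> h, \<zero>\<^bsub>Ver\<^esub>) \<in> N}"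
    have sub: "submodule ?M K \<Omega>B"
      by (rule linear_preimage_submodule[OF _ _ N]) (rule conn_linear | (simp; fail))+
    have "\<beta> \<in> ?M" by (rule kspan_subset[OF sub]) (use exact_hor b calcB.diff_span in auto)
    thus ?thesis using h by auto
  qed
  have hor: "(t, \<zero>\<^bsub>Ver\<^esub>) \<in> N" if t: "t \<in> carrier Hor" for t
  proof -
    have "(t, \<zero>\<^bsub>Ver\<^esub>) = tensor_lift Forms (\<lambda>\<beta> h. (pure_tensor K \<Omega>B H \<beta> h, \<zero>\<^bsub>Ver\<^esub>)) t"
      by (rule linear_map_eq_tensor_lift[OF _ _ _ t linear_embed_hor]) auto
    also have "\<dots> \<in> N" by (rule tensor_lift_in_submodule[OF t _ _ N]) (auto intro: pure_hor)
    finally show ?thesis .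
  qed
  have "(fst \<omega>, \<zero>\<^bsub>Ver\<^esub>) \<oplus>\<^bsub>Forms\<^esub> (\<zero>\<^bsub>Hor\<^esub>, snd \<omega>) \<in> N"
    using \<omega> by (intro E(5) hor ver) auto
  thus ?thesis using \<omega> by auto
qed

text \<open>The equalizer of two linear maps is a subspace.\<close>

lemma linear_maps_eq_on_forms:
  assumes P: "kspace K P" and f: "linear_map K Forms P f" and g: "linear_map K Forms P g"
    and eq: "\<And>a a'. \<lbrakk>a \<in> carrier BH; a' \<in> carrier BH\<rbrakk> \<Longrightarrow>
      f (lact_hor a (diffA_hor a'), lact_ver a (diffA_ver a')) = g (lact_hor a (diffA_hor a'), lact_ver a (diffA_ver a'))"
    and \<omega>: "\<omega> \<in> carrier Forms"
  shows "f \<omega> = g \<omega>"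
proof -
  interpret F: kspace K Forms by auto
  interpret P: kspace K P by fact
  have z: "f \<zero>\<^bsub>Forms\<^esub> = \<zero>\<^bsub>P\<^esub>" "g \<zero>\<^bsub>Forms\<^esub> = \<zero>\<^bsub>P\<^esub>"
    by (rule linear_map_zero[OF F.kspace_axioms P.kspace_axioms f] linear_map_zero[OF F.kspace_axioms P.kspace_axioms g])+
  have "submodule {\<omega> \<in> carrier Forms. f \<omega> = g \<omega>} K Forms"
    by (rule submodule_kspaceI[OF F.kspace_axioms])
       (simp_all del: Forms_ops add: z linear_map_add[OF f] linear_map_add[OF g] linear_map_smult[OF f]
          linear_map_smult[OF g] Collect_mono)
  from forms_generated[OF this _ \<omega>] eq show ?thesis by simp
qed

section \<open>The vertical map\<close>

lemma crossed_diff_eq: "crossed_diff K H B \<Omega>H \<Omega>B a = (diffA_hor a, diffA_ver a)"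
  by (simp add: crossed_diff_def)

text \<open>\<open>split_map_vertical_value\<close> provides existence, \<open>linear_maps_eq_on_forms\<close> uniqueness; restriction to the carrier
  selects the representative that is \<open>undefined\<close> elsewhere.\<close>

lemma vertical_map_eq:
  assumes \<omega>: "\<omega> \<in> carrier Forms"
  shows "vertical_map K H \<Omega>H A coA \<Omega>A \<omega> = split_map (snd \<omega>)"
proof -
  let ?v = "restrict (\<lambda>\<omega>. split_map (snd \<omega>)) (carrier Forms)"
  let ?P = "\<lambda>v. v \<in> extensional (carrier Forms) \<and> linear_map K Forms BHC v \<and>
    (\<forall>a\<in>carrier BH. \<forall>a'\<in>carrier BH.
      v (lact_hor a (diffA_hor a'), lact_ver a (diffA_ver a')) = vertical_value a a')"
  interpret F: kspace K Forms by auto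
  have "linear_map K Forms BHC (\<lambda>\<omega>. split_map (snd \<omega>))"
    by (intro linear_map_comp[OF split_map_linear] linear_map_snd[OF linear_map_id])
  hence lin: "linear_map K Forms BHC ?v"
    by (subst linear_map_cong[where g = "\<lambda>\<omega>. split_map (snd \<omega>)"]) auto
  have P: "?P ?v" using lin by (simp add: split_map_vertical_value)
  have uniq: "v = ?v" if v: "?P v" for v
  proof (rule extensionalityI[of _ "carrier Forms"])
    fix \<omega> assume "\<omega> \<in> carrier Forms"
    thus "v \<omega> = ?v \<omega>"
      by (rule linear_maps_eq_on_forms[OF _ _ lin, rotated 3]) (use v P in auto)
  qed (use v in auto)
  have "vertical_map K H \<Omega>H A coA \<Omega>A = (THE v. ?P v)"
    unfolding vertical_map_def Let_def A_tensor A_ops \<Omega>A_ops linear_map_\<Omega>A crossed_lact_eq crossed_diff_eq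
      fst_conv snd_conv vertical_value_def ..
  also have "\<dots> = ?v" by (rule the_equality) (use P uniq in auto)
  finally show ?thesis using \<omega> by simp
qed

section \<open>The strong connection\<close>

text \<open>\<open>(\<beta> \<otimes> 1) (1 \<otimes> h) = \<beta> \<otimes> h\<close>.\<close>

lemma horizontal_in_span:
  assumes t: "t \<in> carrier Hor"
  shows "(t, \<zero>\<^bsub>Ver\<^esub>) \<in> kspan K \<Omega>A {ract \<Omega>A \<beta> a | \<beta> a. \<beta> \<in> base_forms K H B \<Omega>H \<Omega>B \<and> a \<in> carrier A}"
  unfolding kspan_def
proof safe
  fix N assume N: "submodule N K \<Omega>A"
    and sub: "{ract \<Omega>A \<beta> a | \<beta> a. \<beta> \<in> base_forms K H B \<Omega>H \<Omega>B \<and> a \<in> carrier A} \<subseteq> N"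
  have gen: "(pure_tensor K \<Omega>B H \<beta> h, \<zero>\<^bsub>Ver\<^esub>) \<in> N" if [simp]: "\<beta> \<in> carrier \<Omega>B" "h \<in> carrier H" for \<beta> h
  proof -
    have "ract \<Omega>A (pure_tensor K \<Omega>B H \<beta> \<one>\<^bsub>H\<^esub>, \<zero>\<^bsub>Ver\<^esub>) (pure_tensor K B H \<one>\<^bsub>B\<^esub> h) \<in> N"
    proof -
      have "(pure_tensor K \<Omega>B H \<beta> \<one>\<^bsub>H\<^esub>, \<zero>\<^bsub>Ver\<^esub>) \<in> base_forms K H B \<Omega>H \<Omega>B"
        by (simp add: base_forms_def)
      moreover have "pure_tensor K B H \<one>\<^bsub>B\<^esub> h \<in> carrier A" by (simp add: A_ops)
      ultimately show ?thesis using sub by blast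
    qed
    thus ?thesis by (simp add: \<Omega>A_ops crossed_ract_eq ract_hor_base actions_zero)
  qed
  have "(t, \<zero>\<^bsub>Ver\<^esub>) = tensor_lift Forms (\<lambda>\<beta> h. (pure_tensor K \<Omega>B H \<beta> h, \<zero>\<^bsub>Ver\<^esub>)) t"
    by (rule linear_map_eq_tensor_lift[OF _ _ _ t linear_embed_hor]) auto
  also have "\<dots> = tensor_lift \<Omega>A (\<lambda>\<beta> h. (pure_tensor K \<Omega>B H \<beta> h, \<zero>\<^bsub>Ver\<^esub>)) t"
    unfolding tensor_lift_def \<Omega>A_ops ..
  also have "\<dots> \<in> N" by (rule tensor_lift_in_submodule[OF t _ _ N]) (auto intro: gen)
  finally show "(t, \<zero>\<^bsub>Ver\<^esub>) \<in> N" .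
qed

lemma strong_connection_conn:
  "strong_connection K H \<Omega>H A coA \<Omega>A (crossed_calculus_coact K H B \<Omega>H \<Omega>B) (base_forms K H B \<Omega>H \<Omega>B) conn"
proof -
  interpret \<Omega>A: kspace K \<Omega>A by (rule kspace_\<Omega>A)
  interpret Hor: kspace K Hor by auto
  interpret Ver: kspace K Ver by auto
  have diag: "diagonal_coact K H \<Omega>H A coA = diagonal_coact K H \<Omega>H BH coA"
    unfolding diagonal_coact_def A_tensor ..
  have "connection K H \<Omega>H A coA \<Omega>A (crossed_calculus_coact K H B \<Omega>H \<Omega>B) conn"
    unfolding connection_def Let_def A_tensor \<Omega>A_tensor A_ops linear_map_\<Omega>A diag
  proof (intro conjI ballI)
    fix a t assume "a \<in> carrier BH" "t \<in> carrier BHC"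
    thus "conn (tensor_map K BH Coinv (mulA a) (\<lambda>\<gamma>. \<gamma>) t) = lact \<Omega>A a (conn t)"
      by (simp add: conn_def \<Omega>A_ops crossed_lact_eq mult_map_left_linear actions_zero)
  next
    fix t assume "t \<in> carrier BHC"
    thus "vertical_map K H \<Omega>H A coA \<Omega>A (conn t) = t"
      using conn_closed[of t] by (simp add: vertical_map_eq) (simp add: conn_def split_mult)
  qed (rule conn_map_linear conn_colinear, assumption?)+
  moreover have "diff \<Omega>A a \<ominus>\<^bsub>\<Omega>A\<^esub> conn (vertical_map K H \<Omega>H A coA \<Omega>A (diff \<Omega>A a))
      \<in> kspan K \<Omega>A {ract \<Omega>A \<beta> a' | \<beta> a'. \<beta> \<in> base_forms K H B \<Omega>H \<Omega>B \<and> a' \<in> carrier A}"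
    if "a \<in> carrier A" for a
  proof -
    have a: "a \<in> carrier BH" using that by (simp add: A_ops)
    let ?Z = "(diffA_hor a, \<zero>\<^bsub>Ver\<^esub>)" and ?Y = "(\<zero>\<^bsub>Hor\<^esub>, diffA_ver a)"
    have d: "diff \<Omega>A a = (diffA_hor a, diffA_ver a)" unfolding \<Omega>A_ops by (rule crossed_diff_eq)
    have mem: "?Z \<in> carrier \<Omega>A" "?Y \<in> carrier \<Omega>A" using a by (simp_all add: \<Omega>A_ops)
    have "diff \<Omega>A a = ?Z \<oplus>\<^bsub>\<Omega>A\<^esub> ?Y" using a by (simp add: crossed_diff_eq \<Omega>A_ops)
    moreover have "conn (vertical_map K H \<Omega>H A coA \<Omega>A (diff \<Omega>A a)) = ?Y"
      using a by (simp add: d vertical_map_eq conn_def mult_split)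
    ultimately have "diff \<Omega>A a \<ominus>\<^bsub>\<Omega>A\<^esub> conn (vertical_map K H \<Omega>H A coA \<Omega>A (diff \<Omega>A a)) = ?Z"
      using mem by (simp add: \<Omega>A.minus_eq \<Omega>A.a_assoc \<Omega>A.r_neg)
    thus ?thesis using horizontal_in_span a by simp
  qed
  ultimately show ?thesis unfolding strong_connection_def by blast
qed

lemma conn_pure:
  assumes "b \<in> carrier B" "h \<in> carrier H" "\<gamma> \<in> carrier Coinv"
  shows "conn (pure_tensor K A Coinv (pure_tensor K B H b h) \<gamma>) = (\<zero>\<^bsub>Hor\<^esub>, pure_tensor K B \<Omega>H b (lact \<Omega>H h \<gamma>))"
  using assms by (simp add: A_tensor conn_def mult_map_pure_pure)

end

theorem proposition3p19:
  fixes K :: "('k, 'r) ring_scheme"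
    and H :: "('k, 'h, 'x) hopf_scheme"
    and B :: "('k, 'b, 'y) module_scheme"
    and act :: "'h \<Rightarrow> 'b \<Rightarrow> 'b"
    and \<sigma> \<sigma>' :: "('h \<times> 'h) list set \<Rightarrow> 'b"
    and \<Omega>H :: "('k, 'm, 'h, 'w) bicovariant_calculus_scheme"
    and \<Omega>B :: "('k, 'v, 'b, 'z) calculus_scheme"
    and actf :: "'h \<Rightarrow> 'v \<Rightarrow> 'v"
  defines "A \<equiv> crossed_product K H B act \<sigma>"
    and "\<Omega>A \<equiv> crossed_calculus K H B act \<sigma> \<Omega>H \<Omega>B actf"
  assumes "field K"
    and "hopf_algebra K H"
    and "bij_betw (antipode H) (carrier H) (carrier H)"
    and "twisted_module_algebra K H B act \<sigma> \<sigma>'"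
    and "bicovariant_fodc K H \<Omega>H"
    and "twisted_module_fodc K H B act \<sigma> \<sigma>' \<Omega>B actf"
  shows "\<exists>c. strong_connection K H \<Omega>H A (crossed_coact K H B) \<Omega>A
               (crossed_calculus_coact K H B \<Omega>H \<Omega>B) (base_forms K H B \<Omega>H \<Omega>B) c \<and>
             (\<forall>b\<in>carrier B. \<forall>h\<in>carrier H. \<forall>\<gamma>\<in>carrier (coinv_forms K H \<Omega>H).
                c (pure_tensor K A (coinv_forms K H \<Omega>H) (pure_tensor K B H b h) \<gamma>)
                = (\<zero>\<^bsub>tensor K \<Omega>B H\<^esub>, pure_tensor K B \<Omega>H b (lact \<Omega>H h \<gamma>)))"
proof -
  interpret crossed_product_calculus K H B act \<sigma> \<sigma>' \<Omega>H \<Omega>B actf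
    by (intro crossed_product_calculus.intro) fact+
  show ?thesis
    unfolding A_def \<Omega>A_def using strong_connection_conn conn_pure by blast
qed

end
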